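(* There is a universal constant $C>0$ such that for every integer $N\ge2$ and every $\delta>0$ there is a quantum algorithm that uses no advice at all and solves $\mathsf{maxQPE}_{N,\delta}$ in the unknown-eigenbasis case (and hence also in the known-eigenbasis case, and a fortiori whenever any advice states or advice unitaries are made available) with cost at most $C\,\frac{\sqrt N\log N}{\delta}$.
   Context: Model of computation. The input is an unknown $N$-dimensional unitary $U$. The state space is $\mathbb{C}^N\otimes W$, where the first register is $N$-dimensional with computational basis $|0\rangle,\dots,|N-1\rangle$ and $W$ is an arbitrarily large (finite-dimensional) workspace. The algorithm starts in $|0\rangle|0\rangle$; it may apply $U$ and $U^{-1}$ to the first register (possibly controlled by a qubit of the workspace), and arbitrary unitaries independent of $U$ to the whole space; at the end it performs a POVM (independent of $U$) which determines the classical output. The cost of the algorithm is the total number of applications of $U$ and $U^{-1}$ (including controlled versions); all other operations are free. Logarithms are base 2. The task $\mathsf{maxQPE}_{N,\delta}$ (without advice). Let $U=\sum_{j=0}^{N-1}e^{i\theta_j}|u_j\rangle\langle u_j|$ with orthonormal eigenbasis $(|u_j\rangle)$ and $\theta_j\in[0,2\pi)$, and let $\theta_{\max}=\max_j\theta_j$. Input promise: $\theta_{\max}\in[0,2\pi-2\delta)$. In the known-eigenbasis case $U$ is moreover promised to be diagonal in the computational basis; in the unknown-eigenbasis case the eigenbasis is arbitrary and unknown. Output: with probability at least $2/3$, a value in $[\theta_{\max}-\delta,\theta_{\max}+\delta]$ modulo $2\pi$. The algorithm must be correct for every $U$ satisfying the promise. *)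

theory Defs
  imports Complex_Main "Jordan_Normal_Form.Schur_Decomposition"
begin

text \<open>
  The dimension \<open>N\<close> is quantified inside the statement, so operators are matrices with
  explicit carriers. The state space is \<open>\<complex>\<^sup>N \<otimes> \<complex>\<^sup>d\<close> (input register, then a workspace of
  dimension \<open>d\<close>), and the basis state \<open>|i\<rangle>|w\<rangle>\<close> has index \<open>i * d + w\<close>.
\<close>

definition kron :: "complex mat \<Rightarrow> complex mat \<Rightarrow> complex mat" where
  "kron A B = mat (dim_row A * dim_row B) (dim_col A * dim_col B)
     (\<lambda>(r, c). A $$ (r div dim_row B, c div dim_col B) * B $$ (r mod dim_row B, c mod dim_col B))"

definition unitary_mat :: "nat \<Rightarrow> complex mat \<Rightarrow> bool" where
  "unitary_mat n V \<longleftrightarrow> V \<in> carrier_mat n n \<and>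
     mat_adjoint V * V = 1\<^sub>m n \<and> V * mat_adjoint V = 1\<^sub>m n"

text \<open>The order on complex numbers is that of \<open>Complex_Order\<close>: \<open>0 \<le> z\<close> means that \<open>z\<close> is real and
  nonnegative.\<close>

definition positive_mat :: "nat \<Rightarrow> complex mat \<Rightarrow> bool" where
  "positive_mat n E \<longleftrightarrow> E \<in> carrier_mat n n \<and>
     (\<forall>v \<in> carrier_vec n. 0 \<le> (E *\<^sub>v v) \<bullet>c v)"

text \<open>
  A workspace qubit is a tensor factor \<open>\<complex>\<^sup>2\<close> in \<open>\<complex>\<^sup>d = \<complex>\<^sup>m \<otimes> \<complex>\<^sup>2 \<otimes> \<complex>\<^sup>k\<close>; it is named by its
  stride \<open>k\<close>, where \<open>2 * k\<close> divides \<open>d\<close>, and its value in the basis state \<open>|w\<rangle>\<close> is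
  \<open>(w div k) mod 2\<close>. For \<open>d = 2 ^ q\<close> the strides are \<open>2 ^ 0, \<dots>, 2 ^ (q - 1)\<close>, that is, all the
  \<open>q\<close> qubits.
\<close>

definition qubit_proj :: "nat \<Rightarrow> nat \<Rightarrow> nat \<Rightarrow> complex mat" where
  "qubit_proj d k b = mat d d (\<lambda>(v, w). if v = w \<and> (w div k) mod 2 = b then 1 else 0)"

text \<open>\<open>Free V\<close> is an input-independent unitary on the whole space. \<open>Query adj ctrl\<close> applies the
  input unitary, or its inverse if \<open>adj\<close>, to the first register, with the workspace qubit
  \<open>k\<close> as control if \<open>ctrl = Some k\<close>.\<close>

datatype gate = Free "complex mat" | Query bool "nat option"

text \<open>The measurement is a list of pairs of a POVM element and the real number that is
  output when the corresponding outcome occurs.\<close>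

record qalg =
  work_dim :: nat
  gates :: "gate list"
  povm :: "(complex mat \<times> real) list"

fun gate_ok :: "nat \<Rightarrow> nat \<Rightarrow> gate \<Rightarrow> bool" where
  "gate_ok N d (Free V) = unitary_mat (N * d) V"
| "gate_ok N d (Query adj None) = True"
| "gate_ok N d (Query adj (Some k)) = (0 < k \<and> 2 * k dvd d)"

definition povm_ok :: "nat \<Rightarrow> (complex mat \<times> real) list \<Rightarrow> bool" where
  "povm_ok n M \<longleftrightarrow> (\<forall>E \<in> set (map fst M). positive_mat n E) \<and>
     foldr (+) (map fst M) (0\<^sub>m n n) = 1\<^sub>m n"

definition quantum_algorithm :: "nat \<Rightarrow> qalg \<Rightarrow> bool" where
  "quantum_algorithm N A \<longleftrightarrow> 0 < work_dim A \<and>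
     (\<forall>g \<in> set (gates A). gate_ok N (work_dim A) g) \<and>
     povm_ok (N * work_dim A) (povm A)"

text \<open>Inputs are unitary, so the adjoint below is the inverse.\<close>

definition query_mat :: "complex mat \<Rightarrow> bool \<Rightarrow> complex mat" where
  "query_mat U adj = (if adj then mat_adjoint U else U)"

fun gate_mat :: "nat \<Rightarrow> nat \<Rightarrow> complex mat \<Rightarrow> gate \<Rightarrow> complex mat" where
  "gate_mat N d U (Free V) = V"
| "gate_mat N d U (Query adj None) = kron (query_mat U adj) (1\<^sub>m d)"
| "gate_mat N d U (Query adj (Some k)) =
     kron (1\<^sub>m N) (qubit_proj d k 0) + kron (query_mat U adj) (qubit_proj d k 1)"

definition final_state :: "nat \<Rightarrow> qalg \<Rightarrow> complex mat \<Rightarrow> complex vec" where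
  "final_state N A U =
     foldl (\<lambda>\<psi> g. gate_mat N (work_dim A) U g *\<^sub>v \<psi>) (unit_vec (N * work_dim A) 0) (gates A)"

definition output_prob :: "nat \<Rightarrow> qalg \<Rightarrow> complex mat \<Rightarrow> real set \<Rightarrow> real" where
  "output_prob N A U S = (\<Sum>(E, x) \<leftarrow> povm A.
     if x \<in> S then Re ((E *\<^sub>v final_state N A U) \<bullet>c final_state N A U) else 0)"

fun is_query :: "gate \<Rightarrow> bool" where
  "is_query (Free V) = False"
| "is_query (Query adj ctrl) = True"

definition cost :: "qalg \<Rightarrow> nat" where
  "cost A = length (filter is_query (gates A))"

definition orthonormal_basis :: "nat \<Rightarrow> (nat \<Rightarrow> complex vec) \<Rightarrow> bool" where
  "orthonormal_basis N u \<longleftrightarrow> (\<forall>j<N. u j \<in> carrier_vec N) \<and>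
     (\<forall>i<N. \<forall>j<N. u i \<bullet>c u j = (if i = j then 1 else 0))"

text \<open>\<open>U = (\<Sum>j<N. cis (\<theta> j) |u j\<rangle>\<langle>u j|)\<close>, written entrywise.\<close>

definition eigendecomposition ::
  "nat \<Rightarrow> complex mat \<Rightarrow> (nat \<Rightarrow> real) \<Rightarrow> (nat \<Rightarrow> complex vec) \<Rightarrow> bool" where
  "eigendecomposition N U \<theta> u \<longleftrightarrow> orthonormal_basis N u \<and>
     (\<forall>j<N. \<theta> j \<in> {0..<2 * pi}) \<and>
     U = mat N N (\<lambda>(a, b). \<Sum>j<N. cis (\<theta> j) * (u j $ a * cnj (u j $ b)))"

definition max_phase :: "nat \<Rightarrow> (nat \<Rightarrow> real) \<Rightarrow> real" where
  "max_phase N \<theta> = Max (\<theta> ` {..<N})"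

text \<open>Pairs of an input satisfying the promise and its largest eigenphase.\<close>

definition unknown_eigenbasis_inputs :: "nat \<Rightarrow> real \<Rightarrow> (complex mat \<times> real) set" where
  "unknown_eigenbasis_inputs N \<delta> = {(U, max_phase N \<theta>) | U \<theta> u.
     eigendecomposition N U \<theta> u \<and> max_phase N \<theta> \<in> {0..<2 * pi - 2 * \<delta>}}"

definition known_eigenbasis_inputs :: "nat \<Rightarrow> real \<Rightarrow> (complex mat \<times> real) set" where
  "known_eigenbasis_inputs N \<delta> = {(U, t) \<in> unknown_eigenbasis_inputs N \<delta>. diagonal_mat U}"

definition correct_outputs :: "real \<Rightarrow> real \<Rightarrow> real set" where
  "correct_outputs \<delta> t = {x. \<exists>k::int. x + 2 * pi * of_int k \<in> {t - \<delta>..t + \<delta>}}"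

definition solves_maxQPE_on :: "nat \<Rightarrow> real \<Rightarrow> (complex mat \<times> real) set \<Rightarrow> qalg \<Rightarrow> bool" where
  "solves_maxQPE_on N \<delta> inputs A \<longleftrightarrow>
     (\<forall>(U, t) \<in> inputs. output_prob N A U (correct_outputs \<delta> t) \<ge> 2 / 3)"

end

theory Submission
  imports Defs
begin

text \<open>
  Applied to the first half of the maximally entangled state, the input acts as a diagonal unitary on
  a uniform superposition of eigenphases, whatever the eigenbasis is. Phase estimation with a
  sufficiently smooth window of length \<open>O(log N / \<delta>)\<close> then yields an estimate that is off by more than
  \<open>\<delta>\<close> only with probability \<open>O(1 / N)\<close>. The maximum is found by quantum maximum finding: amplify
  the estimates beyond a threshold by a random number of Grover iterations, measure, and raise the
  threshold. With iteration bounds growing geometrically to \<open>O(\<surd>N)\<close>, the expected probability mass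
  beyond the threshold falls to a small fraction of \<open>1 / N\<close>, and the total amplification of the
  false estimates stays bounded.

  No circuit is written down. Two families of states, indexed by the inputs, are related by an
  input-independent unitary iff their Gram matrices agree, so only the Gram kernels
  \<open>(U, U') \<mapsto> \<langle>\<psi>\<^sub>U, \<psi>\<^sub>U\<^sub>'\<rangle>\<close> matter. What a fixed number of queries can do to such kernels is closed
  under sums and under products with Gram kernels, and this makes intermediate measurements, random
  choices and adaptivity available for free.
\<close>

section \<open>Isometries between families with equal Gram matrices\<close>

text \<open>The obstacle is that estimates are fuzzy. Amplification that lifts a probability of
  order 1 / N to a constant lifts the false estimates above the maximum by a factor of order N as
  well. With the usual flat window, errors beyond \<delta> decay only polynomially in the number of
  queries. A window that is a power of a box decays exponentially in the exponent \<open>L\<close>,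
  so \<open>L\<close> of order log N makes the false mass a small multiple of 1 / N. This is the
  only source of the logarithm in the cost.

  The search adds no second logarithm. Its iteration bounds grow geometrically, so their sum is of
  the order of the last one, sqrt N, and the sum of their squares, which controls the amplified
  false mass, is of order N. What is searched is a probability distribution of estimates, not a list
  of N values; hence progress is measured by the expected mass \<tau> beyond the threshold rather
  than by a rank. The failure indicator is dominated by \<open>overshoot\<close> plus 2 N \<tau>: a
  union bound for the former and a Markov bound for the latter finish the proof.\<close>

lemma finite_spanning_subset:
  fixes f :: "'s \<Rightarrow> nat \<Rightarrow> complex"
  shows "\<exists>F. finite F \<and> F \<subseteq> S \<and>
    (\<forall>s\<in>S. \<exists>c. \<forall>i<n. f s i = (\<Sum>t\<in>F. c t * f t i))"
proof (induction n)
  case 0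
  show ?case by (rule exI[of _ "{}"]) auto
next
  case (Suc n)
  then obtain F where F: "finite F" "F \<subseteq> S"
    and "\<forall>s\<in>S. \<exists>c. \<forall>i<n. f s i = (\<Sum>t\<in>F. c t * f t i)"
    by blast
  then obtain c where c: "\<And>s i. s \<in> S \<Longrightarrow> i < n \<Longrightarrow> f s i = (\<Sum>t\<in>F. c s t * f t i)"
    by metis
  \<comment> \<open>The error in coordinate \<open>n\<close> of a combination that is exact in the
    first \<open>n\<close> coordinates. One further index with nonzero error suffices to correct it
    for every \<open>s\<close>.\<close>
  define r where "r s = f s n - (\<Sum>t\<in>F. c s t * f t n)" for s
  show ?case
  proof (cases "\<forall>s\<in>S. r s = 0")
    case True
    then have "\<forall>s\<in>S. \<forall>i<Suc n. f s i = (\<Sum>t\<in>F. c s t * f t i)"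
      using c by (auto simp: r_def less_Suc_eq)
    then show ?thesis using F by blast
  next
    case False
    then obtain s0 where s0: "s0 \<in> S" "r s0 \<noteq> 0" by blast
    let ?F = "insert s0 F"
    have "\<exists>d. \<forall>i<Suc n. f s i = (\<Sum>t\<in>?F. d t * f t i)" if s: "s \<in> S" for s
    proof -
      define l where "l = r s / r s0"
      \<comment> \<open>The two terms are kept apart because \<open>s0\<close> may already belong to
        \<open>F\<close>: the chosen \<open>c s0\<close> need not be the trivial
        combination.\<close>
      define d where "d t = (if t \<in> F then c s t - l * c s0 t else 0) + (if t = s0 then l else 0)" for t
      have "(\<Sum>t\<in>?F. d t * f t i)
          = (\<Sum>t\<in>F. c s t * f t i) + l * (f s0 i - (\<Sum>t\<in>F. c s0 t * f t i))" for i
      proof -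
        have "(\<Sum>t\<in>?F. d t * f t i)
          = (\<Sum>t\<in>?F. (if t \<in> F then c s t - l * c s0 t else 0) * f t i)
            + (\<Sum>t\<in>?F. (if t = s0 then l else 0) * f t i)"
          by (simp only: d_def distrib_right sum.distrib)
        also have "(\<Sum>t\<in>?F. (if t \<in> F then c s t - l * c s0 t else 0) * f t i)
          = (\<Sum>t\<in>F. (if t \<in> F then c s t - l * c s0 t else 0) * f t i)"
          using F by (intro sum.mono_neutral_right) auto
        also have "\<dots> = (\<Sum>t\<in>F. (c s t - l * c s0 t) * f t i)"
          by (intro sum.cong) auto
        also have "(\<Sum>t\<in>?F. (if t = s0 then l else 0) * f t i) = l * f s0 i"
          using F by (subst sum.cong[OF refl, of _ _ "\<lambda>t. if t = s0 then l * f t i else 0"])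
            (auto simp: sum.delta simp del: sum.insert_remove)
        finally show ?thesis
          by (simp add: algebra_simps sum_subtractf sum_distrib_left)
      qed
      then have "\<forall>i<Suc n. f s i = (\<Sum>t\<in>?F. d t * f t i)"
        using c[OF s] c[OF s0(1)] s0(2) by (auto simp: less_Suc_eq l_def r_def)
      then show ?thesis by blast
    qed
    then show ?thesis using F s0 by (intro exI[of _ ?F]) auto
  qed
qed

definition isometry_coeffs :: "nat \<Rightarrow> (nat \<Rightarrow> nat \<Rightarrow> complex) \<Rightarrow> bool" where
  "isometry_coeffs n M \<longleftrightarrow>
    (\<forall>i<n. \<forall>j<n. (\<Sum>k<n. cnj (M k i) * M k j) = (if i = j then 1 else 0))"

lemma sum_delta_complex:
  fixes f :: "nat \<Rightarrow> complex"
  assumes "j < n"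
  shows "(\<Sum>i<n. (if i = j then 1 else 0) * f i) = f j"
    and "(\<Sum>i<n. (if j = i then 1 else 0) * f i) = f j"
  using assms by (subst sum.cong[OF refl, of _ _ "\<lambda>i. if i = j then f i else 0"]; auto)+

lemma sum_inner_expand:
  fixes c d :: "'j \<Rightarrow> complex"
  shows "(\<Sum>x\<in>X. cnj (\<Sum>j\<in>J. p j x * c j) * (\<Sum>k\<in>J. q k x * d k))
    = (\<Sum>j\<in>J. \<Sum>k\<in>J. (\<Sum>x\<in>X. cnj (p j x) * q k x) * (cnj (c j) * d k))"
proof -
  have "(\<Sum>x\<in>X. cnj (\<Sum>j\<in>J. p j x * c j) * (\<Sum>k\<in>J. q k x * d k))
      = (\<Sum>x\<in>X. \<Sum>j\<in>J. \<Sum>k\<in>J. cnj (p j x) * q k x * (cnj (c j) * d k))"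
    unfolding cnj_sum complex_cnj_mult sum_product by (simp only: mult_ac)
  also have "\<dots> = (\<Sum>j\<in>J. \<Sum>x\<in>X. \<Sum>k\<in>J. cnj (p j x) * q k x * (cnj (c j) * d k))"
    by (rule sum.swap)
  also have "\<dots> = (\<Sum>j\<in>J. \<Sum>k\<in>J. \<Sum>x\<in>X. cnj (p j x) * q k x * (cnj (c j) * d k))"
    by (intro sum.cong refl sum.swap)
  finally show ?thesis by (simp add: sum_distrib_right)
qed

lemma isometry_coeffs_inner:
  assumes "isometry_coeffs n M"
  shows "(\<Sum>k<n. cnj (\<Sum>i<n. M k i * v i) * (\<Sum>j<n. M k j * w j)) = (\<Sum>i<n. cnj (v i) * w i)"
proof -
  have "(\<Sum>k<n. cnj (\<Sum>i<n. M k i * v i) * (\<Sum>j<n. M k j * w j))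
      = (\<Sum>i<n. \<Sum>j<n. (if j = i then 1 else 0) * (cnj (v i) * w j))"
    unfolding sum_inner_expand
    using assms by (intro sum.cong refl) (simp add: isometry_coeffs_def)
  also have "\<dots> = (\<Sum>i<n. cnj (v i) * w i)"
    by (intro sum.cong refl) (simp add: if_distrib[of "\<lambda>x. x * _"] cong: if_cong)
  finally show ?thesis .
qed

lemma isometry_coeffs_compose:
  assumes "isometry_coeffs n M" "isometry_coeffs n M'"
  shows "isometry_coeffs n (\<lambda>i j. \<Sum>k<n. M' i k * M k j)"
  using assms(1) isometry_coeffs_inner[OF assms(2)] unfolding isometry_coeffs_def by simp

text \<open>For \<open>\<parallel>x\<parallel> = \<parallel>y\<parallel>\<close> and \<open>d = x - y \<noteq> 0\<close>, the complex reflection \<open>I - d d\<^sup>* / \<langle>d, x\<rangle>\<close> is unitary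
  because \<open>2 Re \<langle>d, x\<rangle> = \<parallel>d\<parallel>\<^sup>2\<close>; it maps \<open>x\<close> to \<open>y\<close> and fixes the orthogonal complement of \<open>d\<close>.\<close>

lemma complex_reflection:
  fixes x y :: "nat \<Rightarrow> complex"
  assumes eq: "(\<Sum>i<n. cnj (x i) * x i) = (\<Sum>i<n. cnj (y i) * y i)"
  shows "\<exists>M. isometry_coeffs n M \<and> (\<forall>i<n. (\<Sum>j<n. M i j * x j) = y i) \<and>
    (\<forall>v. (\<Sum>i<n. cnj (x i - y i) * v i) = 0 \<longrightarrow> (\<forall>i<n. (\<Sum>j<n. M i j * v j) = v i))"
proof (cases "\<forall>i<n. x i = y i")
  case True
  then show ?thesis
    by (intro exI[of _ "\<lambda>i j. if j = i then 1 else 0"])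
      (auto simp: isometry_coeffs_def sum_delta_complex if_distrib[of cnj] cong: if_cong)
next
  case False
  define d where "d i = x i - y i" for i
  define z where "z = (\<Sum>i<n. cnj (d i) * x i)"
  define e where "e = (\<Sum>i<n. cnj (d i) * d i)"
  have e_norm: "e = of_real (\<Sum>i<n. (cmod (d i))\<^sup>2)"
    by (simp add: e_def complex_norm_square mult.commute del: of_real_power)
  have ze: "z + cnj z = e"
  proof -
    have "z + cnj z - e = (\<Sum>i<n. cnj (x i) * x i) - (\<Sum>i<n. cnj (y i) * y i)"
      unfolding z_def e_def d_def
      by (simp add: sum.distrib[symmetric] sum_subtractf[symmetric] algebra_simps)
    then show ?thesis using eq by simp
  qed
  have "e \<noteq> 0"
  proof
    assume "e = 0"
    then have "(\<Sum>i<n. (cmod (d i))\<^sup>2) = 0" unfolding e_norm using of_real_eq_0_iff by blast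
    then have "\<forall>i<n. d i = 0" by (simp add: sum_nonneg_eq_0_iff)
    then show False using False by (simp add: d_def)
  qed
  then have z0: "z \<noteq> 0" "cnj z \<noteq> 0" using ze by auto
  then have "1 / z + 1 / cnj z = (z + cnj z) / (z * cnj z)" by (simp add: add_frac_eq)
  with z0 have z: "z \<noteq> 0" "cnj z \<noteq> 0" "1 / z + 1 / cnj z = e / (z * cnj z)"
    by (simp_all add: ze)
  define M where "M i j = (if j = i then 1 else 0) - d i * cnj (d j) / z" for i j
  have M: "(\<Sum>j<n. M i j * v j) = v i - d i * (\<Sum>j<n. cnj (d j) * v j) / z" if "i < n" for i v
  proof -
    have "(\<Sum>j<n. M i j * v j)
        = (\<Sum>j<n. (if j = i then 1 else 0) * v j) - (\<Sum>j<n. d i * (cnj (d j) * v j) / z)"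
      by (simp add: M_def left_diff_distrib sum_subtractf mult.assoc)
    then show ?thesis
      using that by (simp add: sum_delta_complex sum_distrib_left sum_divide_distrib)
  qed
  have "isometry_coeffs n M"
    unfolding isometry_coeffs_def
  proof (intro allI impI)
    fix i j assume ij: "i < n" "j < n"
    have "(\<Sum>k<n. cnj (M k i) * M k j)
      = (\<Sum>k<n. (if k = i then 1 else 0) * (if j = k then 1 else 0))
        - (\<Sum>k<n. (if k = i then 1 else 0) * (d k * cnj (d j) / z))
        - (\<Sum>k<n. (if k = j then 1 else 0) * (cnj (d k) * d i / cnj z))
        + (\<Sum>k<n. cnj (d k) * d k) * (d i * cnj (d j) / (z * cnj z))"
      unfolding sum_subtractf[symmetric] sum_distrib_right sum.distrib[symmetric]
      by (intro sum.cong refl) (auto simp: M_def algebra_simps)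
    also have "\<dots> = (if j = i then 1 else 0) - d i * cnj (d j) / z
        - cnj (d j) * d i / cnj z + e * (d i * cnj (d j) / (z * cnj z))"
      by (simp only: sum_delta_complex[OF ij(1)] sum_delta_complex[OF ij(2)] e_def)
    also have "\<dots> = (if j = i then 1 else 0)
        - d i * cnj (d j) * (1 / z + 1 / cnj z - e / (z * cnj z))"
      by (simp add: algebra_simps)
    also have "\<dots> = (if i = j then 1 else 0)"
      using z by simp
    finally show "(\<Sum>k<n. cnj (M k i) * M k j) = (if i = j then 1 else 0)" .
  qed
  moreover have "\<forall>i<n. (\<Sum>j<n. M i j * x j) = y i"
    using z by (simp add: M z_def[symmetric]) (simp add: d_def)
  moreover have "\<forall>v. (\<Sum>i<n. cnj (x i - y i) * v i) = 0 \<longrightarrow> (\<forall>i<n. (\<Sum>j<n. M i j * v j) = v i)"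
    by (auto simp: M d_def)
  ultimately show ?thesis by blast
qed

text \<open>The vectors are matched one at a time. A reflection moves the image of the new vector to
  its target. Image and target have the same inner products with the earlier targets, so these are
  orthogonal to the difference and stay fixed.\<close>

lemma isometry_extending_finite:
  fixes f g :: "'s \<Rightarrow> nat \<Rightarrow> complex"
  assumes "finite F"
    and "\<And>s t. s \<in> F \<Longrightarrow> t \<in> F \<Longrightarrow>
      (\<Sum>i<n. cnj (f s i) * f t i) = (\<Sum>i<n. cnj (g s i) * g t i)"
  shows "\<exists>M. isometry_coeffs n M \<and> (\<forall>s\<in>F. \<forall>i<n. (\<Sum>j<n. M i j * f s j) = g s i)"
  using assms
proof (induction F rule: finite_induct)
  case empty
  show ?case
    by (intro exI[of _ "\<lambda>i j. if j = i then 1 else 0"])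
      (auto simp: isometry_coeffs_def sum_delta_complex if_distrib[of cnj] cong: if_cong)
next
  case (insert a F)
  have "\<exists>M. isometry_coeffs n M \<and> (\<forall>s\<in>F. \<forall>i<n. (\<Sum>j<n. M i j * f s j) = g s i)"
    by (rule insert.IH, rule insert.prems) auto
  then obtain M where M: "isometry_coeffs n M"
    and Mf: "\<And>s i. s \<in> F \<Longrightarrow> i < n \<Longrightarrow> (\<Sum>j<n. M i j * f s j) = g s i"
    by blast
  define x where "x i = (\<Sum>j<n. M i j * f a j)" for i
  have "(\<Sum>i<n. cnj (x i) * x i) = (\<Sum>i<n. cnj (g a i) * g a i)"
    unfolding x_def isometry_coeffs_inner[OF M] using insert.prems by simp
  from complex_reflection[OF this] obtain R where R: "isometry_coeffs n R"
    and Rx: "\<And>i. i < n \<Longrightarrow> (\<Sum>j<n. R i j * x j) = g a i"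
    and Rv: "\<And>v i. (\<Sum>i<n. cnj (x i - g a i) * v i) = 0 \<Longrightarrow> i < n \<Longrightarrow> (\<Sum>j<n. R i j * v j) = v i"
    by blast
  have orth: "(\<Sum>i<n. cnj (x i - g a i) * g s i) = 0" if "s \<in> F" for s
  proof -
    have "(\<Sum>i<n. cnj (x i) * g s i) = (\<Sum>i<n. cnj (x i) * (\<Sum>j<n. M i j * f s j))"
      using Mf[OF that] by simp
    also have "\<dots> = (\<Sum>i<n. cnj (f a i) * f s i)"
      unfolding x_def by (rule isometry_coeffs_inner[OF M])
    also have "\<dots> = (\<Sum>i<n. cnj (g a i) * g s i)"
      using insert.prems that by simp
    finally show ?thesis by (simp add: left_diff_distrib sum_subtractf)
  qed
  define MR where "MR i j = (\<Sum>k<n. R i k * M k j)" for i j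
  have MR: "(\<Sum>j<n. MR i j * v j) = (\<Sum>k<n. R i k * (\<Sum>j<n. M k j * v j))" for i v
    unfolding MR_def sum_distrib_left sum_distrib_right
    by (subst sum.swap) (simp add: mult_ac)
  have "\<forall>s\<in>insert a F. \<forall>i<n. (\<Sum>j<n. MR i j * f s j) = g s i"
  proof (intro ballI allI impI)
    fix s i assume s: "s \<in> insert a F" and i: "i < n"
    show "(\<Sum>j<n. MR i j * f s j) = g s i"
    proof (cases "s = a")
      case True
      then show ?thesis unfolding MR using Rx[OF i] by (simp add: x_def)
    next
      case False
      with s have "s \<in> F" by simp
      then show ?thesis unfolding MR using Mf Rv[OF orth i] by simp
    qed
  qed
  moreover have "isometry_coeffs n MR"
    unfolding MR_def by (rule isometry_coeffs_compose[OF M R])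
  ultimately show ?case by blast
qed

text \<open>\<open>S\<close> may be infinite, so only a finite spanning subfamily is matched. The
  Gram matrix forces the rest: when the squared norm of the difference between the image of
  \<open>f s\<close> and \<open>g s\<close> is expanded, its four terms cancel.\<close>

lemma isometry_extending:
  fixes f g :: "'s \<Rightarrow> nat \<Rightarrow> complex"
  assumes gram: "\<And>s t. s \<in> S \<Longrightarrow> t \<in> S \<Longrightarrow>
      (\<Sum>i<n. cnj (f s i) * f t i) = (\<Sum>i<n. cnj (g s i) * g t i)"
  shows "\<exists>M. isometry_coeffs n M \<and> (\<forall>s\<in>S. \<forall>i<n. (\<Sum>j<n. M i j * f s j) = g s i)"
proof -
  obtain F where F: "finite F" "F \<subseteq> S"
    and span: "\<And>s. s \<in> S \<Longrightarrow> \<exists>c. \<forall>i<n. f s i = (\<Sum>t\<in>F. c t * f t i)"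
    using finite_spanning_subset[of S n f] by blast
  have "\<exists>M. isometry_coeffs n M \<and> (\<forall>s\<in>F. \<forall>i<n. (\<Sum>j<n. M i j * f s j) = g s i)"
    using F by (intro isometry_extending_finite gram) auto
  then obtain M where M: "isometry_coeffs n M"
    and Mf: "\<And>s i. s \<in> F \<Longrightarrow> i < n \<Longrightarrow> (\<Sum>j<n. M i j * f s j) = g s i" by blast
  have "(\<Sum>j<n. M i j * f s j) = g s i" if s: "s \<in> S" and i: "i < n" for s i
  proof -
    obtain c where c: "\<And>i. i < n \<Longrightarrow> f s i = (\<Sum>t\<in>F. c t * f t i)"
      using span[OF s] by blast
    define h where "h i = (\<Sum>j<n. M i j * f s j)" for i
    have h: "h i = (\<Sum>t\<in>F. c t * g t i)" if "i < n" for i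
    proof -
      have "h i = (\<Sum>j<n. \<Sum>t\<in>F. M i j * (c t * f t j))"
        unfolding h_def using c by (intro sum.cong refl) (simp add: sum_distrib_left)
      also have "\<dots> = (\<Sum>t\<in>F. c t * (\<Sum>j<n. M i j * f t j))"
        by (subst sum.swap) (simp add: sum_distrib_left mult_ac)
      also have "\<dots> = (\<Sum>t\<in>F. c t * g t i)"
        using Mf that by simp
      finally show ?thesis .
    qed
    have gh: "(\<Sum>i<n. cnj (g u i) * h i) = (\<Sum>i<n. cnj (f u i) * f s i)" if "u \<in> S" for u
    proof -
      have "(\<Sum>i<n. cnj (g u i) * h i) = (\<Sum>i<n. \<Sum>t\<in>F. c t * (cnj (g u i) * g t i))"
        by (simp add: h sum_distrib_left mult_ac)
      also have "\<dots> = (\<Sum>t\<in>F. c t * (\<Sum>i<n. cnj (g u i) * g t i))"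
        by (subst sum.swap) (simp add: sum_distrib_left)
      also have "\<dots> = (\<Sum>t\<in>F. c t * (\<Sum>i<n. cnj (f u i) * f t i))"
        using gram that F by (intro sum.cong refl) (metis subsetD)
      also have "\<dots> = (\<Sum>i<n. \<Sum>t\<in>F. c t * (cnj (f u i) * f t i))"
        by (subst sum.swap) (simp add: sum_distrib_left)
      also have "\<dots> = (\<Sum>i<n. cnj (f u i) * f s i)"
        by (simp add: c sum_distrib_left mult_ac)
      finally show ?thesis .
    qed
    have hh: "(\<Sum>i<n. cnj (h i) * h i) = (\<Sum>i<n. cnj (f s i) * f s i)"
      unfolding h_def by (rule isometry_coeffs_inner[OF M])
    have "(\<Sum>i<n. cnj (h i - g s i) * (h i - g s i))
      = (\<Sum>i<n. cnj (h i) * h i) - cnj (\<Sum>i<n. cnj (g s i) * h i)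
        - (\<Sum>i<n. cnj (g s i) * h i) + (\<Sum>i<n. cnj (g s i) * g s i)"
      by (simp add: sum_subtractf[symmetric] sum.distrib[symmetric] algebra_simps)
    also have "\<dots> = 0"
      unfolding gh[OF s] hh gram[OF s s, symmetric] by (simp add: mult.commute)
    finally have "of_real (\<Sum>i<n. (cmod (h i - g s i))\<^sup>2) = (0::complex)"
      by (simp add: complex_norm_square mult.commute del: of_real_power)
    then have "(\<Sum>i<n. (cmod (h i - g s i))\<^sup>2) = 0"
      using of_real_eq_0_iff by blast
    then have "h i = g s i"
      using i by (simp add: sum_nonneg_eq_0_iff)
    then show ?thesis by (simp add: h_def)
  qed
  then show ?thesis using M by blast
qed

section \<open>Queries and Gram kernels\<close>

definition gram :: "'i set \<Rightarrow> ('s \<Rightarrow> 'i \<Rightarrow> complex) \<Rightarrow> 's \<Rightarrow> 's \<Rightarrow> complex" where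
  "gram I f s t = (\<Sum>i\<in>I. cnj (f s i) * f t i)"

definition gram2 :: "'i set \<Rightarrow> 'j set \<Rightarrow> ('s \<Rightarrow> 'i \<Rightarrow> 'j \<Rightarrow> complex) \<Rightarrow> 's \<Rightarrow> 's \<Rightarrow> complex" where
  "gram2 I J v s t = (\<Sum>i\<in>I. \<Sum>j\<in>J. cnj (v s i j) * v t i j)"

locale query_inputs =
  fixes N :: nat and S :: "'s set" and U :: "'s \<Rightarrow> nat \<Rightarrow> nat \<Rightarrow> complex"
  assumes N_pos: "N > 0"
begin

text \<open>Index sets \<open>{..<n}\<close> allow the dimension to be quantified within one type;
  other finite index sets enter through \<open>is_gramI\<close>.\<close>

definition is_gram :: "('s \<Rightarrow> 's \<Rightarrow> complex) \<Rightarrow> bool" where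
  "is_gram K \<longleftrightarrow> (\<exists>n f. \<forall>s\<in>S. \<forall>t\<in>S. K s t = gram {..<n::nat} f s t)"

definition queried :: "bool \<Rightarrow> ('s \<Rightarrow> 'w \<Rightarrow> nat \<Rightarrow> complex) \<Rightarrow> 's \<Rightarrow> 'w \<Rightarrow> nat \<Rightarrow> complex" where
  "queried adj v s w a = (\<Sum>b<N. (if adj then cnj (U s b a) else U s a b) * v s w b)"

text \<open>One controlled query, between input-independent unitaries: \<open>v0\<close> and \<open>v1\<close> are the parts of the
  state on which the control qubit is 0 and 1.\<close>

definition query_step :: "bool \<Rightarrow> ('s \<Rightarrow> 's \<Rightarrow> complex) \<Rightarrow> ('s \<Rightarrow> 's \<Rightarrow> complex) \<Rightarrow> bool" where
  "query_step adj K K' \<longleftrightarrow> (\<exists>n v0 v1. \<forall>s\<in>S. \<forall>t\<in>S.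
     K s t = gram2 {..<n::nat} {..<N} v0 s t + gram2 {..<n} {..<N} v1 s t \<and>
     K' s t = gram2 {..<n} {..<N} v0 s t + gram2 {..<n} {..<N} (queried adj v1) s t)"

fun query_steps :: "bool list \<Rightarrow> ('s \<Rightarrow> 's \<Rightarrow> complex) \<Rightarrow> ('s \<Rightarrow> 's \<Rightarrow> complex) \<Rightarrow> bool" where
  "query_steps [] K K' \<longleftrightarrow> (\<forall>s\<in>S. \<forall>t\<in>S. K s t = K' s t)"
| "query_steps (b # p) K K' \<longleftrightarrow> (\<exists>K1. query_step b K K1 \<and> query_steps p K1 K')"

lemma is_gramI:
  assumes "finite I" and "\<And>s t. s \<in> S \<Longrightarrow> t \<in> S \<Longrightarrow> K s t = gram I f s t"
  shows "is_gram K"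
proof -
  obtain h where h: "bij_betw h {..<card I} I"
    using assms(1) ex_bij_betw_nat_finite by (metis atLeast0LessThan)
  have "K s t = gram {..<card I} (\<lambda>s i. f s (h i)) s t" if "s \<in> S" "t \<in> S" for s t
    unfolding assms(2)[OF that] gram_def
    by (rule sum.reindex_bij_betw[OF h, symmetric])
  then show ?thesis unfolding is_gram_def by blast
qed

lemma is_gram_const: "c \<ge> 0 \<Longrightarrow> is_gram (\<lambda>_ _. of_real c)"
  by (rule is_gramI[of "{()}" _ "\<lambda>_ _. of_real (sqrt c)"])
    (auto simp: gram_def simp flip: of_real_mult)

text \<open>Tensor products of the vectors realise the product; for the sum below they are replaced
  by direct sums.\<close>

lemma is_gram_mult:
  assumes "is_gram K" "is_gram K'"
  shows "is_gram (\<lambda>s t. K s t * K' s t)"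
proof -
  obtain n f m g where fg: "\<And>s t. s \<in> S \<Longrightarrow> t \<in> S \<Longrightarrow> K s t = gram {..<n::nat} f s t"
     "\<And>s t. s \<in> S \<Longrightarrow> t \<in> S \<Longrightarrow> K' s t = gram {..<m::nat} g s t"
    using assms unfolding is_gram_def by blast
  show ?thesis
    by (rule is_gramI[of "{..<n} \<times> {..<m}" _ "\<lambda>s (i, j). f s i * g s j"])
      (auto simp: fg gram_def sum_product sum.cartesian_product mult_ac intro!: sum.cong)
qed

lemma is_gram_add:
  assumes "is_gram K" "is_gram K'"
  shows "is_gram (\<lambda>s t. K s t + K' s t)"
proof -
  obtain n f m g where fg: "\<And>s t. s \<in> S \<Longrightarrow> t \<in> S \<Longrightarrow> K s t = gram {..<n::nat} f s t"
     "\<And>s t. s \<in> S \<Longrightarrow> t \<in> S \<Longrightarrow> K' s t = gram {..<m::nat} g s t"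
    using assms unfolding is_gram_def by blast
  show ?thesis
    by (rule is_gramI[of "{..<n} <+> {..<m}" _ "\<lambda>s. case_sum (f s) (g s)"])
      (auto simp: fg gram_def sum.Plus)
qed

lemma is_gram_sum:
  assumes "finite X" "\<And>x. x \<in> X \<Longrightarrow> is_gram (K x)"
  shows "is_gram (\<lambda>s t. \<Sum>x\<in>X. K x s t)"
  using assms
proof (induction X rule: finite_induct)
  case empty
  show ?case using is_gram_const[of 0] by simp
next
  case (insert x X)
  then show ?case using is_gram_add[of "K x" "\<lambda>s t. \<Sum>x\<in>X. K x s t"] by simp
qed

lemma query_stepI:
  assumes "finite W"
    and "\<And>s t. s \<in> S \<Longrightarrow> t \<in> S \<Longrightarrow> K s t = gram2 W {..<N} v0 s t + gram2 W {..<N} v1 s t"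
    and "\<And>s t. s \<in> S \<Longrightarrow> t \<in> S \<Longrightarrow>
      K' s t = gram2 W {..<N} v0 s t + gram2 W {..<N} (queried adj v1) s t"
  shows "query_step adj K K'"
proof -
  obtain h where h: "bij_betw h {..<card W} W"
    using assms(1) ex_bij_betw_nat_finite by (metis atLeast0LessThan)
  have *: "gram2 W {..<N} v s t = gram2 {..<card W} {..<N} (\<lambda>s w. v s (h w)) s t" for v s t
    unfolding gram2_def by (rule sum.reindex_bij_betw[OF h, symmetric])
  have "queried adj (\<lambda>s w. v1 s (h w)) = (\<lambda>s w. queried adj v1 s (h w))"
    by (intro ext) (simp add: queried_def)
  then show ?thesis
    unfolding query_step_def
    by (intro exI[of _ "card W"] exI[of _ "\<lambda>s w. v0 s (h w)"] exI[of _ "\<lambda>s w. v1 s (h w)"])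
      (auto simp: assms(2,3) *)
qed

lemma query_step_add:
  assumes "query_step b K1 K1'" "query_step b K2 K2'"
  shows "query_step b (\<lambda>s t. K1 s t + K2 s t) (\<lambda>s t. K1' s t + K2' s t)"
proof -
  obtain n v0 v1 where v: "\<And>s t. s \<in> S \<Longrightarrow> t \<in> S \<Longrightarrow>
     K1 s t = gram2 {..<n::nat} {..<N} v0 s t + gram2 {..<n} {..<N} v1 s t \<and>
     K1' s t = gram2 {..<n} {..<N} v0 s t + gram2 {..<n} {..<N} (queried b v1) s t"
    using assms(1) unfolding query_step_def by blast
  obtain m w0 w1 where w: "\<And>s t. s \<in> S \<Longrightarrow> t \<in> S \<Longrightarrow>
     K2 s t = gram2 {..<m::nat} {..<N} w0 s t + gram2 {..<m} {..<N} w1 s t \<and>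
     K2' s t = gram2 {..<m} {..<N} w0 s t + gram2 {..<m} {..<N} (queried b w1) s t"
    using assms(2) unfolding query_step_def by blast
  have q: "queried b (\<lambda>s. case_sum (v1 s) (w1 s)) = (\<lambda>s. case_sum (queried b v1 s) (queried b w1 s))"
    by (intro ext) (simp add: queried_def split: sum.split)
  show ?thesis
    by (rule query_stepI[of "{..<n} <+> {..<m}" _ "\<lambda>s. case_sum (v0 s) (w0 s)"
          "\<lambda>s. case_sum (v1 s) (w1 s)"]; (unfold q)?)
      (auto simp: v w gram2_def sum.Plus)
qed

text \<open>\<open>G\<close> belongs to a register that the query does not touch, such as a
  probability weight or the record of earlier rounds.\<close>

lemma query_step_mult:
  assumes "is_gram G" "query_step b K K'"
  shows "query_step b (\<lambda>s t. G s t * K s t) (\<lambda>s t. G s t * K' s t)"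
proof -
  obtain n v0 v1 where v: "\<And>s t. s \<in> S \<Longrightarrow> t \<in> S \<Longrightarrow>
     K s t = gram2 {..<n::nat} {..<N} v0 s t + gram2 {..<n} {..<N} v1 s t \<and>
     K' s t = gram2 {..<n} {..<N} v0 s t + gram2 {..<n} {..<N} (queried b v1) s t"
    using assms(2) unfolding query_step_def by blast
  obtain m g where g: "\<And>s t. s \<in> S \<Longrightarrow> t \<in> S \<Longrightarrow> G s t = gram {..<m::nat} g s t"
    using assms(1) unfolding is_gram_def by blast
  define scale where "scale v s x a = g s (fst x) * v s (snd x) a"
    for v :: "'s \<Rightarrow> nat \<Rightarrow> nat \<Rightarrow> complex" and s and x :: "nat \<times> nat" and a
  have q: "queried b (scale v) = scale (queried b v)" for v
    by (intro ext) (simp add: queried_def scale_def sum_distrib_left mult_ac)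
  have prod: "gram2 ({..<m} \<times> {..<n}) {..<N} (scale v) s t
      = gram {..<m} g s t * gram2 {..<n} {..<N} v s t" for v s t
  proof -
    have "gram2 ({..<m} \<times> {..<n}) {..<N} (scale v) s t
      = (\<Sum>i<m. \<Sum>w<n. cnj (g s i) * g t i * (\<Sum>a<N. cnj (v s w a) * v t w a))"
      unfolding gram2_def scale_def sum.cartesian_product'
      by (intro sum.cong refl) (simp add: sum_distrib_left mult_ac)
    then show ?thesis by (simp add: gram_def gram2_def sum_product)
  qed
  show ?thesis
    by (rule query_stepI[of "{..<m} \<times> {..<n}" _ "scale v0" "scale v1"])
      (auto simp: v g q prod distrib_left)
qed

text \<open>The control is 0 on the whole state. Idle queries pad shorter runs to a common query
  sequence, so that their kernels can be added.\<close>

lemma query_step_idle: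
  assumes "is_gram K"
  shows "query_step b K K"
proof -
  obtain m g where g: "\<And>s t. s \<in> S \<Longrightarrow> t \<in> S \<Longrightarrow> K s t = gram {..<m::nat} g s t"
    using assms(1) unfolding is_gram_def by blast
  have *: "gram2 {..<m} {..<N} (\<lambda>s w a. if a = 0 then g s w else 0) s t = gram {..<m} g s t" for s t
    using N_pos
    by (simp add: gram_def gram2_def if_distrib[of "\<lambda>x. x * _"] if_distrib[of cnj] cong: if_cong)
  show ?thesis
    by (rule query_stepI[of "{..<m}" _ "\<lambda>s w a. if a = 0 then g s w else 0" "\<lambda>_ _ _. 0"])
      (simp_all add: g * gram2_def[of _ _ "\<lambda>_ _ _. 0"] gram2_def[of _ _ "queried b _"] queried_def)
qed

lemma query_step_cong:
  assumes "query_step b K K'"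
    and "\<And>s t. s \<in> S \<Longrightarrow> t \<in> S \<Longrightarrow> K s t = L s t"
    and "\<And>s t. s \<in> S \<Longrightarrow> t \<in> S \<Longrightarrow> K' s t = L' s t"
  shows "query_step b L L'"
  using assms unfolding query_step_def by metis

lemma query_steps_cong:
  assumes "query_steps p K K'"
    and "\<And>s t. s \<in> S \<Longrightarrow> t \<in> S \<Longrightarrow> K s t = L s t"
    and "\<And>s t. s \<in> S \<Longrightarrow> t \<in> S \<Longrightarrow> K' s t = L' s t"
  shows "query_steps p L L'"
  using assms
proof (induction p arbitrary: K L)
  case Nil
  then show ?case by simp
next
  case (Cons b p)
  then obtain K1 where "query_step b K K1" "query_steps p K1 K'" by auto
  then have "query_step b L K1" "query_steps p K1 L'"
    using Cons query_step_cong[of b K K1 L K1] by blast+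
  then show ?case by auto
qed

lemma query_steps_append:
  assumes "query_steps p K K'" "query_steps q K' K''"
  shows "query_steps (p @ q) K K''"
  using assms
proof (induction p arbitrary: K)
  case Nil
  then show ?case using query_steps_cong[of q K' K'' K K''] by simp
qed auto

lemma query_steps_add:
  assumes "query_steps p K1 K1'" "query_steps p K2 K2'"
  shows "query_steps p (\<lambda>s t. K1 s t + K2 s t) (\<lambda>s t. K1' s t + K2' s t)"
  using assms
proof (induction p arbitrary: K1 K2)
  case (Cons b p)
  then obtain L1 L2 where "query_step b K1 L1" "query_steps p L1 K1'"
    "query_step b K2 L2" "query_steps p L2 K2'" by auto
  then show ?case
    using query_step_add[of b K1 L1 K2 L2] Cons.IH[of L1 L2] by auto
qed simp

lemma query_steps_mult:
  assumes "is_gram G" "query_steps p K K'"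
  shows "query_steps p (\<lambda>s t. G s t * K s t) (\<lambda>s t. G s t * K' s t)"
  using assms(2)
proof (induction p arbitrary: K)
  case (Cons b p)
  then obtain L where "query_step b K L" "query_steps p L K'" by auto
  then show ?case
    using query_step_mult[OF assms(1), of b K L] Cons.IH[of L] by auto
qed simp

lemma query_steps_idle: "is_gram K \<Longrightarrow> query_steps p K K"
  by (induction p) (auto intro: query_step_idle)

lemma query_steps_sum:
  assumes "finite X" "\<And>x. x \<in> X \<Longrightarrow> query_steps p (K x) (K' x)"
  shows "query_steps p (\<lambda>s t. \<Sum>x\<in>X. K x s t) (\<lambda>s t. \<Sum>x\<in>X. K' x s t)"
  using assms
proof (induction X rule: finite_induct)
  case empty
  show ?case using query_steps_idle[OF is_gram_const[of 0], of p] by simp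
next
  case (insert x X)
  then have "query_steps p (K x) (K' x)"
    "query_steps p (\<lambda>s t. \<Sum>x\<in>X. K x s t) (\<lambda>s t. \<Sum>x\<in>X. K' x s t)"
    by auto
  from query_steps_add[OF this] show ?case using insert.hyps by simp
qed

end

section \<open>From kernels to algorithms\<close>

lemma dim_mat_adjoint [simp]:
  "dim_row (mat_adjoint A) = dim_col A" "dim_col (mat_adjoint A) = dim_row A"
  by (simp_all add: mat_adjoint_def)

lemma index_mat_adjoint [simp]:
  fixes A :: "complex mat"
  assumes "i < dim_col A" "j < dim_row A"
  shows "mat_adjoint A $$ (i, j) = cnj (A $$ (j, i))"
  using assms by (simp add: mat_adjoint_def mat_of_rows_index)

lemma unitary_mat_isometry_coeffs:
  assumes "isometry_coeffs n M"
  shows "unitary_mat n (mat n n (\<lambda>(i, j). M i j))"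
proof -
  let ?V = "mat n n (\<lambda>(i, j). M i j)"
  have "mat_adjoint ?V * ?V = 1\<^sub>m n"
    using assms unfolding isometry_coeffs_def
    by (intro eq_matI) (auto simp: scalar_prod_def atLeast0LessThan)
  moreover have "mat_adjoint ?V \<in> carrier_mat n n" by auto
  ultimately show ?thesis
    unfolding unitary_mat_def by (auto intro: mat_mult_left_right_inverse)
qed

lemma mat_mult_vec_fun:
  "mat n m (\<lambda>(i, j). M i j) *\<^sub>v vec m v = vec n (\<lambda>i. \<Sum>j<m. M i j * (v j :: complex))"
  by (intro eq_vecI) (auto simp: scalar_prod_def atLeast0LessThan)

lemma sum_mult_index:
  fixes f :: "nat \<Rightarrow> 'a :: comm_monoid_add"
  shows "(\<Sum>i<N * d. f i) = (\<Sum>a<N. \<Sum>w<d. f (a * d + w))"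
proof -
  have "(\<Sum>i<N * d. f i) = (\<Sum>a<N. sum f {a * d..<a * d + d})"
    by (rule sum.nat_group[symmetric])
  also have "\<dots> = (\<Sum>a<N. \<Sum>w<d. f (a * d + w))"
  proof (rule sum.cong[OF refl])
    fix a
    show "sum f {a * d..<a * d + d} = (\<Sum>w<d. f (a * d + w))"
      using sum.shift_bounds_nat_ivl[of f 0 "a * d" d] by (simp add: add.commute atLeast0LessThan)
  qed
  finally show ?thesis .
qed

lemma sum_even_odd:
  fixes f :: "nat \<Rightarrow> 'a :: comm_monoid_add"
  shows "(\<Sum>i<2 * n. f i) = (\<Sum>w<n. f (2 * w) + f (2 * w + 1))"
  by (induction n) (simp_all add: add_ac)

text \<open>The last workspace qubit is the control.\<close>

definition place :: "nat \<Rightarrow> nat \<Rightarrow> (nat \<Rightarrow> nat \<Rightarrow> complex) \<Rightarrow> (nat \<Rightarrow> nat \<Rightarrow> complex) \<Rightarrow> nat \<Rightarrow> complex" where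
  "place d n v0 v1 r = (let a = r div d; w = r mod d in
     if w div 2 < n then (if even w then v0 else v1) (w div 2) a else 0)"

lemma place_inner:
  assumes "even d" "2 * n \<le> d"
  shows "(\<Sum>r<N * d. cnj (place d n v0 v1 r) * place d n w0 w1 r)
    = (\<Sum>w<n. \<Sum>a<N. cnj (v0 w a) * w0 w a) + (\<Sum>w<n. \<Sum>a<N. cnj (v1 w a) * w1 w a)"
proof -
  obtain e where e: "d = 2 * e" using assms(1) by blast
  let ?g = "\<lambda>a w. cnj (v0 w a) * w0 w a + cnj (v1 w a) * w1 w a"
  have odd_index: "Suc (a * (2 * e) + 2 * w) div (2 * e) = a" if "w < e" for a w
  proof -
    have "Suc (a * (2 * e) + 2 * w) div (2 * e) = ((2 * w + 1) + a * (2 * e)) div (2 * e)"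
      by (simp add: add.commute)
    also have "\<dots> = a" using that by (subst div_mult_self1) auto
    finally show ?thesis .
  qed
  have "(\<Sum>r<N * d. cnj (place d n v0 v1 r) * place d n w0 w1 r)
      = (\<Sum>a<N. \<Sum>w<e. if w < n then ?g a w else 0)"
    unfolding sum_mult_index[of _ N d] unfolding e sum_even_odd
    by (intro sum.cong refl) (auto simp: place_def Let_def odd_index)
  also have "\<dots> = (\<Sum>a<N. \<Sum>w<n. ?g a w)"
    using assms(2) by (intro sum.cong refl sum.mono_neutral_cong_right) (auto simp: e)
  also have "\<dots> = (\<Sum>w<n. \<Sum>a<N. ?g a w)" by (rule sum.swap)
  finally show ?thesis by (simp add: sum.distrib)
qed

lemma controlled_query_place:
  assumes d: "even d" "d > 0" "2 * n \<le> d" and Q: "Q = query_mat Um adj" "Um \<in> carrier_mat N N"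
  shows "gate_mat N d Um (Query adj (Some 1)) *\<^sub>v vec (N * d) (place d n v0 v1)
    = vec (N * d) (place d n v0 (\<lambda>w a. \<Sum>b<N. Q $$ (a, b) * v1 w b))"
proof (intro eq_vecI)
  have Qc: "Q \<in> carrier_mat N N" using Q by (auto simp: query_mat_def)
  fix r assume "r < dim_vec (vec (N * d) (place d n v0 (\<lambda>w a. \<Sum>b<N. Q $$ (a, b) * v1 w b)))"
  then have r: "r < N * d" by simp
  define a w where "a = r div d" and "w = r mod d"
  have aw: "a < N" "w < d" using r d by (auto simp: a_def w_def less_mult_imp_div_less)
  let ?A = "\<lambda>b v. (if a = b then 1 else 0) * (if w = v \<and> even v then 1 else 0)
     + Q $$ (a, b) * (if w = v \<and> odd v then 1 else 0)"
  have idx: "b * d + v < N * d" if "b < N" "v < d" for b v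
  proof -
    have "b * d + v < (b + 1) * d" using that by simp
    also have "\<dots> \<le> N * d" using that by (intro mult_le_mono1) simp
    finally show ?thesis .
  qed
  have "(gate_mat N d Um (Query adj (Some 1)) *\<^sub>v vec (N * d) (place d n v0 v1)) $ r
     = (\<Sum>c<N * d. gate_mat N d Um (Query adj (Some 1)) $$ (r, c) * place d n v0 v1 c)"
    using r Qc Q by (simp add: scalar_prod_def atLeast0LessThan kron_def qubit_proj_def)
  also have "\<dots> = (\<Sum>b<N. \<Sum>v<d. ?A b v * place d n v0 v1 (b * d + v))"
    unfolding sum_mult_index
  proof (intro sum.cong refl)
    fix b v assume "b \<in> {..<N}" "v \<in> {..<d}"
    then show "gate_mat N d Um (Query adj (Some 1)) $$ (r, b * d + v) * place d n v0 v1 (b * d + v)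
      = ?A b v * place d n v0 v1 (b * d + v)"
      using r Qc Q idx aw
      by (auto simp: kron_def qubit_proj_def even_iff_mod_2_eq_zero odd_iff_mod_2_eq_one
          simp flip: a_def w_def)
  qed
  also have "\<dots> = (\<Sum>b<N. (if even w then (if a = b then 1 else 0) else Q $$ (a, b))
      * place d n v0 v1 (b * d + w))"
  proof (intro sum.cong refl)
    fix b
    have "(\<Sum>v<d. ?A b v * place d n v0 v1 (b * d + v))
      = (\<Sum>v<d. if v = w then (if even w then (if a = b then 1 else 0) else Q $$ (a, b))
          * place d n v0 v1 (b * d + w) else 0)"
      by (intro sum.cong refl) auto
    then show "(\<Sum>v<d. ?A b v * place d n v0 v1 (b * d + v))
      = (if even w then (if a = b then 1 else 0) else Q $$ (a, b)) * place d n v0 v1 (b * d + w)"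
      using aw by simp
  qed
  also have "\<dots> = place d n v0 (\<lambda>w a. \<Sum>b<N. Q $$ (a, b) * v1 w b) r"
  proof (cases "even w")
    case True
    then show ?thesis using aw sum_delta_complex(2)[where j = a and n = N and f = "\<lambda>b. place d n v0 v1 (b * d + w)"]
      by (simp add: place_def Let_def flip: a_def w_def)
  next
    case False
    then show ?thesis using aw by (simp add: place_def Let_def flip: a_def w_def)
  qed
  finally show "(gate_mat N d Um (Query adj (Some 1)) *\<^sub>v vec (N * d) (place d n v0 v1)) $ r
    = vec (N * d) (place d n v0 (\<lambda>w a. \<Sum>b<N. Q $$ (a, b) * v1 w b)) $ r"
    using r by simp
qed (use Q in \<open>auto simp: kron_def query_mat_def qubit_proj_def\<close>)

context query_inputs
begin

definition input_mat :: "'s \<Rightarrow> complex mat" where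
  "input_mat s = mat N N (\<lambda>(a, b). U s a b)"

lemma free_gate_exists:
  assumes "\<And>s t. s \<in> S \<Longrightarrow> t \<in> S \<Longrightarrow> gram {..<n} f s t = gram {..<n} g s t"
  shows "\<exists>V. unitary_mat n V \<and> (\<forall>s\<in>S. V *\<^sub>v vec n (f s) = vec n (g s))"
proof -
  obtain M where "isometry_coeffs n M" "\<forall>s\<in>S. \<forall>i<n. (\<Sum>j<n. M i j * f s j) = g s i"
    using isometry_extending[where S = S and n = n and f = f and g = g] assms unfolding gram_def by blast
  then show ?thesis
    by (intro exI[of _ "mat n n (\<lambda>(i, j). M i j)"])
      (auto simp: unitary_mat_isometry_coeffs mat_mult_vec_fun intro: eq_vecI)
qed

lemma query_steps_gates:
  assumes "query_steps p K K'"
  shows "\<exists>D. \<forall>d f g. D \<le> d \<longrightarrow> 0 < d \<longrightarrow> even d \<longrightarrow>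
    (\<forall>s\<in>S. \<forall>t\<in>S. gram {..<N * d} f s t = K s t \<and> gram {..<N * d} g s t = K' s t) \<longrightarrow>
    (\<exists>gs. (\<forall>x\<in>set gs. gate_ok N d x) \<and> length (filter is_query gs) = length p \<and>
      (\<forall>s\<in>S. foldl (\<lambda>\<psi> x. gate_mat N d (input_mat s) x *\<^sub>v \<psi>) (vec (N * d) (f s)) gs = vec (N * d) (g s)))"
  using assms
proof (induction p arbitrary: K)
  case Nil
  show ?case
  proof (intro exI[of _ 0] allI impI)
    fix d f g
    assume "\<forall>s\<in>S. \<forall>t\<in>S. gram {..<N * d} f s t = K s t \<and> gram {..<N * d} g s t = K' s t"
    with Nil obtain V where "unitary_mat (N * d) V" "\<forall>s\<in>S. V *\<^sub>v vec (N * d) (f s) = vec (N * d) (g s)"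
      using free_gate_exists[of "N * d" f g] by auto
    then show "\<exists>gs. (\<forall>x\<in>set gs. gate_ok N d x) \<and> length (filter is_query gs) = length [] \<and>
      (\<forall>s\<in>S. foldl (\<lambda>\<psi> x. gate_mat N d (input_mat s) x *\<^sub>v \<psi>) (vec (N * d) (f s)) gs = vec (N * d) (g s))"
      by (intro exI[of _ "[Free V]"]) auto
  qed
next
  case (Cons b p)
  then obtain K1 where K1: "query_step b K K1" "query_steps p K1 K'" by auto
  then obtain n v0 v1 where v: "\<And>s t. s \<in> S \<Longrightarrow> t \<in> S \<Longrightarrow>
     K s t = gram2 {..<n::nat} {..<N} v0 s t + gram2 {..<n} {..<N} v1 s t \<and>
     K1 s t = gram2 {..<n} {..<N} v0 s t + gram2 {..<n} {..<N} (queried b v1) s t"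
    unfolding query_step_def by blast
  from Cons.IH[OF K1(2)] obtain D where D: "\<And>d f g. D \<le> d \<Longrightarrow> 0 < d \<Longrightarrow> even d \<Longrightarrow>
    (\<forall>s\<in>S. \<forall>t\<in>S. gram {..<N * d} f s t = K1 s t \<and> gram {..<N * d} g s t = K' s t) \<Longrightarrow>
    (\<exists>gs. (\<forall>x\<in>set gs. gate_ok N d x) \<and> length (filter is_query gs) = length p \<and>
      (\<forall>s\<in>S. foldl (\<lambda>\<psi> x. gate_mat N d (input_mat s) x *\<^sub>v \<psi>) (vec (N * d) (f s)) gs = vec (N * d) (g s)))"
    by blast
  show ?case
  proof (intro exI[of _ "max D (2 * n)"] allI impI)
    fix d f g
    assume d: "max D (2 * n) \<le> d" "0 < d" "even d"
      and fg: "\<forall>s\<in>S. \<forall>t\<in>S. gram {..<N * d} f s t = K s t \<and> gram {..<N * d} g s t = K' s t"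
    \<comment> \<open>\<open>h\<close> realises \<open>K\<close> just before the query, with the
      control bit in place, and \<open>h'\<close> realises \<open>K1\<close> just after it.\<close>
    define h where "h s = place d n (v0 s) (v1 s)" for s
    define h' where "h' s = place d n (v0 s) (queried b v1 s)" for s
    have "gram {..<N * d} h s t = K s t" "gram {..<N * d} h' s t = K1 s t" if "s \<in> S" "t \<in> S" for s t
      using place_inner[where d = d and n = n and N = N] d v[OF that] by (simp_all add: gram_def gram2_def h_def h'_def)
    then obtain V where V: "unitary_mat (N * d) V" "\<forall>s\<in>S. V *\<^sub>v vec (N * d) (f s) = vec (N * d) (h s)"
      and "\<forall>s\<in>S. \<forall>t\<in>S. gram {..<N * d} h' s t = K1 s t \<and> gram {..<N * d} g s t = K' s t"
      using free_gate_exists[of "N * d" f h] fg by metis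
    with D[of d h' g] d obtain gs where gs: "\<forall>x\<in>set gs. gate_ok N d x"
      "length (filter is_query gs) = length p"
      "\<forall>s\<in>S. foldl (\<lambda>\<psi> x. gate_mat N d (input_mat s) x *\<^sub>v \<psi>) (vec (N * d) (h' s)) gs = vec (N * d) (g s)"
      by auto
    have "gate_mat N d (input_mat s) (Query b (Some 1)) *\<^sub>v vec (N * d) (h s) = vec (N * d) (h' s)" for s
    proof -
      have "queried b v1 s w a = (\<Sum>c<N. query_mat (input_mat s) b $$ (a, c) * v1 s w c)"
        if "a < N" for w a
        using that unfolding queried_def
        by (intro sum.cong refl) (auto simp: query_mat_def input_mat_def)
      then have "vec (N * d) (h' s)
        = vec (N * d) (place d n (v0 s) (\<lambda>w a. \<Sum>c<N. query_mat (input_mat s) b $$ (a, c) * v1 s w c))"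
        using d by (intro eq_vecI) (auto simp: h'_def place_def Let_def less_mult_imp_div_less)
      then show ?thesis
        using controlled_query_place[where d = d and n = n and Q = "query_mat (input_mat s) b" and Um = "input_mat s"
            and adj = b and N = N] d
        by (simp add: h_def input_mat_def)
    qed
    with V gs d show "\<exists>gs. (\<forall>x\<in>set gs. gate_ok N d x) \<and>
      length (filter is_query gs) = length (b # p) \<and>
      (\<forall>s\<in>S. foldl (\<lambda>\<psi> x. gate_mat N d (input_mat s) x *\<^sub>v \<psi>) (vec (N * d) (f s)) gs = vec (N * d) (g s))"
      by (intro exI[of _ "Free V # Query b (Some 1) # gs"]) (auto simp: dvd_def elim: evenE)
  qed
qed

end

section \<open>Measurement in the computational basis\<close>

definition basis_proj :: "nat \<Rightarrow> nat \<Rightarrow> complex mat" where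
  "basis_proj n r = mat n n (\<lambda>(i, j). if i = r \<and> j = r then 1 else 0)"

lemma basis_proj_mult_vec:
  assumes "v \<in> carrier_vec n" "r < n"
  shows "(basis_proj n r *\<^sub>v v) \<bullet>c v = of_real ((cmod (v $ r))\<^sup>2)"
proof -
  have E: "basis_proj n r *\<^sub>v v = vec n (\<lambda>i. if i = r then v $ r else 0)"
  proof (intro eq_vecI)
    fix i assume i: "i < dim_vec (vec n (\<lambda>i. if i = r then v $ r else 0))"
    then have "(basis_proj n r *\<^sub>v v) $ i = (\<Sum>j<n. if j = r then (if i = r then v $ r else 0) else 0)"
      using assms by (auto simp: basis_proj_def scalar_prod_def atLeast0LessThan sum_delta_complex)
    then show "(basis_proj n r *\<^sub>v v) $ i = vec n (\<lambda>i. if i = r then v $ r else 0) $ i"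
      using assms i by simp
  qed (simp add: basis_proj_def)
  have "(basis_proj n r *\<^sub>v v) \<bullet>c v = (\<Sum>i<n. if i = r then v $ r * cnj (v $ r) else 0)"
    using assms unfolding E
    by (auto simp: scalar_prod_def atLeast0LessThan if_distrib[of "\<lambda>x. x * _"] cong: if_cong)
  then show ?thesis
    using assms by (simp add: complex_norm_square del: of_real_power)
qed

lemma basis_povm_ok: "povm_ok n (map (\<lambda>r. (basis_proj n r, out r)) [0..<n])"
proof -
  have dims: "foldr (+) (map (basis_proj n) xs) (0\<^sub>m n n) \<in> carrier_mat n n" for xs
    by (induction xs) (auto simp: basis_proj_def)
  have entry: "foldr (+) (map (basis_proj n) xs) (0\<^sub>m n n) $$ (i, j)
    = (\<Sum>r\<leftarrow>xs. if i = r \<and> j = r then 1 else 0)" if "i < n" "j < n" for xs i j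
    proof (induction xs)
    case (Cons r xs)
    have "foldr (+) (map (basis_proj n) (r # xs)) (0\<^sub>m n n) $$ (i, j)
      = basis_proj n r $$ (i, j) + foldr (+) (map (basis_proj n) xs) (0\<^sub>m n n) $$ (i, j)"
      using that carrier_matD[OF dims[of xs]] by simp
    moreover have "basis_proj n r $$ (i, j) = (if i = r \<and> j = r then 1 else 0)"
      using that by (simp add: basis_proj_def)
    ultimately show ?case using Cons by simp
  qed (use that in auto)
  have "foldr (+) (map (basis_proj n) [0..<n]) (0\<^sub>m n n) = 1\<^sub>m n"
  proof (intro eq_matI)
    fix i j assume "i < dim_row (1\<^sub>m n :: complex mat)" "j < dim_col (1\<^sub>m n :: complex mat)"
    then have ij: "i < n" "j < n" by simp_all
    have "foldr (+) (map (basis_proj n) [0..<n]) (0\<^sub>m n n) $$ (i, j)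
      = (\<Sum>r<n. if r = i then (if j = i then 1 else 0) else 0)"
      unfolding entry[OF ij] interv_sum_list_conv_sum_set_nat
      by (auto simp: atLeast0LessThan intro!: sum.cong)
    then show "foldr (+) (map (basis_proj n) [0..<n]) (0\<^sub>m n n) $$ (i, j) = 1\<^sub>m n $$ (i, j)"
      using ij by simp
  qed (use dims[of "[0..<n]"] in auto)
  moreover have "positive_mat n (basis_proj n r)" if "r < n" for r
    using that by (auto simp: positive_mat_def basis_proj_mult_vec less_eq_complex_def
        simp del: of_real_power) (simp add: basis_proj_def)
  ultimately show ?thesis
    by (auto simp: povm_ok_def comp_def)
qed

context query_inputs
begin

text \<open>The constant kernel 1 is the Gram kernel of the fixed start state, and \<open>K\<close>
  is that of \<phi>. Hence the circuit can be made to end with the amplitudes \<phi> on the measured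
  basis.\<close>

lemma query_steps_algorithm:
  fixes out :: "'i \<Rightarrow> real"
  assumes "query_steps p (\<lambda>_ _. 1) K" "finite I"
    and K: "\<And>s t. s \<in> S \<Longrightarrow> t \<in> S \<Longrightarrow> K s t = gram I \<phi> s t"
  shows "\<exists>A. quantum_algorithm N A \<and> cost A = length p \<and>
    (\<forall>s\<in>S. \<forall>T. output_prob N A (input_mat s) T = (\<Sum>i\<in>I. if out i \<in> T then (cmod (\<phi> s i))\<^sup>2 else 0))"
proof -
  obtain D where D: "\<And>d f g. D \<le> d \<Longrightarrow> 0 < d \<Longrightarrow> even d \<Longrightarrow>
    (\<forall>s\<in>S. \<forall>t\<in>S. gram {..<N * d} f s t = 1 \<and> gram {..<N * d} g s t = K s t) \<Longrightarrow>
    (\<exists>gs. (\<forall>x\<in>set gs. gate_ok N d x) \<and> length (filter is_query gs) = length p \<and>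
      (\<forall>s\<in>S. foldl (\<lambda>\<psi> x. gate_mat N d (input_mat s) x *\<^sub>v \<psi>) (vec (N * d) (f s)) gs = vec (N * d) (g s)))"
    using query_steps_gates[OF assms(1)] by blast
  obtain h where h: "bij_betw h {..<card I} I"
    using assms(2) ex_bij_betw_nat_finite by (metis atLeast0LessThan)
  \<comment> \<open>Even, at least \<open>D\<close>, and large enough to embed \<open>I\<close> into
    the basis.\<close>
  define d where "d = 2 * (D + card I + 1)"
  define n where "n = N * d"
  have d: "D \<le> d" "0 < d" "even d" by (simp_all add: d_def)
  have n: "card I \<le> n" "0 < n"
  proof -
    have "d \<le> n" using N_pos by (simp add: n_def)
    then show "card I \<le> n" "0 < n" by (simp_all add: d_def)
  qed
  \<comment> \<open>Basis states outside the copy of \<open>I\<close> get amplitude 0, so the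
    meaningless values \<open>out (h r)\<close> attached to them are output with probability
    0.\<close>
  define g where "g s r = (if r < card I then \<phi> s (h r) else 0)" for s r
  have restrict: "(\<Sum>r<n. if r < card I then F (h r) else 0) = (\<Sum>i\<in>I. F i)"
    for F :: "'i \<Rightarrow> 'b :: comm_monoid_add"
  proof -
    have "(\<Sum>r<n. if r < card I then F (h r) else 0) = (\<Sum>r<card I. F (h r))"
      using n by (intro sum.mono_neutral_cong_right) auto
    then show ?thesis using sum.reindex_bij_betw[OF h, of F] by simp
  qed
  have "gram {..<n} g s t = K s t" if "s \<in> S" "t \<in> S" for s t
    unfolding K[OF that] gram_def restrict[symmetric]
    by (intro sum.cong) (auto simp: g_def)
  moreover have "gram {..<n} (\<lambda>_ r. if r = 0 then 1 else 0) s t = 1" for s t :: 's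
    using n by (simp add: gram_def if_distrib[of "\<lambda>x. _ * x"] cong: if_cong)
  ultimately obtain gs where gs: "\<forall>x\<in>set gs. gate_ok N d x" "length (filter is_query gs) = length p"
    "\<forall>s\<in>S. foldl (\<lambda>\<psi> x. gate_mat N d (input_mat s) x *\<^sub>v \<psi>) (vec n (\<lambda>r. if r = 0 then 1 else 0)) gs
      = vec n (g s)"
    using D[of d "\<lambda>_ r. if r = 0 then 1 else 0" g] d by (auto simp flip: n_def)
  define A where "A = \<lparr>work_dim = d, gates = gs,
    povm = map (\<lambda>r. (basis_proj n r, out (h r))) [0..<n]\<rparr>"
  have "quantum_algorithm N A"
    using gs(1) n basis_povm_ok[of n "\<lambda>r. out (h r)"]
    by (auto simp: quantum_algorithm_def A_def n_def d_def)
  moreover have "cost A = length p"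
    using gs(2) by (simp add: cost_def A_def)
  moreover have "output_prob N A (input_mat s) T = (\<Sum>i\<in>I. if out i \<in> T then (cmod (\<phi> s i))\<^sup>2 else 0)"
    if s: "s \<in> S" for s T
  proof -
    have "unit_vec n 0 = vec n (\<lambda>r. if r = 0 then 1 else 0 :: complex)"
      by (simp add: unit_vec_def)
    then have fs: "final_state N A (input_mat s) = vec n (g s)"
      using gs(3) s by (simp add: final_state_def A_def n_def)
    have "output_prob N A (input_mat s) T
      = (\<Sum>r<n. if out (h r) \<in> T then Re ((basis_proj n r *\<^sub>v vec n (g s)) \<bullet>c vec n (g s)) else 0)"
      unfolding output_prob_def fs
      by (simp add: A_def comp_def interv_sum_list_conv_sum_set_nat atLeast0LessThan)
    also have "\<dots> = (\<Sum>r<n. if r < card I then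
        (if out (h r) \<in> T then (cmod (\<phi> s (h r)))\<^sup>2 else 0) else 0)"
      by (intro sum.cong refl) (auto simp: basis_proj_mult_vec g_def simp del: of_real_power)
    also have "\<dots> = (\<Sum>i\<in>I. if out i \<in> T then (cmod (\<phi> s i))\<^sup>2 else 0)"
      by (rule restrict)
    finally show ?thesis .
  qed
  ultimately show ?thesis by blast
qed

end

section \<open>States in the eigenbasis\<close>

locale eigen_inputs =
  fixes N :: nat and S :: "'s set" and \<theta> :: "'s \<Rightarrow> nat \<Rightarrow> real"
    and u :: "'s \<Rightarrow> nat \<Rightarrow> nat \<Rightarrow> complex"
  assumes N_pos: "N > 0"
    and orthonormal: "\<And>s i j. s \<in> S \<Longrightarrow> i < N \<Longrightarrow> j < N \<Longrightarrow>
      (\<Sum>a<N. u s i a * cnj (u s j a)) = (if i = j then 1 else 0)"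
begin

definition U :: "'s \<Rightarrow> nat \<Rightarrow> nat \<Rightarrow> complex" where
  "U s a b = (\<Sum>j<N. cis (\<theta> s j) * (u s j a * cnj (u s j b)))"

sublocale query_inputs N S U
  by unfold_locales (rule N_pos)

lemma completeness:
  assumes "s \<in> S" "a < N" "b < N"
  shows "(\<Sum>j<N. u s j a * cnj (u s j b)) = (if a = b then 1 else 0)"
proof -
  let ?A = "mat N N (\<lambda>(i, a). u s i a)" and ?B = "mat N N (\<lambda>(a, j). cnj (u s j a))"
  have "?A * ?B = 1\<^sub>m N"
    using orthonormal[OF assms(1)]
    by (intro eq_matI) (auto simp: scalar_prod_def atLeast0LessThan)
  then have "?B * ?A = 1\<^sub>m N"
    by (rule mat_mult_left_right_inverse[rotated 2]) auto
  then have "(?B * ?A) $$ (b, a) = (if a = b then 1 else 0)"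
    using assms by simp
  then show ?thesis
    using assms by (simp add: scalar_prod_def atLeast0LessThan mult.commute)
qed

definition overlap :: "'s \<Rightarrow> 's \<Rightarrow> nat \<Rightarrow> nat \<Rightarrow> complex" where
  "overlap s t j k = (\<Sum>a<N. cnj (u s j a) * u t k a)"

text \<open>The Gram kernel of the states
  \<open>\<psi>\<^sub>s = (\<Sum>j. |u\<^sub>j\<rangle>|\<bar>u\<^sub>j\<rangle>|f s j\<rangle>) / \<surd>N\<close>, where \<open>|f s j\<rangle>\<close> is a vector of an
  \<open>m\<close>-dimensional register. For \<open>f s j = g\<close> the first two registers are in the maximally entangled
  state, which does not depend on the eigenbasis.\<close>

definition eigen_gram :: "nat set \<Rightarrow> ('s \<Rightarrow> nat \<Rightarrow> nat \<Rightarrow> complex) \<Rightarrow> 's \<Rightarrow> 's \<Rightarrow> complex" where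
  "eigen_gram Y f s t = (\<Sum>j<N. \<Sum>k<N. of_real ((cmod (overlap s t j k))\<^sup>2 / N) *
     (\<Sum>y\<in>Y. cnj (f s j y) * f t k y))"

text \<open>The index \<open>a\<close> runs over the first register; \<open>w\<close> pairs the
  value of the third register with that of the second.\<close>

definition eigen_state :: "('s \<Rightarrow> nat \<Rightarrow> nat \<Rightarrow> complex) \<Rightarrow> 's \<Rightarrow> nat \<times> nat \<Rightarrow> nat \<Rightarrow> complex" where
  "eigen_state f s w a = (\<Sum>j<N. u s j a * cnj (u s j (snd w)) * f s j (fst w)) / of_real (sqrt N)"

text \<open>The conjugate in the second register turns the overlap of two eigenvectors into its
  squared modulus.\<close>

lemma gram2_eigen_state:
  "gram2 (Y \<times> {..<N}) {..<N} (eigen_state f) s t = eigen_gram Y f s t"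
proof -
  have root: "of_real (sqrt N) * of_real (sqrt N) = (of_nat N :: complex)"
    by (simp flip: of_real_mult)
  have ov: "(\<Sum>x\<in>{..<N} \<times> {..<N}. cnj (u s j (snd x) * cnj (u s j (fst x)))
      * (u t k (snd x) * cnj (u t k (fst x)))) = of_real ((cmod (overlap s t j k))\<^sup>2)" for j k
  proof -
    have "(\<Sum>x\<in>{..<N} \<times> {..<N}. cnj (u s j (snd x) * cnj (u s j (fst x)))
      * (u t k (snd x) * cnj (u t k (fst x)))) = cnj (overlap s t j k) * overlap s t j k"
      unfolding overlap_def cnj_sum sum_product sum.cartesian_product'
      by (intro sum.cong refl) (simp add: mult_ac)
    then show ?thesis by (simp add: complex_norm_square mult.commute del: of_real_power)
  qed
  have "gram2 (Y \<times> {..<N}) {..<N} (eigen_state f) s t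
    = (\<Sum>y\<in>Y. (\<Sum>x\<in>{..<N} \<times> {..<N}.
        cnj (\<Sum>j<N. u s j (snd x) * cnj (u s j (fst x)) * f s j y)
        * (\<Sum>k<N. u t k (snd x) * cnj (u t k (fst x)) * f t k y)) / N)"
    unfolding gram2_def eigen_state_def sum.cartesian_product' sum_divide_distrib
    by (simp add: root sum_divide_distrib[symmetric])
  also have "\<dots> = (\<Sum>y\<in>Y. \<Sum>j<N. \<Sum>k<N. of_real ((cmod (overlap s t j k))\<^sup>2 / N)
      * (cnj (f s j y) * f t k y))"
    unfolding sum_inner_expand ov by (simp add: sum_divide_distrib)
  also have "\<dots> = (\<Sum>j<N. \<Sum>y\<in>Y. \<Sum>k<N. of_real ((cmod (overlap s t j k))\<^sup>2 / N)
      * (cnj (f s j y) * f t k y))"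
    by (rule sum.swap)
  also have "\<dots> = (\<Sum>j<N. \<Sum>k<N. \<Sum>y\<in>Y. of_real ((cmod (overlap s t j k))\<^sup>2 / N)
      * (cnj (f s j y) * f t k y))"
    by (intro sum.cong refl sum.swap)
  finally show ?thesis by (simp add: eigen_gram_def sum_distrib_left)
qed

lemma is_gram_eigen_gram: "finite Y \<Longrightarrow> is_gram (eigen_gram Y f)"
  by (rule is_gramI[of "(Y \<times> {..<N}) \<times> {..<N}" _ "\<lambda>s x. eigen_state f s (fst x) (snd x)"])
    (simp_all only: gram2_eigen_state[symmetric] gram_def gram2_def sum.cartesian_product' fst_conv snd_conv
      finite_cartesian_product finite_lessThan)

definition phase :: "bool \<Rightarrow> 's \<Rightarrow> nat \<Rightarrow> complex" where
  "phase adj s j = cis (if adj then - \<theta> s j else \<theta> s j)"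

lemma queried_eigen_state:
  assumes "s \<in> S" "a < N"
  shows "queried adj (eigen_state f) s w a = eigen_state (\<lambda>s j y. phase adj s j * f s j y) s w a"
proof -
  have entry: "(if adj then cnj (U s c a) else U s a c)
    = (\<Sum>i<N. phase adj s i * u s i a * cnj (u s i c))" for c
    by (auto simp: U_def phase_def mult_ac cis_cnj intro!: sum.cong)
  let ?d = "\<lambda>j. cnj (u s j (snd w)) * f s j (fst w)"
  have "queried adj (eigen_state f) s w a
    = (\<Sum>c<N. cnj (\<Sum>i<N. u s i c * cnj (phase adj s i * u s i a)) * (\<Sum>j<N. u s j c * ?d j))
      / of_real (sqrt N)"
    unfolding queried_def entry by (simp add: eigen_state_def sum_divide_distrib[symmetric] mult_ac)
  also have "\<dots> = (\<Sum>i<N. \<Sum>j<N. (if j = i then 1 else 0) * (phase adj s i * u s i a * ?d j))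
      / of_real (sqrt N)"
    unfolding sum_inner_expand using orthonormal[OF assms(1)]
    by (intro arg_cong2[where f = "(/)"] sum.cong refl) (auto simp: mult.commute)
  also have "\<dots> = (\<Sum>i<N. phase adj s i * u s i a * ?d i) / of_real (sqrt N)"
    by (intro arg_cong2[where f = "(/)"] sum.cong refl sum_delta_complex(1)) simp
  also have "\<dots> = eigen_state (\<lambda>s j y. phase adj s j * f s j y) s w a"
    by (simp add: eigen_state_def mult_ac)
  finally show ?thesis .
qed

lemma eigen_gram_cong:
  assumes "\<And>j y. j < N \<Longrightarrow> y \<in> Y \<Longrightarrow> f s j y = g s j y" "\<And>j y. j < N \<Longrightarrow> y \<in> Y \<Longrightarrow> f t j y = g t j y"
  shows "eigen_gram Y f s t = eigen_gram Y g s t"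
  unfolding eigen_gram_def using assms by (intro sum.cong refl) auto

lemma eigen_gram_split:
  "eigen_gram Y f s t = eigen_gram Y (\<lambda>s j y. if P y then 0 else f s j y) s t + eigen_gram Y (\<lambda>s j y. if P y then f s j y else 0) s t"
  unfolding eigen_gram_def sum.distrib[symmetric] distrib_left[symmetric]
  by (intro sum.cong refl arg_cong2[where f = "(*)"]) auto

lemma query_step_eigen_gram:
  assumes "finite Y"
  shows "query_step adj (eigen_gram Y f) (eigen_gram Y (\<lambda>s j y. if P y then phase adj s j * f s j y else f s j y))"
proof (rule query_stepI[of "Y \<times> {..<N}" _ "eigen_state (\<lambda>s j y. if P y then 0 else f s j y)"
      "eigen_state (\<lambda>s j y. if P y then f s j y else 0)"])
  show "finite (Y \<times> {..<N})" using assms by simp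
next
  fix s t
  show "eigen_gram Y f s t = gram2 (Y \<times> {..<N}) {..<N} (eigen_state (\<lambda>s j y. if P y then 0 else f s j y)) s t
    + gram2 (Y \<times> {..<N}) {..<N} (eigen_state (\<lambda>s j y. if P y then f s j y else 0)) s t"
    unfolding gram2_eigen_state by (rule eigen_gram_split)
next
  fix s t assume st: "s \<in> S" "t \<in> S"
  let ?g = "\<lambda>s j y. if P y then phase adj s j * f s j y else f s j y"
  have "gram2 (Y \<times> {..<N}) {..<N} (queried adj (eigen_state (\<lambda>s j y. if P y then f s j y else 0))) s t
    = eigen_gram Y (\<lambda>s j y. phase adj s j * (if P y then f s j y else 0)) s t"
    unfolding gram2_eigen_state[symmetric] gram2_def using st by (simp add: queried_eigen_state)
  also have "\<dots> = eigen_gram Y (\<lambda>s j y. if P y then ?g s j y else 0) s t"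
    by (rule eigen_gram_cong) auto
  finally have 1: "gram2 (Y \<times> {..<N}) {..<N} (queried adj (eigen_state (\<lambda>s j y. if P y then f s j y else 0))) s t
    = eigen_gram Y (\<lambda>s j y. if P y then ?g s j y else 0) s t" .
  have 2: "eigen_gram Y (\<lambda>s j y. if P y then 0 else f s j y) s t = eigen_gram Y (\<lambda>s j y. if P y then 0 else ?g s j y) s t"
    by (rule eigen_gram_cong) auto
  show "eigen_gram Y ?g s t
    = gram2 (Y \<times> {..<N}) {..<N} (eigen_state (\<lambda>s j y. if P y then 0 else f s j y)) s t
    + gram2 (Y \<times> {..<N}) {..<N} (queried adj (eigen_state (\<lambda>s j y. if P y then f s j y else 0))) s t"
    unfolding 1 gram2_eigen_state 2 by (rule eigen_gram_split)
qed

text \<open>Query number \<open>k\<close>, counted from 0, is controlled on \<open>k < y\<close>, so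
  a register value \<open>y\<close> receives \<open>min y n\<close> of the \<open>n\<close>
  queries.\<close>

lemma query_steps_phases:
  assumes "finite Y"
  shows "query_steps (replicate n adj) (eigen_gram Y f) (eigen_gram Y (\<lambda>s j y. phase adj s j ^ min y n * f s j y))"
proof (induction n)
  case 0
  show ?case by simp
next
  case (Suc n)
  let ?g = "\<lambda>s j y. phase adj s j ^ min y n * f s j y"
  have "query_steps [adj] (eigen_gram Y ?g) (eigen_gram Y (\<lambda>s j y. if n < y then phase adj s j * ?g s j y else ?g s j y))"
    using query_step_eigen_gram[OF assms, of adj ?g "\<lambda>y. n < y"] by auto
  from query_steps_append[OF Suc this]
  have "query_steps (replicate (Suc n) adj) (eigen_gram Y f)
     (eigen_gram Y (\<lambda>s j y. if n < y then phase adj s j * ?g s j y else ?g s j y))"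
    by (simp add: replicate_append_same)
  then show ?case
    by (rule query_steps_cong) (auto intro!: eigen_gram_cong simp: min_def le_Suc_eq)
qed

section \<open>Input-independent operations, which leave the kernel unchanged\<close>

lemma eigen_gram_isometry:
  assumes "isometry_coeffs m F"
  shows "eigen_gram {..<m} (\<lambda>s j y. \<Sum>x<m. F y x * f s j x) s t = eigen_gram {..<m} f s t"
  unfolding eigen_gram_def isometry_coeffs_inner[OF assms] ..

text \<open>The squared overlaps of two orthonormal bases form a doubly stochastic matrix: one basis
  is complete, and the vectors of the other are normalised.\<close>

lemma overlap_sums:
  assumes "s \<in> S" "t \<in> S"
  shows "j < N \<Longrightarrow> (\<Sum>k<N. of_real ((cmod (overlap s t j k))\<^sup>2 / N)) = (1 / of_nat N :: complex)"
    and "k < N \<Longrightarrow> (\<Sum>j<N. of_real ((cmod (overlap s t j k))\<^sup>2 / N)) = (1 / of_nat N :: complex)"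
proof -
  have sq: "of_real ((cmod z)\<^sup>2 / N) = cnj z * z / of_nat N" for z
    by (simp add: complex_norm_square mult.commute del: of_real_power)
  show "(\<Sum>k<N. of_real ((cmod (overlap s t j k))\<^sup>2 / N)) = (1 / of_nat N :: complex)" if j: "j < N"
  proof -
    have "(\<Sum>k<N. cnj (overlap s t j k) * overlap s t j k)
      = (\<Sum>a<N. \<Sum>b<N. (\<Sum>k<N. cnj (u t k a) * u t k b) * (cnj (cnj (u s j a)) * cnj (u s j b)))"
      unfolding sum_inner_expand[symmetric] by (simp add: overlap_def mult.commute)
    also have "\<dots> = (\<Sum>a<N. \<Sum>b<N. (if b = a then 1 else 0) * (u s j a * cnj (u s j b)))"
      using completeness[OF assms(2)] by (intro sum.cong refl) (auto simp: mult.commute)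
    also have "\<dots> = 1"
      using orthonormal[OF assms(1) j j] by (simp add: sum_delta_complex)
    finally show ?thesis by (simp only: sq sum_divide_distrib[symmetric])
  qed
  show "(\<Sum>j<N. of_real ((cmod (overlap s t j k))\<^sup>2 / N)) = (1 / of_nat N :: complex)" if k: "k < N"
  proof -
    have "(\<Sum>j<N. cnj (overlap s t j k) * overlap s t j k)
      = (\<Sum>a<N. \<Sum>b<N. (\<Sum>j<N. u s j a * cnj (u s j b)) * (cnj (u t k a) * u t k b))"
      using sum_inner_expand[of "\<lambda>a j. cnj (u s j a)" "u t k" "{..<N}" "\<lambda>a j. cnj (u s j a)" "u t k" "{..<N}"]
      by (simp add: overlap_def)
    also have "\<dots> = (\<Sum>a<N. \<Sum>b<N. (if b = a then 1 else 0) * (cnj (u t k a) * u t k b))"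
      using completeness[OF assms(1)] by (intro sum.cong refl) auto
    also have "\<dots> = 1"
      using orthonormal[OF assms(2) k k] by (simp add: sum_delta_complex mult.commute)
    finally show ?thesis by (simp only: sq sum_divide_distrib[symmetric])
  qed
qed

text \<open>The inner product of two \<open>eigen_state\<close>s of the same input: different
  branches \<open>j\<close> are orthogonal, and an average over \<open>j\<close> remains.\<close>

definition mean_inner :: "nat set \<Rightarrow> (nat \<Rightarrow> nat \<Rightarrow> complex) \<Rightarrow> (nat \<Rightarrow> nat \<Rightarrow> complex) \<Rightarrow> complex" where
  "mean_inner Y g f = (\<Sum>j<N. \<Sum>y\<in>Y. cnj (g j y) * f j y) / N"

lemma eigen_gram_const:
  assumes "s \<in> S" "t \<in> S" "(\<Sum>y\<in>Y. cnj (g y) * g y) = 1"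
  shows "eigen_gram Y (\<lambda>s j y. g y) s t = 1"
proof -
  have "eigen_gram Y (\<lambda>s j y. g y) s t = (\<Sum>j<N. 1 / of_nat N)"
    unfolding eigen_gram_def assms(3) mult_1_right
    by (rule sum.cong[OF refl]) (simp only: overlap_sums(1)[OF assms(1,2)] lessThan_iff)
  then show ?thesis using N_pos by simp
qed

text \<open>The maximally entangled state tensored with \<open>g\<close> is the same vector for all
  inputs, so the reflection about it is one fixed unitary. In the calculation, the doubly stochastic
  weights turn the three corrections into -2, -2 and 4 times the same number.\<close>

lemma eigen_gram_reflection:
  assumes st: "s \<in> S" "t \<in> S" and g: "(\<Sum>y\<in>Y. cnj (g y) * g y) = 1"
  shows "eigen_gram Y (\<lambda>s j y. f s j y - 2 * g y * mean_inner Y (\<lambda>_. g) (f s)) s t = eigen_gram Y f s t"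
proof -
  let ?w = "\<lambda>j k. complex_of_real ((cmod (overlap s t j k))\<^sup>2 / N)"
  define b c where "b j = (\<Sum>y\<in>Y. cnj (g y) * f s j y)" and "c k = (\<Sum>y\<in>Y. cnj (g y) * f t k y)" for j k
  define \<mu> \<nu> where "\<mu> = mean_inner Y (\<lambda>_. g) (f s)" and "\<nu> = mean_inner Y (\<lambda>_. g) (f t)"
  have \<mu>: "\<mu> = (\<Sum>j<N. b j) / N" and \<nu>: "\<nu> = (\<Sum>k<N. c k) / N"
    by (simp_all add: \<mu>_def \<nu>_def mean_inner_def b_def c_def)
  define A where "A j k = (\<Sum>y\<in>Y. cnj (f s j y) * f t k y)" for j k
  have inner: "(\<Sum>y\<in>Y. cnj (f s j y - 2 * g y * \<mu>) * (f t k y - 2 * g y * \<nu>))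
    = A j k - 2 * \<nu> * cnj (b j) - 2 * cnj \<mu> * c k + 4 * cnj \<mu> * \<nu>" for j k
  proof -
    have "(\<Sum>y\<in>Y. cnj (f s j y - 2 * g y * \<mu>) * (f t k y - 2 * g y * \<nu>))
      = A j k - 2 * \<nu> * cnj (b j) - 2 * cnj \<mu> * c k
        + 4 * cnj \<mu> * \<nu> * (\<Sum>y\<in>Y. cnj (g y) * g y)"
      unfolding A_def b_def c_def cnj_sum sum_distrib_left sum_subtractf[symmetric] sum.distrib[symmetric]
      by (intro sum.cong refl) (simp add: algebra_simps)
    then show ?thesis using g by simp
  qed
  have fold_A: "eigen_gram Y f s t = (\<Sum>j<N. \<Sum>k<N. ?w j k * A j k)"
    by (simp only: eigen_gram_def A_def)
  have "(\<Sum>j<N. \<Sum>k<N. ?w j k * cnj (b j)) = (\<Sum>j<N. 1 / of_nat N * cnj (b j))"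
    by (rule sum.cong[OF refl])
      (simp only: sum_distrib_right[symmetric] overlap_sums(1)[OF st] lessThan_iff)
  then have sum_b: "(\<Sum>j<N. \<Sum>k<N. ?w j k * cnj (b j)) = cnj \<mu>"
    by (simp add: \<mu> sum_divide_distrib)
  have "(\<Sum>k<N. \<Sum>j<N. ?w j k * c k) = (\<Sum>k<N. 1 / of_nat N * c k)"
    by (rule sum.cong[OF refl])
      (simp only: sum_distrib_right[symmetric] overlap_sums(2)[OF st] lessThan_iff)
  then have sum_c: "(\<Sum>j<N. \<Sum>k<N. ?w j k * c k) = \<nu>"
    by (subst sum.swap) (simp add: \<nu> sum_divide_distrib)
  have "(\<Sum>j<N. \<Sum>k<N. ?w j k) = (\<Sum>j<N. 1 / of_nat N)"
    by (rule sum.cong[OF refl]) (simp only: overlap_sums(1)[OF st] lessThan_iff)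
  then have sum_w: "(\<Sum>j<N. \<Sum>k<N. ?w j k) = 1"
    using N_pos by simp
  have "eigen_gram Y (\<lambda>s j y. f s j y - 2 * g y * mean_inner Y (\<lambda>_. g) (f s)) s t
    = (\<Sum>j<N. \<Sum>k<N. ?w j k * (A j k - 2 * \<nu> * cnj (b j) - 2 * cnj \<mu> * c k + 4 * cnj \<mu> * \<nu>))"
    unfolding eigen_gram_def \<mu>_def[symmetric] \<nu>_def[symmetric] inner ..
  also have "\<dots> = eigen_gram Y f s t - 2 * \<nu> * (\<Sum>j<N. \<Sum>k<N. ?w j k * cnj (b j))
      - 2 * cnj \<mu> * (\<Sum>j<N. \<Sum>k<N. ?w j k * c k) + 4 * cnj \<mu> * \<nu> * (\<Sum>j<N. \<Sum>k<N. ?w j k)"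
    unfolding fold_A sum_distrib_left sum_subtractf[symmetric] sum.distrib[symmetric]
    by (intro sum.cong refl) (simp add: algebra_simps add_divide_distrib)
  also have "\<dots> = eigen_gram Y f s t"
    unfolding sum_b sum_c sum_w by simp
  finally show ?thesis .
qed

end

section \<open>Measured outcomes as sums of Gram kernels\<close>

context query_inputs
begin

text \<open>The kernels of different outcomes are realised in orthogonal subspaces. An outcome has
  as its probability the squared norm of its part of the state, which is the diagonal value of its
  kernel.\<close>

lemma query_steps_outcomes_algorithm:
  fixes out :: "'x \<Rightarrow> real"
  assumes "query_steps p (\<lambda>_ _. 1) (\<lambda>s t. \<Sum>x\<in>X. K x s t)" "finite X"
    and "\<And>x. x \<in> X \<Longrightarrow> is_gram (K x)"
  shows "\<exists>A. quantum_algorithm N A \<and> cost A = length p \<and>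
    (\<forall>s\<in>S. \<forall>T. output_prob N A (input_mat s) T = (\<Sum>x\<in>X. if out x \<in> T then Re (K x s s) else 0))"
proof -
  have "\<forall>x\<in>X. \<exists>nf :: nat \<times> _. \<forall>s\<in>S. \<forall>t\<in>S. K x s t = gram {..<fst nf} (snd nf) s t"
  proof
    fix x assume "x \<in> X"
    then obtain n f where "\<forall>s\<in>S. \<forall>t\<in>S. K x s t = gram {..<n::nat} f s t"
      using assms(3) unfolding is_gram_def by blast
    then show "\<exists>nf :: nat \<times> _. \<forall>s\<in>S. \<forall>t\<in>S. K x s t = gram {..<fst nf} (snd nf) s t"
      by - (rule exI[of _ "(n, f)"], simp)
  qed
  from bchoice[OF this] obtain nf where nf: "\<And>x s t. x \<in> X \<Longrightarrow> s \<in> S \<Longrightarrow> t \<in> S \<Longrightarrow>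
      K x s t = gram {..<fst (nf x) :: nat} (snd (nf x)) s t"
    by blast
  define I where "I = (SIGMA x:X. {..<fst (nf x)})"
  define \<phi> where "\<phi> s i = snd (nf (fst i)) s (snd i)" for s i
  have I: "finite I" using assms(2) by (simp add: I_def)
  have Sigma: "(\<Sum>i\<in>I. h i) = (\<Sum>x\<in>X. \<Sum>i<fst (nf x). h (x, i))"
    for h :: "'x \<times> nat \<Rightarrow> 'b :: comm_monoid_add"
    unfolding I_def using assms(2) by (simp add: sum.Sigma case_prod_unfold)
  have "(\<Sum>x\<in>X. K x s t) = gram I \<phi> s t" if "s \<in> S" "t \<in> S" for s t
    using that by (simp add: gram_def Sigma nf \<phi>_def)
  from query_steps_algorithm[OF assms(1) I this, of "\<lambda>i. out (fst i)"]
  obtain A where A: "quantum_algorithm N A" "cost A = length p"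
    "\<And>s T. s \<in> S \<Longrightarrow> output_prob N A (input_mat s) T =
      (\<Sum>i\<in>I. if out (fst i) \<in> T then (cmod (\<phi> s i))\<^sup>2 else 0)"
    by blast
  have "output_prob N A (input_mat s) T = (\<Sum>x\<in>X. if out x \<in> T then Re (K x s s) else 0)"
    if s: "s \<in> S" for s T
  proof -
    have "output_prob N A (input_mat s) T
      = (\<Sum>x\<in>X. \<Sum>i<fst (nf x). if out x \<in> T then (cmod (\<phi> s (x, i)))\<^sup>2 else 0)"
      unfolding A(3)[OF s] Sigma by simp
    also have "\<dots> = (\<Sum>x\<in>X. if out x \<in> T then Re (K x s s) else 0)"
    proof (rule sum.cong[OF refl])
      fix x assume x: "x \<in> X"
      have "K x s s = of_real (\<Sum>i<fst (nf x). (cmod (\<phi> s (x, i)))\<^sup>2)"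
        unfolding nf[OF x s s] gram_def
        by (simp add: \<phi>_def complex_norm_square mult.commute del: of_real_power)
      then show "(\<Sum>i<fst (nf x). if out x \<in> T then (cmod (\<phi> s (x, i)))\<^sup>2 else 0)
        = (if out x \<in> T then Re (K x s s) else 0)"
        by simp
    qed
    finally show ?thesis .
  qed
  with A(1,2) show ?thesis by blast
qed

end

section \<open>Amplitude amplification and maximum finding\<close>

text \<open>The factors by which \<open>k\<close> iterations multiply the initial good and bad
  amplitudes. \<open>\<mu>\<close> is the overlap with the initial state after the sign of the good
  part is flipped; the new pair is the reflected state times -1. Factors, unlike normalised
  components, remain meaningful for \<tau> = 0 and \<tau> = 1.\<close>

fun grover_coeffs :: "real \<Rightarrow> nat \<Rightarrow> real \<times> real" where
  "grover_coeffs \<tau> 0 = (1, 1)"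
| "grover_coeffs \<tau> (Suc k) = (let (a, b) = grover_coeffs \<tau> k; \<mu> = b * (1 - \<tau>) - a * \<tau>
    in (a + 2 * \<mu>, 2 * \<mu> - b))"

definition grover_coeff :: "real \<Rightarrow> nat \<Rightarrow> bool \<Rightarrow> real" where
  "grover_coeff \<tau> k good = (if good then fst else snd) (grover_coeffs \<tau> k)"

text \<open>Weights of the number of Grover iterations. The extra weight of \<open>k = 0\<close> covers
  the case that almost all the amplitude is good already.\<close>

definition iteration_weight :: "nat \<Rightarrow> nat \<Rightarrow> real" where
  "iteration_weight M k = (if k = 0 then 1 / 2 else 0) + 1 / (2 * real M)"

lemma iteration_weight_nonneg: "iteration_weight M k \<ge> 0"
  by (simp add: iteration_weight_def)

lemma sum_iteration_weight: "M > 0 \<Longrightarrow> (\<Sum>k<M. iteration_weight M k) = 1"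
  by (simp add: iteration_weight_def sum.distrib)

text \<open>A threshold \<open>t\<close> declares the estimates \<open>y \<ge> t\<close> good; the best estimate so far is \<open>t - 1\<close>, and
  \<open>t = 0\<close> means that there is none.\<close>

definition next_threshold :: "nat \<Rightarrow> nat \<Rightarrow> nat" where
  "next_threshold t y = (if t \<le> y then Suc y else t)"

section \<open>Grover iterations around coherent phase estimation\<close>

locale estimation = eigen_inputs +
  fixes m n :: nat and F :: "nat \<Rightarrow> nat \<Rightarrow> complex" and g :: "nat \<Rightarrow> complex"
  assumes F: "isometry_coeffs m F" and F': "isometry_coeffs m (\<lambda>x y. cnj (F y x))"
    and g: "(\<Sum>x<m. cnj (g x) * g x) = 1"
begin

text \<open>The amplitude of the estimate \<open>y\<close> in branch \<open>j\<close>: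
  \<open>g\<close> is the window, the powers of the phase come from \<open>n\<close> queries, and
  \<open>F\<close> will be a shifted Fourier transform.\<close>

definition \<sigma> :: "'a \<Rightarrow> nat \<Rightarrow> nat \<Rightarrow> complex" where
  "\<sigma> s j y = (\<Sum>x<m. F y x * (phase False s j ^ min x n * g x))"

lemma phase_mult: "phase False s j * phase True s j = 1"
  by (simp add: phase_def cis_mult)

lemma cnj_phase: "cnj (phase b s j) = phase (\<not> b) s j"
  by (simp add: phase_def cis_cnj)

lemma query_steps_initial: "query_steps (replicate n False) (\<lambda>_ _. 1) (eigen_gram {..<m} \<sigma>)"
proof -
  have "query_steps (replicate n False) (eigen_gram {..<m} (\<lambda>s j y. g y))
      (eigen_gram {..<m} (\<lambda>s j y. phase False s j ^ min y n * g y))"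
    by (rule query_steps_phases) simp
  then show ?thesis
    by (rule query_steps_cong) (auto simp: eigen_gram_const g \<sigma>_def[abs_def] eigen_gram_isometry[OF F])
qed

lemma \<sigma>_inner:
  "(\<Sum>y<m. cnj (\<sigma> s j y) * f y)
    = (\<Sum>x<m. cnj (g x) * (phase True s j ^ min x n * (\<Sum>y<m. cnj (F y x) * f y)))"
proof -
  have "(\<Sum>y<m. cnj (\<sigma> s j y) * f y)
    = (\<Sum>y<m. \<Sum>x<m. cnj (g x) * (phase True s j ^ min x n * (cnj (F y x) * f y)))"
    by (simp add: \<sigma>_def sum_distrib_left sum_distrib_right cnj_phase mult_ac)
  then show ?thesis by (subst (asm) sum.swap) (simp add: sum_distrib_left)
qed

text \<open>Conjugation: undo \<open>F\<close> and, with \<open>n\<close> inverse queries, the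
  phases; reflect about the input-independent state for free; then redo both with \<open>n\<close>
  queries.\<close>

lemma query_steps_reflection:
  "query_steps (replicate n True @ replicate n False) (eigen_gram {..<m} f)
    (eigen_gram {..<m} (\<lambda>s j y. f s j y - 2 * \<sigma> s j y * mean_inner {..<m} (\<sigma> s) (f s)))"
proof -
  define f1 where "f1 s j x = (\<Sum>y<m. cnj (F y x) * f s j y)" for s j x
  define f2 where "f2 s j x = phase True s j ^ min x n * f1 s j x" for s j x
  define \<mu> where "\<mu> s = mean_inner {..<m} (\<lambda>_. g) (f2 s)" for s
  define f3 where "f3 s j x = f2 s j x - 2 * g x * \<mu> s" for s j x
  define f4 where "f4 s j x = phase False s j ^ min x n * f3 s j x" for s j x
  have \<mu>: "\<mu> s = mean_inner {..<m} (\<sigma> s) (f s)" for s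
    by (simp add: \<mu>_def mean_inner_def \<sigma>_inner f2_def f1_def)
  have f4: "f4 s j x = f1 s j x - 2 * \<mu> s * (phase False s j ^ min x n * g x)" for s j x
  proof -
    have "phase False s j ^ min x n * phase True s j ^ min x n = 1"
      by (simp add: power_mult_distrib[symmetric] phase_mult)
    then have "phase False s j ^ min x n * f2 s j x = f1 s j x"
      by (simp add: f2_def mult.assoc[symmetric])
    then show ?thesis by (simp add: f4_def f3_def right_diff_distrib mult_ac)
  qed
  have Ff1: "(\<Sum>x<m. F y x * f1 s j x) = f s j y" if "y < m" for s j y
  proof -
    have "(\<Sum>x<m. F y x * f1 s j x) = (\<Sum>x<m. \<Sum>y'<m. F y x * cnj (F y' x) * f s j y')"
      by (simp add: f1_def sum_distrib_left mult_ac)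
    also have "\<dots> = (\<Sum>y'<m. (\<Sum>x<m. F y x * cnj (F y' x)) * f s j y')"
      by (subst sum.swap) (simp add: sum_distrib_right)
    also have "\<dots> = (\<Sum>y'<m. (if y = y' then 1 else 0) * f s j y')"
      using F' that unfolding isometry_coeffs_def by (intro sum.cong refl) simp
    finally show ?thesis using that by (simp add: sum_delta_complex)
  qed
  have Ff4: "(\<Sum>x<m. F y x * f4 s j x) = f s j y - 2 * \<sigma> s j y * mean_inner {..<m} (\<sigma> s) (f s)"
    if "y < m" for s j y
  proof -
    have "(\<Sum>x<m. F y x * f4 s j x) = (\<Sum>x<m. F y x * f1 s j x)
        - 2 * \<mu> s * (\<Sum>x<m. F y x * (phase False s j ^ min x n * g x))"
      unfolding f4 right_diff_distrib sum_subtractf sum_distrib_left by (simp add: mult_ac)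
    then show ?thesis using Ff1[OF that] by (simp add: \<sigma>_def \<mu>)
  qed
  have "query_steps (replicate n True) (eigen_gram {..<m} f1) (eigen_gram {..<m} f2)"
    unfolding f2_def[abs_def] by (rule query_steps_phases) simp
  then have A: "query_steps (replicate n True) (eigen_gram {..<m} f) (eigen_gram {..<m} f3)"
    by (rule query_steps_cong)
      (auto simp: f1_def[abs_def] eigen_gram_isometry[OF F'] f3_def[abs_def] \<mu>_def eigen_gram_reflection g)
  have "query_steps (replicate n False) (eigen_gram {..<m} f3) (eigen_gram {..<m} f4)"
    unfolding f4_def[abs_def] by (rule query_steps_phases) simp
  then have B: "query_steps (replicate n False) (eigen_gram {..<m} f3)
    (eigen_gram {..<m} (\<lambda>s j y. f s j y - 2 * \<sigma> s j y * mean_inner {..<m} (\<sigma> s) (f s)))"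
    by (rule query_steps_cong)
      (auto simp: Ff4 eigen_gram_isometry[OF F, of f4, symmetric] intro!: eigen_gram_cong)
  show ?thesis by (rule query_steps_append[OF A B])
qed

definition p :: "'a \<Rightarrow> nat \<Rightarrow> real" where
  "p s y = (\<Sum>j<N. (cmod (\<sigma> s j y))\<^sup>2) / N"

definition \<tau> :: "'a \<Rightarrow> nat \<Rightarrow> real" where
  "\<tau> s t = (\<Sum>y\<in>{t..<m}. p s y)"

lemma p_nonneg: "p s y \<ge> 0"
  by (simp add: p_def sum_nonneg)

lemma \<sigma>_norm: "(\<Sum>y<m. cnj (\<sigma> s j y) * \<sigma> s j y) = 1"
proof -
  have "phase True s j ^ k * phase False s j ^ k = 1" for k
    by (simp add: power_mult_distrib[symmetric] phase_mult mult.commute)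
  then have unit: "cnj (phase False s j ^ k * g x) * (phase False s j ^ k * g x) = cnj (g x) * g x" for k x
    by (simp add: cnj_phase)
  show ?thesis
    unfolding \<sigma>_def isometry_coeffs_inner[OF F] unit by (rule g)
qed

lemma of_real_p: "of_real (p s y) = (\<Sum>j<N. cnj (\<sigma> s j y) * \<sigma> s j y) / of_nat N"
  by (simp add: p_def complex_norm_square mult.commute del: of_real_power)

lemma sum_p: "(\<Sum>y<m. p s y) = 1"
proof -
  have "complex_of_real (\<Sum>y<m. p s y) = (\<Sum>y<m. \<Sum>j<N. cnj (\<sigma> s j y) * \<sigma> s j y) / of_nat N"
    by (simp add: of_real_p sum_divide_distrib)
  also have "\<dots> = 1"
    using N_pos by (subst sum.swap) (simp add: \<sigma>_norm)
  finally show ?thesis using of_real_eq_1_iff by blast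
qed

lemma mean_inner_split:
  assumes "t \<le> m"
  shows "mean_inner {..<m} (\<sigma> s) (\<lambda>j y. of_real (if t \<le> y then a else b) * \<sigma> s j y)
    = of_real (a * \<tau> s t + b * (1 - \<tau> s t))"
proof -
  have "mean_inner {..<m} (\<sigma> s) (\<lambda>j y. of_real (if t \<le> y then a else b) * \<sigma> s j y)
    = (\<Sum>y<m. of_real (if t \<le> y then a else b) * ((\<Sum>j<N. cnj (\<sigma> s j y) * \<sigma> s j y) / of_nat N))"
    unfolding mean_inner_def
    by (subst sum.swap) (simp add: sum_distrib_left sum_divide_distrib mult_ac)
  also have "\<dots> = of_real (\<Sum>y<m. (if t \<le> y then a else b) * p s y)"
    by (simp add: of_real_p[symmetric])
  also have "(\<Sum>y<m. (if t \<le> y then a else b) * p s y) = a * \<tau> s t + b * (1 - \<tau> s t)"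
  proof -
    have split: "(\<Sum>y<m. h y) = (\<Sum>y<t. h y) + (\<Sum>y\<in>{t..<m}. h y)" for h :: "nat \<Rightarrow> real"
      using sum.atLeastLessThan_concat[of 0 t m h] assms by (simp add: atLeast0LessThan)
    have "(\<Sum>y<t. (if t \<le> y then a else b) * p s y) = b * (\<Sum>y<t. p s y)"
      "(\<Sum>y\<in>{t..<m}. (if t \<le> y then a else b) * p s y) = a * \<tau> s t"
      by (simp_all add: \<tau>_def sum_distrib_left)
    moreover have "(\<Sum>y<t. p s y) = 1 - \<tau> s t"
      unfolding \<tau>_def using split[of "p s"] sum_p[of s] by linarith
    ultimately show ?thesis unfolding split by simp
  qed
  finally show ?thesis .
qed

definition amplified :: "nat \<Rightarrow> nat \<Rightarrow> 'a \<Rightarrow> nat \<Rightarrow> nat \<Rightarrow> complex" where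
  "amplified t k s j y = of_real (grover_coeff (\<tau> s t) k (t \<le> y)) * \<sigma> s j y"

text \<open>The sign flip of the good estimates depends on \<open>y\<close> alone and is free, and
  the global sign -1 is invisible to the Gram kernel. Only the reflection costs queries.\<close>

lemma query_steps_amplify:
  assumes "t \<le> m"
  shows "query_steps (replicate n True @ replicate n False)
    (eigen_gram {..<m} (amplified t k)) (eigen_gram {..<m} (amplified t (Suc k)))"
proof -
  define f where "f s j y = (if t \<le> y then - amplified t k s j y else amplified t k s j y)" for s j y
  define a b where "a s = fst (grover_coeffs (\<tau> s t) k)" and "b s = snd (grover_coeffs (\<tau> s t) k)" for s
  then have ab: "grover_coeffs (\<tau> s t) k = (a s, b s)" for s by simp
  have f: "f s = (\<lambda>j y. of_real (if t \<le> y then - a s else b s) * \<sigma> s j y)" for s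
    by (intro ext) (simp add: f_def amplified_def grover_coeff_def ab)
  have "f s j y - 2 * \<sigma> s j y * mean_inner {..<m} (\<sigma> s) (f s) = - amplified t (Suc k) s j y" for s j y
    unfolding f mean_inner_split[OF assms]
    by (simp add: amplified_def grover_coeff_def ab Let_def algebra_simps)
  then have "query_steps (replicate n True @ replicate n False)
      (eigen_gram {..<m} f) (eigen_gram {..<m} (\<lambda>s j y. - amplified t (Suc k) s j y))"
    using query_steps_reflection[of f] by simp
  moreover have "eigen_gram {..<m} f s s' = eigen_gram {..<m} (amplified t k) s s'" for s s'
  proof -
    have "cnj (f s j y) * f s' l y = cnj (amplified t k s j y) * amplified t k s' l y" for j l y
      by (simp add: f_def)
    then show ?thesis by (simp add: eigen_gram_def)
  qed
  ultimately show ?thesis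
    by (elim query_steps_cong) (simp_all add: eigen_gram_def)
qed

definition trial_queries :: "nat \<Rightarrow> bool list" where
  "trial_queries M = replicate n False @ concat (replicate M (replicate n True @ replicate n False))"

lemma length_trial_queries: "length (trial_queries M) = n + M * (2 * n)"
  by (simp add: trial_queries_def length_concat sum_list_replicate)

text \<open>A run with fewer than \<open>M\<close> iterations idles through the remaining queries,
  so that all \<open>k\<close> share one query list and can be mixed.\<close>

lemma query_steps_trial:
  assumes "t \<le> m" "k \<le> M"
  shows "query_steps (trial_queries M) (\<lambda>_ _. 1) (eigen_gram {..<m} (amplified t k))"
proof -
  have k: "query_steps (trial_queries k) (\<lambda>_ _. 1) (eigen_gram {..<m} (amplified t k))" for k
  proof (induction k)
    case 0
    have "amplified t 0 = \<sigma>" by (intro ext) (simp add: amplified_def grover_coeff_def)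
    then show ?case using query_steps_initial by (simp add: trial_queries_def)
  next
    case (Suc k)
    have "trial_queries (Suc k) = trial_queries k @ (replicate n True @ replicate n False)"
      by (simp only: trial_queries_def replicate_Suc replicate_append_same[symmetric]) simp
    then show ?case
      using query_steps_append[OF Suc query_steps_amplify[OF assms(1)]] by simp
  qed
  have "trial_queries M = trial_queries k @ concat (replicate (M - k) (replicate n True @ replicate n False))"
  proof -
    have "replicate M x = replicate k x @ replicate (M - k) x" for x :: "bool list"
      using assms(2) by (simp add: replicate_add[symmetric])
    then show ?thesis unfolding trial_queries_def by simp
  qed
  then show ?thesis
    using query_steps_append[OF k query_steps_idle[OF is_gram_eigen_gram]] by simp
qed

section \<open>Random iteration numbers and adaptive thresholds\<close>

definition trial_kernel :: "nat \<Rightarrow> nat \<Rightarrow> nat \<Rightarrow> 'a \<Rightarrow> 'a \<Rightarrow> complex" where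
  "trial_kernel M t y s s' = (\<Sum>k<M. of_real (iteration_weight M k) * eigen_gram {y} (amplified t k) s s')"

lemma is_gram_trial_kernel: "is_gram (trial_kernel M t y)"
  unfolding trial_kernel_def[abs_def]
  by (intro is_gram_sum is_gram_mult is_gram_const is_gram_eigen_gram) (simp_all add: iteration_weight_nonneg)

lemma eigen_gram_sum_singletons: "eigen_gram {..<m} f s s' = (\<Sum>y<m. eigen_gram {y} f s s')"
proof -
  have "(\<Sum>y<m. eigen_gram {y} f s s') = (\<Sum>j<N. \<Sum>y<m. \<Sum>k<N. of_real ((cmod (overlap s s' j k))\<^sup>2 / N) *
     (\<Sum>y\<in>{y}. cnj (f s j y) * f s' k y))"
    unfolding eigen_gram_def by (rule sum.swap)
  also have "\<dots> = (\<Sum>j<N. \<Sum>k<N. \<Sum>y<m. of_real ((cmod (overlap s s' j k))\<^sup>2 / N) *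
     (\<Sum>y\<in>{y}. cnj (f s j y) * f s' k y))"
    by (intro sum.cong refl sum.swap)
  finally show ?thesis by (simp add: eigen_gram_def sum_distrib_left)
qed

text \<open>Drawing \<open>k\<close> at random amounts to splitting the start kernel 1 into the
  weights; measuring the estimate amounts to splitting the final kernel over
  \<open>y\<close>.\<close>

lemma query_steps_trial_kernel:
  assumes "t \<le> m" "M > 0"
  shows "query_steps (trial_queries M) (\<lambda>_ _. 1) (\<lambda>s s'. \<Sum>y<m. trial_kernel M t y s s')"
proof -
  have "query_steps (trial_queries M)
    (\<lambda>s s'. \<Sum>k<M. of_real (iteration_weight M k) * 1)
    (\<lambda>s s'. \<Sum>k<M. of_real (iteration_weight M k) * eigen_gram {..<m} (amplified t k) s s')"
    by (intro query_steps_sum query_steps_mult is_gram_const query_steps_trial assms(1))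
      (auto simp: iteration_weight_nonneg)
  moreover have "(\<Sum>k<M. complex_of_real (iteration_weight M k) * 1) = 1"
    using sum_iteration_weight[OF assms(2)] by (simp flip: of_real_sum)
  moreover have "(\<Sum>k<M. of_real (iteration_weight M k) * eigen_gram {..<m} (amplified t k) s s')
    = (\<Sum>y<m. trial_kernel M t y s s')" for s s'
    unfolding trial_kernel_def eigen_gram_sum_singletons sum_distrib_left by (rule sum.swap)
  ultimately show ?thesis by simp
qed

context
  fixes M :: "nat \<Rightarrow> nat"
begin

text \<open>The branch in which the threshold after \<open>i\<close> trials is \<open>t\<close>.
  Histories leading to it are added as orthogonal branches, because the next trial depends on the
  threshold alone.\<close>

fun search_kernel :: "nat \<Rightarrow> nat \<Rightarrow> 'a \<Rightarrow> 'a \<Rightarrow> complex" where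
  "search_kernel 0 t s s' = (if t = 0 then 1 else 0)"
| "search_kernel (Suc i) t' s s' = (\<Sum>t\<le>m. \<Sum>y<m.
     of_real (if next_threshold t y = t' then 1 else 0) * (search_kernel i t s s' * trial_kernel (M i) t y s s'))"

fun search_queries :: "nat \<Rightarrow> bool list" where
  "search_queries 0 = []"
| "search_queries (Suc i) = search_queries i @ trial_queries (M i)"

lemma is_gram_search_kernel: "is_gram (search_kernel i t)"
proof (induction i arbitrary: t)
  case 0
  have "search_kernel 0 t = (\<lambda>_ _. of_real (if t = 0 then 1 else 0))" by (intro ext) simp
  then show ?case using is_gram_const[of "if t = 0 then 1 else 0"] by simp
next
  case (Suc i)
  have "search_kernel (Suc i) t = (\<lambda>s s'. \<Sum>t'\<le>m. \<Sum>y<m.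
     of_real (if next_threshold t' y = t then 1 else 0) * (search_kernel i t' s s' * trial_kernel (M i) t' y s s'))"
    by (intro ext) simp
  then show ?case
    by (auto intro!: is_gram_sum is_gram_mult is_gram_const is_gram_trial_kernel Suc simp del: of_real_1 of_real_0)
qed

lemma next_threshold_le: "t \<le> m \<Longrightarrow> y < m \<Longrightarrow> next_threshold t y \<le> m"
  by (simp add: next_threshold_def)

text \<open>In the branch with threshold \<open>t\<close>, the kernel of the history is an untouched
  factor, and a fresh trial starts from the kernel 1. The query list of a trial does not depend on
  \<open>t\<close>.\<close>

lemma query_steps_search:
  assumes "\<And>i. M i > 0"
  shows "query_steps (search_queries i) (\<lambda>_ _. 1) (\<lambda>s s'. \<Sum>t\<le>m. search_kernel i t s s')"
proof (induction i)
  case 0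
  show ?case by simp
next
  case (Suc i)
  have "query_steps (trial_queries (M i)) (\<lambda>s s'. \<Sum>t\<le>m. search_kernel i t s s' * 1)
    (\<lambda>s s'. \<Sum>t\<le>m. search_kernel i t s s' * (\<Sum>y<m. trial_kernel (M i) t y s s'))"
    using assms
    by (intro query_steps_sum query_steps_mult is_gram_search_kernel query_steps_trial_kernel) auto
  moreover have "(\<Sum>t\<le>m. search_kernel i t s s' * (\<Sum>y<m. trial_kernel (M i) t y s s'))
    = (\<Sum>t'\<le>m. search_kernel (Suc i) t' s s')" for s s'
  proof -
    let ?K = "\<lambda>t y. search_kernel i t s s' * trial_kernel (M i) t y s s'"
    have "(\<Sum>t'\<le>m. search_kernel (Suc i) t' s s')
      = (\<Sum>t\<le>m. \<Sum>t'\<le>m. \<Sum>y<m. of_real (if next_threshold t y = t' then 1 else 0) * ?K t y)"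
      unfolding search_kernel.simps by (rule sum.swap)
    also have "\<dots> = (\<Sum>t\<le>m. \<Sum>y<m. \<Sum>t'\<le>m. of_real (if next_threshold t y = t' then 1 else 0) * ?K t y)"
      by (intro sum.cong refl sum.swap)
    also have "\<dots> = (\<Sum>t\<le>m. \<Sum>y<m. ?K t y)"
    proof (intro sum.cong refl)
      fix t y assume "t \<in> {..m}" "y \<in> {..<m}"
      then have "next_threshold t y \<le> m" by (simp add: next_threshold_le)
      moreover have "(\<Sum>t'\<le>m. of_real (if next_threshold t y = t' then 1 else 0) * ?K t y)
        = (\<Sum>t'\<le>m. if next_threshold t y = t' then ?K t y else 0)"
        by (intro sum.cong refl) simp
      ultimately show "(\<Sum>t'\<le>m. of_real (if next_threshold t y = t' then 1 else 0) * ?K t y) = ?K t y"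
        by simp
    qed
    finally show ?thesis by (simp add: sum_distrib_left)
  qed
  ultimately show ?case
    using query_steps_append[OF Suc] by simp
qed

section \<open>The Markov chain of thresholds for a single input\<close>

fun search_prob :: "'a \<Rightarrow> nat \<Rightarrow> nat \<Rightarrow> real" where
  "search_prob s 0 t = (if t = 0 then 1 else 0)"
| "search_prob s (Suc i) t' = (\<Sum>t\<le>m. \<Sum>y<m.
     (if next_threshold t y = t' then 1 else 0) * (search_prob s i t *
       ((\<Sum>k<M i. iteration_weight (M i) k * (grover_coeff (\<tau> s t) k (t \<le> y))\<^sup>2) * p s y)))"

lemma trial_kernel_diag:
  assumes s: "s \<in> S"
  shows "trial_kernel r t y s s
    = of_real ((\<Sum>k<r. iteration_weight r k * (grover_coeff (\<tau> s t) k (t \<le> y))\<^sup>2) * p s y)"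
proof -
  have ov: "overlap s s j k = (if k = j then 1 else 0)" if "j < N" "k < N" for j k
    using orthonormal[OF s that(2,1)] by (simp add: overlap_def mult.commute)
  have "eigen_gram {y} f s s = (\<Sum>j<N. cnj (f s j y) * f s j y) / of_nat N" for f
  proof -
    have "eigen_gram {y} f s s = (\<Sum>j<N. \<Sum>k<N. if k = j then cnj (f s j y) * f s j y / of_nat N else 0)"
      unfolding eigen_gram_def by (intro sum.cong refl) (auto simp: ov)
    then show ?thesis by (simp add: sum_divide_distrib)
  qed
  then have "eigen_gram {y} (amplified t k) s s
    = of_real ((grover_coeff (\<tau> s t) k (t \<le> y))\<^sup>2 * p s y)" for k
    by (simp add: amplified_def of_real_p sum_distrib_left power2_eq_square mult_ac)
  then show ?thesis
    by (simp add: trial_kernel_def sum_distrib_left sum_distrib_right mult_ac)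
qed

lemma search_kernel_diag: "s \<in> S \<Longrightarrow> search_kernel i t s s = of_real (search_prob s i t)"
  by (induction i arbitrary: t) (simp_all add: trial_kernel_diag del: of_real_mult of_real_sum
     flip: of_real_mult of_real_sum)

lemma search_algorithm:
  assumes "\<And>i. M i > 0"
  shows "\<exists>A. quantum_algorithm N A \<and> cost A = (\<Sum>j<i. n + M j * (2 * n)) \<and>
    (\<forall>s\<in>S. \<forall>T. output_prob N A (input_mat s) T = (\<Sum>t\<le>m. if out t \<in> T then search_prob s i t else 0))"
proof -
  have "length (search_queries i) = (\<Sum>j<i. n + M j * (2 * n))"
    by (induction i) (simp_all add: length_trial_queries)
  moreover have "(\<Sum>t\<le>m. if out t \<in> T then Re (search_kernel i t s s) else 0)
    = (\<Sum>t\<le>m. if out t \<in> T then search_prob s i t else 0)" if "s \<in> S" for s T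
    using that by (simp add: search_kernel_diag cong: if_cong)
  ultimately show ?thesis
    using query_steps_outcomes_algorithm[OF query_steps_search[OF assms] _ is_gram_search_kernel, of i out]
    by auto
qed

end
end

section \<open>Analysis of the search\<close>

text \<open>Each iteration rotates by the angle 2 \<phi>. The product form also covers a vanishing
  sine or cosine.\<close>

lemma grover_coeff_sin:
  "grover_coeff ((sin \<phi>)\<^sup>2) k True * sin \<phi> = sin (real (2 * k + 1) * \<phi>)"
  "grover_coeff ((sin \<phi>)\<^sup>2) k False * cos \<phi> = cos (real (2 * k + 1) * \<phi>)"
proof -
  have "fst (grover_coeffs ((sin \<phi>)\<^sup>2) k) * sin \<phi> = sin (real (2 * k + 1) * \<phi>) \<and>
    snd (grover_coeffs ((sin \<phi>)\<^sup>2) k) * cos \<phi> = cos (real (2 * k + 1) * \<phi>)"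
  proof (induction k)
    case (Suc k)
    obtain a b where ab: "grover_coeffs ((sin \<phi>)\<^sup>2) k = (a, b)" by fastforce
    define x where "x = real (2 * k + 1) * \<phi>"
    have IH: "a * sin \<phi> = sin x" "b * cos \<phi> = cos x"
      using Suc by (simp_all add: ab x_def)
    have x: "real (2 * Suc k + 1) * \<phi> = x + 2 * \<phi>"
      by (simp add: x_def algebra_simps)
    have c: "1 - (sin \<phi>)\<^sup>2 = (cos \<phi>)\<^sup>2" using sin_cos_squared_add[of \<phi>] by linarith
    have d: "cos (2 * \<phi>) = 1 - 2 * (sin \<phi>)\<^sup>2" "cos (2 * \<phi>) = 2 * (cos \<phi>)\<^sup>2 - 1"
      by (fact cos_double_sin, fact cos_double_cos)
    have "(a + 2 * (b * (cos \<phi>)\<^sup>2 - a * (sin \<phi>)\<^sup>2)) * sin \<phi>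
      = (a * sin \<phi>) * (1 - 2 * (sin \<phi>)\<^sup>2) + (b * cos \<phi>) * (2 * sin \<phi> * cos \<phi>)"
      by (simp add: algebra_simps power2_eq_square)
    also have "\<dots> = sin (x + 2 * \<phi>)"
      by (simp only: IH d(1)[symmetric] sin_add sin_double)
    finally have 1: "(a + 2 * (b * (cos \<phi>)\<^sup>2 - a * (sin \<phi>)\<^sup>2)) * sin \<phi> = sin (x + 2 * \<phi>)" .
    have "(2 * (b * (cos \<phi>)\<^sup>2 - a * (sin \<phi>)\<^sup>2) - b) * cos \<phi>
      = (b * cos \<phi>) * (2 * (cos \<phi>)\<^sup>2 - 1) - (a * sin \<phi>) * (2 * sin \<phi> * cos \<phi>)"
      by (simp add: algebra_simps power2_eq_square)
    also have "\<dots> = cos (x + 2 * \<phi>)"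
      by (simp only: IH d(2)[symmetric] cos_add sin_double)
    finally have 2: "(2 * (b * (cos \<phi>)\<^sup>2 - a * (sin \<phi>)\<^sup>2) - b) * cos \<phi> = cos (x + 2 * \<phi>)" .
    show ?case
      unfolding x using 1 2 by (simp add: ab Let_def c)
  qed simp
  then show "grover_coeff ((sin \<phi>)\<^sup>2) k True * sin \<phi> = sin (real (2 * k + 1) * \<phi>)"
    "grover_coeff ((sin \<phi>)\<^sup>2) k False * cos \<phi> = cos (real (2 * k + 1) * \<phi>)"
    by (simp_all add: grover_coeff_def)
qed

lemma abs_sin_nat_mult: "\<bar>sin (real k * \<phi>)\<bar> \<le> real k * \<bar>sin \<phi>\<bar>"
proof (induction k)
  case (Suc k)
  have "\<bar>sin (real (Suc k) * \<phi>)\<bar> = \<bar>sin (real k * \<phi>) * cos \<phi> + cos (real k * \<phi>) * sin \<phi>\<bar>"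
    by (simp add: algebra_simps sin_add)
  also have "\<dots> \<le> \<bar>sin (real k * \<phi>)\<bar> * \<bar>cos \<phi>\<bar> + \<bar>cos (real k * \<phi>)\<bar> * \<bar>sin \<phi>\<bar>"
    by (metis abs_mult abs_triangle_ineq)
  also have "\<dots> \<le> \<bar>sin (real k * \<phi>)\<bar> * 1 + 1 * \<bar>sin \<phi>\<bar>"
    by (intro add_mono mult_mono) auto
  also have "\<dots> \<le> real (Suc k) * \<bar>sin \<phi>\<bar>"
    using Suc by (simp add: algebra_simps)
  finally show ?case .
qed simp

text \<open>The sum telescopes by 2 sin (2 \<phi>) cos x = sin (x + 2 \<phi>) - sin (x - 2
  \<phi>).\<close>

lemma sum_cos_arith:
  "2 * sin (2 * \<phi>) * (\<Sum>k<M. cos (2 * (real (2 * k + 1) * \<phi>))) = sin (4 * real M * \<phi>)"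
proof (induction M)
  case (Suc M)
  define x where "x = 2 * (real (2 * M + 1) * \<phi>)"
  have x: "4 * real (Suc M) * \<phi> = x + 2 * \<phi>" "4 * real M * \<phi> = x - 2 * \<phi>"
    by (simp_all add: x_def algebra_simps)
  have "2 * sin (2 * \<phi>) * (\<Sum>k<Suc M. cos (2 * (real (2 * k + 1) * \<phi>)))
    = sin (x - 2 * \<phi>) + 2 * sin (2 * \<phi>) * cos x"
    using Suc unfolding x(2) by (simp add: x_def distrib_left)
  also have "\<dots> = sin (x + 2 * \<phi>)"
    by (simp add: sin_add sin_diff)
  finally show ?case unfolding x(1) .
qed simp

section \<open>Average amplification of the probabilities of good and bad estimates\<close>

definition gain :: "nat \<Rightarrow> real \<Rightarrow> bool \<Rightarrow> real" where
  "gain M \<tau> good = (\<Sum>k<M. iteration_weight M k * (grover_coeff \<tau> k good)\<^sup>2)"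

lemma gain_nonneg: "gain M \<tau> good \<ge> 0"
  unfolding gain_def by (intro sum_nonneg mult_nonneg_nonneg) (auto simp: iteration_weight_nonneg)

context
  fixes \<tau> :: real and M :: nat
  assumes \<tau>: "0 \<le> \<tau>" "\<tau> \<le> 1" and M: "M > 0"
begin

lemma angle_exists: "\<exists>\<phi>. \<tau> = (sin \<phi>)\<^sup>2 \<and> 0 \<le> sin \<phi> \<and> 0 \<le> cos \<phi>"
proof -
  have "sqrt \<tau> \<le> 1" "0 \<le> sqrt \<tau>" "- 1 \<le> sqrt \<tau>"
    using \<tau> by (auto intro: order_trans[of _ 0])
  then have "sin (arcsin (sqrt \<tau>)) = sqrt \<tau>" "cos (arcsin (sqrt \<tau>)) = sqrt (1 - \<tau>)"
    using \<tau> by (simp_all add: cos_arcsin)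
  then show ?thesis
    using \<tau> by (intro exI[of _ "arcsin (sqrt \<tau>)"]) simp
qed

lemma gain_total: "gain M \<tau> True * \<tau> + gain M \<tau> False * (1 - \<tau>) = 1"
proof -
  obtain \<phi> where \<phi>: "\<tau> = (sin \<phi>)\<^sup>2" using angle_exists by blast
  have "(grover_coeff \<tau> k True)\<^sup>2 * \<tau> + (grover_coeff \<tau> k False)\<^sup>2 * (1 - \<tau>) = 1" for k
  proof -
    have "1 - \<tau> = (cos \<phi>)\<^sup>2" using sin_cos_squared_add[of \<phi>] \<phi> by linarith
    then have "(grover_coeff \<tau> k True)\<^sup>2 * \<tau> + (grover_coeff \<tau> k False)\<^sup>2 * (1 - \<tau>)
      = (sin (real (2 * k + 1) * \<phi>))\<^sup>2 + (cos (real (2 * k + 1) * \<phi>))\<^sup>2"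
      by (simp only: \<phi> power_mult_distrib[symmetric] grover_coeff_sin)
    then show ?thesis by simp
  qed
  then have "gain M \<tau> True * \<tau> + gain M \<tau> False * (1 - \<tau>) = (\<Sum>k<M. iteration_weight M k * 1)"
    unfolding gain_def sum_distrib_right sum.distrib[symmetric] mult.assoc distrib_left[symmetric] by simp
  then show ?thesis using sum_iteration_weight[OF M] by simp
qed

text \<open>Since |sin (j \<phi>)| is at most j |sin \<phi>|, \<open>k\<close> iterations multiply a
  good amplitude by at most \<open>2 * k + 1\<close>, hence by at most \<open>2 * M\<close>. For
  false estimates beyond the threshold this is the only protection.\<close>

lemma gain_upper:
  assumes "\<tau> > 0"
  shows "gain M \<tau> True \<le> 4 * (real M)\<^sup>2"
proof -
  obtain \<phi> where \<phi>: "\<tau> = (sin \<phi>)\<^sup>2" "0 \<le> sin \<phi>" using angle_exists by blast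
  have "sin \<phi> > 0" using assms \<phi> by (cases "sin \<phi> = 0") auto
  have "(grover_coeff \<tau> k True)\<^sup>2 \<le> 4 * (real M)\<^sup>2" if "k < M" for k
  proof -
    have "\<bar>grover_coeff \<tau> k True\<bar> * sin \<phi> = \<bar>grover_coeff \<tau> k True * sin \<phi>\<bar>"
      using \<phi>(2) by (simp add: abs_mult)
    also have "\<dots> = \<bar>sin (real (2 * k + 1) * \<phi>)\<bar>"
      by (simp only: \<phi>(1) grover_coeff_sin)
    also have "\<dots> \<le> real (2 * k + 1) * \<bar>sin \<phi>\<bar>" by (rule abs_sin_nat_mult)
    also have "\<dots> \<le> (2 * real M) * sin \<phi>"
      using that \<phi>(2) by (intro mult_mono) auto
    finally have "\<bar>grover_coeff \<tau> k True\<bar> \<le> 2 * real M"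
      using \<open>sin \<phi> > 0\<close> by simp
    then have "\<bar>grover_coeff \<tau> k True\<bar>\<^sup>2 \<le> (2 * real M)\<^sup>2" by (intro power_mono) auto
    then show ?thesis by (simp add: power_mult_distrib)
  qed
  then have "gain M \<tau> True \<le> (\<Sum>k<M. iteration_weight M k * (4 * (real M)\<^sup>2))"
    unfolding gain_def by (intro sum_mono mult_left_mono) (auto simp: iteration_weight_nonneg)
  then show ?thesis
    using sum_iteration_weight[OF M] by (simp add: sum_distrib_right[symmetric])
qed

text \<open>If cos \<phi> is at least 1/2, then sin (2 \<phi>) is at least 1 / M, the mean of the
  squared sines over \<open>k\<close> is at least 1/4, and the uniform half of the weights yields
  1/8. Otherwise \<tau> is at least 3/4, and the extra weight of \<open>k = 0\<close>
  suffices.\<close>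

lemma gain_lower:
  assumes "\<tau> * (real M)\<^sup>2 \<ge> 1"
  shows "gain M \<tau> True * \<tau> \<ge> 1 / 8"
proof -
  obtain \<phi> where \<phi>: "\<tau> = (sin \<phi>)\<^sup>2" "0 \<le> sin \<phi>" "0 \<le> cos \<phi>" using angle_exists by blast
  have sinM: "sin \<phi> * real M \<ge> 1"
  proof -
    have "(sin \<phi> * real M)\<^sup>2 \<ge> 1\<^sup>2" using assms \<phi>(1) by (simp add: power_mult_distrib)
    then show ?thesis using \<phi>(2) by (metis power2_le_imp_le mult_nonneg_nonneg of_nat_0_le_iff)
  qed
  have gain: "gain M \<tau> True * \<tau> = (\<Sum>k<M. iteration_weight M k * (sin (real (2 * k + 1) * \<phi>))\<^sup>2)"
    unfolding gain_def sum_distrib_right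
    by (intro sum.cong refl) (simp only: \<phi>(1) mult.assoc power_mult_distrib[symmetric] grover_coeff_sin)
  show ?thesis
  proof (cases "cos \<phi> \<ge> 1 / 2")
    case True
    define C where "C = (\<Sum>k<M. cos (2 * (real (2 * k + 1) * \<phi>)))"
    have "sin \<phi> \<le> sin (2 * \<phi>)"
      using mult_left_mono[OF True \<phi>(2)] by (simp add: sin_double)
    then have "sin \<phi> * real M \<le> sin (2 * \<phi>) * real M"
      by (intro mult_right_mono) auto
    then have s2: "sin (2 * \<phi>) * real M \<ge> 1"
      using sinM by linarith
    have C: "C \<le> real M / 2"
    proof (cases "C \<le> 0")
      case False
      have "2 * C \<le> 2 * C * (sin (2 * \<phi>) * real M)"
        using s2 False by (simp add: mult_le_cancel_left1)
      also have "\<dots> = real M * (2 * sin (2 * \<phi>) * C)" by simp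
      also have "\<dots> = real M * sin (4 * real M * \<phi>)" unfolding C_def sum_cos_arith ..
      also have "\<dots> \<le> real M * 1" by (intro mult_left_mono) auto
      finally show ?thesis by simp
    qed simp
    have "(\<Sum>k<M. (sin (real (2 * k + 1) * \<phi>))\<^sup>2)
      = (\<Sum>k<M. (1 - cos (2 * (real (2 * k + 1) * \<phi>))) / 2)"
      unfolding cos_double_sin by simp
    also have "\<dots> = (real M - C) / 2"
      unfolding C_def sum_divide_distrib[symmetric] sum_subtractf by simp
    finally have "(\<Sum>k<M. (sin (real (2 * k + 1) * \<phi>))\<^sup>2) = (real M - C) / 2" .
    then have "1 / 8 \<le> 1 / (2 * real M) * (\<Sum>k<M. (sin (real (2 * k + 1) * \<phi>))\<^sup>2)"
      using C M by (simp add: field_simps)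
    also have "\<dots> \<le> gain M \<tau> True * \<tau>"
      unfolding gain sum_distrib_left
      by (intro sum_mono mult_right_mono) (auto simp: iteration_weight_def)
    finally show ?thesis .
  next
    case False
    have "(cos \<phi>)\<^sup>2 \<le> (1 / 2)\<^sup>2" using False \<phi>(3) by (intro power_mono) auto
    then have "\<tau> \<ge> 3 / 4"
      using sin_cos_squared_add[of \<phi>] \<phi>(1) by (simp add: power2_eq_square)
    then have "1 / 8 \<le> iteration_weight M 0 * (sin (real (2 * 0 + 1) * \<phi>))\<^sup>2"
      using mult_mono[of "1/2" "iteration_weight M 0" "3/4" \<tau>]
      by (simp add: iteration_weight_def \<phi>(1))
    also have "\<dots> \<le> gain M \<tau> True * \<tau>"
      unfolding gain using M
      by (intro member_le_sum) (auto simp: iteration_weight_nonneg)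
    finally show ?thesis .
  qed
qed

end

text \<open>Summation by parts for a tail sum: the two sides differ by \<open>(\<Sum>y. (p y)\<^sup>2) / 2\<close>.\<close>

lemma tail_sum_square:
  fixes p :: "nat \<Rightarrow> real"
  assumes "t \<le> m"
  shows "(\<Sum>y\<in>{t..<m}. p y)\<^sup>2 / 2 \<le>
    (\<Sum>y\<in>{t..<m}. p y * ((\<Sum>z\<in>{t..<m}. p z) - (\<Sum>z\<in>{Suc y..<m}. p z)))"
proof -
  have part: "(\<Sum>z\<in>{t..<m}. p z) - (\<Sum>z\<in>{Suc y..<m}. p z) = (\<Sum>z\<in>{t..<Suc y}. p z)"
    if "t \<le> y" "y < m" for y
    using sum.atLeastLessThan_concat[of t "Suc y" m p] that by simp
  have "(\<Sum>y\<in>{t..<k}. p y)\<^sup>2 / 2 \<le> (\<Sum>y\<in>{t..<k}. p y * (\<Sum>z\<in>{t..<Suc y}. p z))"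
    if "t \<le> k" for k
    using that
  proof (induction rule: dec_induct)
    case (step k)
    have "(\<Sum>y\<in>{t..<Suc k}. p y)\<^sup>2 / 2
      \<le> (\<Sum>y\<in>{t..<k}. p y)\<^sup>2 / 2 + p k * (\<Sum>z\<in>{t..<Suc k}. p z)"
      using step(1) by (simp add: power2_eq_square field_simps)
    then show ?case using step by simp
  qed simp
  from this[OF assms] show ?thesis
    using part by (simp cong: sum.cong_simp)
qed

section \<open>Expectations along the search\<close>

context estimation
begin

lemma \<tau>_nonneg: "0 \<le> \<tau> s t"
  unfolding \<tau>_def by (intro sum_nonneg p_nonneg)

lemma \<tau>_le_1: "\<tau> s t \<le> 1"
  unfolding \<tau>_def sum_p[of s, symmetric]
  by (intro sum_mono2) (auto simp: p_nonneg)

text \<open>The condition \<open>t > 0\<close> excludes the start, where truncated subtraction would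
  feign the estimate 0.\<close>

definition overshoot :: "nat set \<Rightarrow> nat \<Rightarrow> real" where
  "overshoot H t = (if t > 0 \<and> t - 1 \<in> H then 1 else 0)"

context
  fixes M :: "nat \<Rightarrow> nat" and s :: 'a
  assumes M: "\<And>i. M i > 0"
begin

abbreviation "E i \<phi> \<equiv> (\<Sum>t\<le>m. \<phi> t * search_prob M s i t)"

lemma search_prob_nonneg: "search_prob M s i t \<ge> 0"
proof (induction i arbitrary: t)
  case (Suc i)
  have "gain (M i) (\<tau> s t) b \<ge> 0" for t b by (rule gain_nonneg)
  then show ?case
    using Suc by (auto intro!: sum_nonneg mult_nonneg_nonneg p_nonneg simp: gain_def[symmetric])
qed simp

text \<open>Good and bad outcomes have total probability 1 by \<open>gain_total\<close>, and only
  good ones move the threshold. What remains is the old value plus the average change.\<close>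

lemma search_expectation_Suc:
  "E (Suc i) \<phi> = (\<Sum>t\<le>m. search_prob M s i t *
     (\<phi> t + gain (M i) (\<tau> s t) True * (\<Sum>y\<in>{t..<m}. p s y * (\<phi> (Suc y) - \<phi> t))))"
proof -
  let ?W = "\<lambda>t y. gain (M i) (\<tau> s t) (t \<le> y) * p s y"
  let ?I = "\<lambda>t y t'. if next_threshold t y = t' then 1 else (0 :: real)"
  have "E (Suc i) \<phi> = (\<Sum>t'\<le>m. \<Sum>t\<le>m. \<Sum>y<m. \<phi> t' * (?I t y t' * (search_prob M s i t * ?W t y)))"
    by (simp add: gain_def sum_distrib_left)
  also have "\<dots> = (\<Sum>t\<le>m. \<Sum>t'\<le>m. \<Sum>y<m. \<phi> t' * (?I t y t' * (search_prob M s i t * ?W t y)))"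
    by (rule sum.swap)
  also have "\<dots> = (\<Sum>t\<le>m. \<Sum>y<m. \<Sum>t'\<le>m. \<phi> t' * (?I t y t' * (search_prob M s i t * ?W t y)))"
    by (intro sum.cong refl sum.swap)
  also have "\<dots> = (\<Sum>t\<le>m. search_prob M s i t *
     (\<phi> t + gain (M i) (\<tau> s t) True * (\<Sum>y\<in>{t..<m}. p s y * (\<phi> (Suc y) - \<phi> t))))"
  proof (rule sum.cong[OF refl])
    fix t assume "t \<in> {..m}"
    then have t: "t \<le> m" by simp
    have "(\<Sum>y<m. \<Sum>t'\<le>m. \<phi> t' * (?I t y t' * (search_prob M s i t * ?W t y)))
      = (\<Sum>y<m. search_prob M s i t * (\<phi> (next_threshold t y) * ?W t y))"
    proof (rule sum.cong[OF refl])
      fix y assume "y \<in> {..<m}"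
      then have "next_threshold t y \<le> m" using t by (simp add: next_threshold_le)
      moreover have "(\<Sum>t'\<le>m. \<phi> t' * (?I t y t' * (search_prob M s i t * ?W t y)))
        = (\<Sum>t'\<le>m. if next_threshold t y = t' then search_prob M s i t * (\<phi> (next_threshold t y) * ?W t y) else 0)"
        by (intro sum.cong refl) simp
      ultimately show "(\<Sum>t'\<le>m. \<phi> t' * (?I t y t' * (search_prob M s i t * ?W t y)))
        = search_prob M s i t * (\<phi> (next_threshold t y) * ?W t y)"
        by simp
    qed
    also have "\<dots> = search_prob M s i t * (\<Sum>y<m. \<phi> (next_threshold t y) * ?W t y)"
      by (simp add: sum_distrib_left)
    also have "(\<Sum>y<m. \<phi> (next_threshold t y) * ?W t y)
      = \<phi> t + gain (M i) (\<tau> s t) True * (\<Sum>y\<in>{t..<m}. p s y * (\<phi> (Suc y) - \<phi> t))"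
    proof -
      have split: "(\<Sum>y<m. h y) = (\<Sum>y<t. h y) + (\<Sum>y\<in>{t..<m}. h y)" for h :: "nat \<Rightarrow> real"
        using sum.atLeastLessThan_concat[of 0 t m h] t by (simp add: atLeast0LessThan)
      have low: "(\<Sum>y<t. \<phi> (next_threshold t y) * ?W t y)
        = \<phi> t * (gain (M i) (\<tau> s t) False * (\<Sum>y<t. p s y))"
        by (simp add: next_threshold_def sum_distrib_left)
      have high: "(\<Sum>y\<in>{t..<m}. \<phi> (next_threshold t y) * ?W t y)
        = gain (M i) (\<tau> s t) True * (\<Sum>y\<in>{t..<m}. p s y * (\<phi> (Suc y) - \<phi> t))
          + \<phi> t * (gain (M i) (\<tau> s t) True * \<tau> s t)"
        unfolding \<tau>_def[of s t] sum_distrib_left sum.distrib[symmetric]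
        by (intro sum.cong refl) (simp add: next_threshold_def algebra_simps)
      have "(\<Sum>y<t. p s y) = 1 - \<tau> s t"
        unfolding \<tau>_def using split[of "p s"] sum_p[of s] by linarith
      moreover have "\<phi> t * (gain (M i) (\<tau> s t) True * \<tau> s t + gain (M i) (\<tau> s t) False * (1 - \<tau> s t))
        = \<phi> t * 1"
        by (subst gain_total) (simp_all add: \<tau>_nonneg \<tau>_le_1 M)
      ultimately show ?thesis
        unfolding split low high distrib_left by simp
    qed
    finally show "(\<Sum>y<m. \<Sum>t'\<le>m. \<phi> t' * (?I t y t' * (search_prob M s i t * ?W t y)))
      = search_prob M s i t *
     (\<phi> t + gain (M i) (\<tau> s t) True * (\<Sum>y\<in>{t..<m}. p s y * (\<phi> (Suc y) - \<phi> t)))" .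
  qed
  finally show ?thesis .
qed

lemma search_total: "E i (\<lambda>_. 1) = 1"
proof (induction i)
  case (Suc i)
  then show ?case unfolding search_expectation_Suc by simp
qed simp

text \<open>A good estimate is distributed like \<open>p\<close> on the tail and leaves on average
  at most half of it. For \<tau> M^2 at least 1 it occurs with probability at least 1/8, so 1/16 of
  the tail is lost. Otherwise \<tau> is below 1 / M^2, and the additive term makes up for the
  missing sixteenth.\<close>

lemma search_tail_step:
  "E (Suc i) (\<tau> s) \<le> 15 / 16 * E i (\<tau> s) + 1 / (16 * (real (M i))\<^sup>2)"
proof -
  have step: "\<tau> s t + gain (M i) (\<tau> s t) True * (\<Sum>y\<in>{t..<m}. p s y * (\<tau> s (Suc y) - \<tau> s t))
    \<le> 15 / 16 * \<tau> s t + 1 / (16 * (real (M i))\<^sup>2)" if t: "t \<le> m" for t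
  proof -
    let ?g = "gain (M i) (\<tau> s t) True"
    have "(\<tau> s t)\<^sup>2 / 2 \<le> (\<Sum>y\<in>{t..<m}. p s y * (\<tau> s t - \<tau> s (Suc y)))"
      using tail_sum_square[OF t, of "p s"] by (simp add: \<tau>_def)
    also have "\<dots> = - (\<Sum>y\<in>{t..<m}. p s y * (\<tau> s (Suc y) - \<tau> s t))"
      unfolding sum_negf[symmetric] by (intro sum.cong refl) (simp add: algebra_simps)
    finally have "?g * (\<Sum>y\<in>{t..<m}. p s y * (\<tau> s (Suc y) - \<tau> s t)) \<le> ?g * - ((\<tau> s t)\<^sup>2 / 2)"
      by (intro mult_left_mono gain_nonneg) linarith
    then have le: "\<tau> s t + ?g * (\<Sum>y\<in>{t..<m}. p s y * (\<tau> s (Suc y) - \<tau> s t))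
      \<le> \<tau> s t - (?g * \<tau> s t) * \<tau> s t / 2"
      by (simp add: power2_eq_square)
    show ?thesis
    proof (cases "\<tau> s t * (real (M i))\<^sup>2 \<ge> 1")
      case True
      then have "?g * \<tau> s t \<ge> 1 / 8" by (intro gain_lower \<tau>_nonneg \<tau>_le_1 M)
      then have "(?g * \<tau> s t) * \<tau> s t \<ge> 1 / 8 * \<tau> s t" by (intro mult_right_mono \<tau>_nonneg)
      moreover have "1 / (16 * (real (M i))\<^sup>2) \<ge> 0" by simp
      ultimately show ?thesis using le by linarith
    next
      case False
      then have "\<tau> s t \<le> 1 / (real (M i))\<^sup>2"
        using M[of i] by (simp add: field_simps)
      moreover have "1 / (16 * (real (M i))\<^sup>2) = (1 / (real (M i))\<^sup>2) / 16" by simp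
      moreover have "(?g * \<tau> s t) * \<tau> s t \<ge> 0"
        by (intro mult_nonneg_nonneg gain_nonneg \<tau>_nonneg)
      ultimately show ?thesis using le by linarith
    qed
  qed
  have "E (Suc i) (\<tau> s) \<le> (\<Sum>t\<le>m. search_prob M s i t * (15 / 16 * \<tau> s t + 1 / (16 * (real (M i))\<^sup>2)))"
    unfolding search_expectation_Suc using step
    by (intro sum_mono mult_left_mono search_prob_nonneg) auto
  also have "\<dots> = 15 / 16 * E i (\<tau> s) + 1 / (16 * (real (M i))\<^sup>2) * E i (\<lambda>_. 1)"
    unfolding sum_distrib_left sum.distrib[symmetric] by (intro sum.cong refl) (simp add: algebra_simps)
  finally show ?thesis unfolding search_total by simp
qed

text \<open>In one trial the mass of \<open>H\<close> is amplified at most by the bound of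
  \<open>gain_upper\<close>; the rest is a union bound.\<close>

lemma search_overshoot_step:
  "E (Suc i) (overshoot H) \<le> E i (overshoot H) + 4 * (real (M i))\<^sup>2 * (\<Sum>y\<in>{..<m} \<inter> H. p s y)"
proof -
  define \<eta> where "\<eta> = (\<Sum>y\<in>{..<m} \<inter> H. p s y)"
  have step: "overshoot H t + gain (M i) (\<tau> s t) True * (\<Sum>y\<in>{t..<m}. p s y * (overshoot H (Suc y) - overshoot H t))
    \<le> overshoot H t + 4 * (real (M i))\<^sup>2 * \<eta>" for t
  proof -
    let ?g = "gain (M i) (\<tau> s t) True" and ?q = "\<Sum>y\<in>{t..<m} \<inter> H. p s y"
    have "(\<Sum>y\<in>{t..<m}. p s y * (overshoot H (Suc y) - overshoot H t))
      \<le> (\<Sum>y\<in>{t..<m}. if y \<in> H then p s y else 0)"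
      by (intro sum_mono) (auto simp: overshoot_def p_nonneg)
    also have "\<dots> = ?q" by (simp add: sum.inter_restrict)
    finally have "?g * (\<Sum>y\<in>{t..<m}. p s y * (overshoot H (Suc y) - overshoot H t)) \<le> ?g * ?q"
      by (intro mult_left_mono gain_nonneg)
    also have "?g * ?q \<le> 4 * (real (M i))\<^sup>2 * \<eta>"
    proof (cases "\<tau> s t > 0")
      case True
      have "?q \<le> \<eta>" unfolding \<eta>_def by (intro sum_mono2) (auto simp: p_nonneg)
      moreover have "?g \<le> 4 * (real (M i))\<^sup>2" by (intro gain_upper True \<tau>_nonneg \<tau>_le_1 M)
      moreover have "?q \<ge> 0" by (intro sum_nonneg p_nonneg)
      ultimately show ?thesis by (intro mult_mono) auto
    next
      case False
      \<comment> \<open>Here \<open>\<tau> s t\<close> is 0, and with it the mass of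
        \<open>H\<close> beyond the threshold.\<close>
      have "?q \<le> \<tau> s t" unfolding \<tau>_def by (intro sum_mono2) (auto simp: p_nonneg)
      moreover have "?q \<ge> 0" "\<eta> \<ge> 0" unfolding \<eta>_def by (intro sum_nonneg p_nonneg)+
      ultimately show ?thesis using False by (cases "?q = 0") auto
    qed
    finally show ?thesis by simp
  qed
  have "E (Suc i) (overshoot H) \<le> (\<Sum>t\<le>m. search_prob M s i t * (overshoot H t + 4 * (real (M i))\<^sup>2 * \<eta>))"
    unfolding search_expectation_Suc using step
    by (intro sum_mono mult_left_mono search_prob_nonneg) auto
  also have "\<dots> = E i (overshoot H) + 4 * (real (M i))\<^sup>2 * \<eta> * E i (\<lambda>_. 1)"
    unfolding sum_distrib_left sum.distrib[symmetric] by (intro sum.cong refl) (simp add: algebra_simps)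
  finally show ?thesis unfolding search_total \<eta>_def by simp
qed

text \<open>The contraction by 15/16 leaves room for \<open>M i\<close> to grow, as long as \<open>1 / (M i)\<^sup>2\<close> decreases by
  no more than a factor 31/32 per round.\<close>

lemma search_tail:
  assumes r: "1 \<le> r" "r\<^sup>2 \<le> 32 / 31" and Mr: "\<And>i. real (M i) \<ge> r ^ i"
  shows "E i (\<tau> s) \<le> 2 / (r ^ i)\<^sup>2"
proof (induction i)
  case 0
  have "E 0 (\<tau> s) = (\<Sum>t\<le>m. if t = 0 then \<tau> s t else 0)" by (intro sum.cong refl) simp
  then show ?case using \<tau>_le_1[of s 0] by simp
next
  case (Suc i)
  have ri: "r ^ i \<ge> 1" using r by simp
  have "(r ^ i)\<^sup>2 \<le> (real (M i))\<^sup>2" using Mr[of i] ri by (intro power_mono) auto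
  then have "1 / (16 * (real (M i))\<^sup>2) \<le> 1 / (16 * (r ^ i)\<^sup>2)"
    using ri r M[of i] by (intro divide_left_mono mult_pos_pos) auto
  then have "E (Suc i) (\<tau> s) \<le> 15 / 16 * (2 / (r ^ i)\<^sup>2) + 1 / (16 * (r ^ i)\<^sup>2)"
    using search_tail_step[of i] Suc by linarith
  also have "\<dots> = 31 / 16 / (r ^ i)\<^sup>2" by (simp add: field_simps)
  also have "\<dots> \<le> 2 / (r ^ Suc i)\<^sup>2"
  proof -
    have "31 / 16 * r\<^sup>2 \<le> 2" using r by simp
    then have "31 / 16 * r\<^sup>2 / (r\<^sup>2 * (r ^ i)\<^sup>2) \<le> 2 / (r\<^sup>2 * (r ^ i)\<^sup>2)"
      using r by (intro divide_right_mono) auto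
    moreover have "r \<noteq> 0" using r by auto
    ultimately show ?thesis by (simp add: power_mult_distrib)
  qed
  finally show ?case .
qed

lemma search_overshoot:
  "E i (overshoot H) \<le> (\<Sum>j<i. 4 * (real (M j))\<^sup>2) * (\<Sum>y\<in>{..<m} \<inter> H. p s y)"
proof (induction i)
  case 0
  have "E 0 (overshoot H) = 0" by (intro sum.neutral) (auto simp: overshoot_def)
  then show ?case by (simp only: lessThan_0 sum.empty mult_zero_left)
next
  case (Suc i)
  then show ?case
    using search_overshoot_step[where i = i and H = H]
    unfolding sum.lessThan_Suc[of _ i] distrib_right by linarith
qed

end
end

section \<open>Phase estimation\<close>

lemma sum_roots_of_unity:
  assumes "i < m" "j < m"
  shows "(\<Sum>y<m. cis (2 * pi * (real i - real j) / real m) ^ y) = (if i = j then of_nat m else 0)"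
proof (cases "i = j")
  case False
  define z where "z = cis (2 * pi * (real i - real j) / real m)"
  have m: "real m > 0" using assms by simp
  have "z ^ m = cis (2 * pi * (real i - real j))"
    using m unfolding z_def Complex.DeMoivre by simp
  also have "2 * pi * (real i - real j) = 2 * pi * of_int (int i - int j)" by simp
  also have "cis (2 * pi * of_int (int i - int j)) = 1"
    by (rule cis_multiple_2pi) simp
  finally have zm: "z ^ m = 1" .
  have "z \<noteq> 1"
  proof
    assume "z = 1"
    moreover have "Re z = cos (2 * pi * (real i - real j) / real m)"
      by (simp add: z_def)
    ultimately have "cos (2 * pi * (real i - real j) / real m) = 1"
      by simp
    then obtain k :: int where "2 * pi * (real i - real j) / real m = of_int k * 2 * pi"
      using cos_one_2pi_int by blast
    then have "2 * pi * (real i - real j) = 2 * pi * (of_int k * real m)"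
      using m by (simp only: divide_eq_eq) (simp add: mult_ac)
    then have k: "real i - real j = of_int k * real m"
      by (subst (asm) mult_cancel_left) simp
    have "\<bar>real i - real j\<bar> < real m" using assms by auto
    then have "\<bar>of_int k :: real\<bar> * real m < 1 * real m"
      by (simp only: k abs_mult abs_of_nat mult_1)
    then have "\<bar>of_int k :: real\<bar> < 1" using m by (simp only: mult_less_cancel_right_pos)
    then have "k = 0" by linarith
    then show False using k False by simp
  qed
  moreover have "(z - 1) * (\<Sum>y<m. z ^ y) = z ^ m - 1"
    by (rule power_diff_1_eq[symmetric])
  ultimately have "(\<Sum>y<m. z ^ y) = 0" using zm by simp
  then show ?thesis using False by (simp only: z_def if_False)
qed simp

text \<open>The grid starts at \<open>- \<delta>\<close>, so that it wraps around within the gap \<open>[2 \<pi> - 2 \<delta>, 2 \<pi>)\<close>.\<close>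

definition grid_angle :: "real \<Rightarrow> nat \<Rightarrow> nat \<Rightarrow> real" where
  "grid_angle \<delta> m y = 2 * pi * real y / real m - \<delta>"

definition fourier :: "real \<Rightarrow> nat \<Rightarrow> nat \<Rightarrow> nat \<Rightarrow> complex" where
  "fourier \<delta> m y x = cis (- grid_angle \<delta> m y) ^ x / of_real (sqrt (real m))"

lemma sqrt_mult_self_complex: "of_real (sqrt (real m)) * of_real (sqrt (real m)) = (of_nat m :: complex)"
  by (simp flip: of_real_mult)

lemma fourier_isometry:
  "isometry_coeffs m (fourier \<delta> m)" "isometry_coeffs m (\<lambda>x y. cnj (fourier \<delta> m y x))"
proof -
  show "isometry_coeffs m (fourier \<delta> m)"
    unfolding isometry_coeffs_def
  proof (intro allI impI)
    fix i j assume ij: "i < m" "j < m"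
    have "cnj (fourier \<delta> m y i) * fourier \<delta> m y j
      = cis (- \<delta> * (real i - real j)) * cis (2 * pi * (real i - real j) / real m) ^ y / of_nat m" for y
      by (simp add: fourier_def grid_angle_def cis_cnj Complex.DeMoivre cis_mult sqrt_mult_self_complex)
        (simp add: algebra_simps diff_divide_distrib)
    then have "(\<Sum>y<m. cnj (fourier \<delta> m y i) * fourier \<delta> m y j)
      = cis (- \<delta> * (real i - real j)) * (\<Sum>y<m. cis (2 * pi * (real i - real j) / real m) ^ y) / of_nat m"
      by (simp add: sum_distrib_left sum_divide_distrib)
    then show "(\<Sum>y<m. cnj (fourier \<delta> m y i) * fourier \<delta> m y j) = (if i = j then 1 else 0)"
      unfolding sum_roots_of_unity[OF ij] using ij by auto
  qed
  show "isometry_coeffs m (\<lambda>x y. cnj (fourier \<delta> m y x))"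
    unfolding isometry_coeffs_def
  proof (intro allI impI)
    fix i j assume ij: "i < m" "j < m"
    have "cnj (cnj (fourier \<delta> m i x)) * cnj (fourier \<delta> m j x)
      = cis (2 * pi * (real j - real i) / real m) ^ x / of_nat m" for x
      by (simp add: fourier_def grid_angle_def cis_cnj Complex.DeMoivre cis_mult sqrt_mult_self_complex)
        (simp add: algebra_simps diff_divide_distrib)
    then have "(\<Sum>x<m. cnj (cnj (fourier \<delta> m i x)) * cnj (fourier \<delta> m j x))
      = (\<Sum>x<m. cis (2 * pi * (real j - real i) / real m) ^ x) / of_nat m"
      by (simp add: sum_divide_distrib)
    then show "(\<Sum>x<m. cnj (cnj (fourier \<delta> m i x)) * cnj (fourier \<delta> m j x)) = (if i = j then 1 else 0)"
      unfolding sum_roots_of_unity[OF ij(2,1)] using ij by auto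
  qed
qed

text \<open>With the coefficients of a polynomial as window, the amplitude of an estimate is a value
  of that polynomial on the unit circle, so factors of the polynomial contribute multiplicatively to
  the decay.\<close>

lemma poly_fourier:
  assumes "degree P < m"
  shows "(\<Sum>x<m. fourier \<delta> m y x * (cis \<theta> ^ x * coeff P x))
    = poly P (cis (\<theta> - grid_angle \<delta> m y)) / of_real (sqrt (real m))"
proof -
  have "poly P z = (\<Sum>x<m. coeff P x * z ^ x)" for z
    unfolding poly_altdef using assms
    by (intro sum.mono_neutral_left) (auto simp: coeff_eq_0)
  moreover have "fourier \<delta> m y x * (cis \<theta> ^ x * c)
    = c * cis (\<theta> - grid_angle \<delta> m y) ^ x / of_real (sqrt (real m))" for x c
  proof -
    have "cis (\<theta> - grid_angle \<delta> m y) = cis \<theta> * cis (- grid_angle \<delta> m y)"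
      by (simp add: cis_mult)
    then show ?thesis by (simp add: fourier_def power_mult_distrib mult_ac)
  qed
  ultimately show ?thesis by (simp add: sum_divide_distrib)
qed

text \<open>Parseval on the grid, from the unitarity of \<open>fourier\<close>.\<close>

lemma sum_norm_poly_grid:
  assumes "degree P < m"
  shows "(\<Sum>y<m. (cmod (poly P (cis (\<theta> - grid_angle \<delta> m y))))\<^sup>2) = real m * (\<Sum>x<m. (cmod (coeff P x))\<^sup>2)"
proof -
  have m: "real m > 0" using assms by simp
  have sq: "cnj z * z = of_real ((cmod z)\<^sup>2)" for z
    by (simp add: complex_norm_square mult.commute del: of_real_power)
  have "of_real (\<Sum>y<m. (cmod (poly P (cis (\<theta> - grid_angle \<delta> m y)) / of_real (sqrt (real m))))\<^sup>2)
    = (\<Sum>y<m. cnj (\<Sum>x<m. fourier \<delta> m y x * (cis \<theta> ^ x * coeff P x))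
        * (\<Sum>x<m. fourier \<delta> m y x * (cis \<theta> ^ x * coeff P x)))"
    unfolding poly_fourier[OF assms] sq by simp
  also have "\<dots> = (\<Sum>x<m. cnj (cis \<theta> ^ x * coeff P x) * (cis \<theta> ^ x * coeff P x))"
    by (rule isometry_coeffs_inner[OF fourier_isometry(1)])
  also have "\<dots> = of_real (\<Sum>x<m. (cmod (coeff P x))\<^sup>2)"
    unfolding sq by (simp add: norm_mult norm_power)
  finally have "(\<Sum>y<m. (cmod (poly P (cis (\<theta> - grid_angle \<delta> m y)) / of_real (sqrt (real m))))\<^sup>2)
    = (\<Sum>x<m. (cmod (coeff P x))\<^sup>2)"
    using of_real_eq_iff by blast
  then show ?thesis
    using m by (simp add: norm_divide power_divide sum_divide_distrib[symmetric] field_simps)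
qed

text \<open>A crude form of Jordan's inequality: t <= 2 gives t^3 / 6 <= 2 t / 3.\<close>

lemma sin_ge_third:
  assumes "0 \<le> t" "t \<le> pi / 2"
  shows "t / 3 \<le> sin t"
proof -
  have "\<bar>sin t - (\<Sum>k<3. sin_coeff k * t ^ k)\<bar> \<le> inverse (fact 3) * \<bar>t\<bar> ^ 3"
    by (rule Maclaurin_sin_bound)
  moreover have "(\<Sum>k<3. sin_coeff k * t ^ k) = t"
    by (simp add: numeral_3_eq_3 sin_coeff_def)
  moreover have "t ^ 3 \<le> 4 * t"
  proof -
    have "t \<le> 2" using assms pi_less_4 by linarith
    then have "t * t \<le> 2 * 2" using assms by (intro mult_mono) auto
    then have "t * t * t \<le> 4 * t" using assms by (intro mult_right_mono) auto
    then show ?thesis by (simp add: power3_eq_cube)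
  qed
  ultimately have "\<bar>sin t - t\<bar> * 6 \<le> 4 * t" using assms by (simp add: fact_numeral)
  then have "\<bar>sin t - t\<bar> \<le> 2 * t / 3" by simp
  then have "- (sin t - t) \<le> 2 * t / 3" by (rule abs_le_D2)
  then show ?thesis by simp
qed

text \<open>The squared chord is 2 - 2 cos x, and the hypotheses keep \<open>x\<close> at distance
  at least \<delta> from 0 and \<plusminus> 2 pi, so cos x is at most cos \<delta>.\<close>

lemma dist_one_cis:
  assumes "0 < \<delta>" "\<delta> < pi" "\<delta> \<le> \<bar>x\<bar>" "\<bar>x\<bar> \<le> 2 * pi - \<delta>"
  shows "\<delta> / 3 \<le> cmod (1 - cis x)"
proof -
  have "cos x \<le> cos \<delta>"
  proof (cases "\<bar>x\<bar> \<le> pi")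
    case True
    then have "cos \<bar>x\<bar> \<le> cos \<delta>" using assms by (intro cos_monotone_0_pi_le) auto
    then show ?thesis by (simp add: abs_if split: if_splits)
  next
    case False
    then have "cos (2 * pi - \<bar>x\<bar>) \<le> cos \<delta>" using assms by (intro cos_monotone_0_pi_le) auto
    then show ?thesis by (simp add: abs_if cos_diff split: if_splits)
  qed
  moreover have "cos \<delta> = 1 - 2 * (sin (\<delta> / 2))\<^sup>2"
    using cos_double_sin[of "\<delta> / 2"] by simp
  moreover have "(\<delta> / 6)\<^sup>2 \<le> (sin (\<delta> / 2))\<^sup>2"
    using sin_ge_third[of "\<delta> / 2"] assms by (intro power_mono) auto
  moreover have "(cmod (1 - cis x))\<^sup>2 = 2 - 2 * cos x"
    by (simp add: cmod_power2 power2_diff)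
  ultimately have "(\<delta> / 3)\<^sup>2 \<le> (cmod (1 - cis x))\<^sup>2"
    by (simp add: power_divide)
  then show ?thesis by (rule power2_le_imp_le) simp
qed

section \<open>The window polynomial and the decay of its amplitudes\<close>

lemma square_sum_le:
  fixes a :: "'i \<Rightarrow> real"
  shows "(\<Sum>x\<in>A. a x)\<^sup>2 \<le> real (card A) * (\<Sum>x\<in>A. (a x)\<^sup>2)"
proof -
  have "(\<Sum>x\<in>A. a x)\<^sup>2 = (\<Sum>x\<in>A. \<Sum>y\<in>A. a x * a y)"
    by (simp add: power2_eq_square sum_product)
  also have "\<dots> \<le> (\<Sum>x\<in>A. \<Sum>y\<in>A. ((a x)\<^sup>2 + (a y)\<^sup>2) / 2)"
    using sum_squares_bound by (intro sum_mono) (simp add: field_simps)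
  also have "\<dots> = real (card A) * (\<Sum>x\<in>A. (a x)\<^sup>2)"
    by (simp add: add_divide_distrib sum.distrib sum_divide_distrib[symmetric] sum_distrib_left[symmetric])
  finally show ?thesis .
qed

definition box_poly :: "nat \<Rightarrow> complex poly" where
  "box_poly w = (\<Sum>i<w. monom 1 i)"

lemma coeff_box_poly: "coeff (box_poly w) x = (if x < w then 1 else 0)"
  by (simp add: box_poly_def coeff_sum)

lemma degree_box_poly: "degree (box_poly w) \<le> w - 1"
  by (rule degree_le) (auto simp: coeff_box_poly)

lemma poly_box_poly: "poly (box_poly w) z = (\<Sum>i<w. z ^ i)"
  by (simp add: box_poly_def poly_sum poly_monom)

lemma norm_box_poly_cis: "cmod (poly (box_poly w) (cis x)) * cmod (1 - cis x) \<le> 2"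
proof -
  have "(1 - cis x) * poly (box_poly w) (cis x) = 1 - cis x ^ w"
    unfolding poly_box_poly by (rule one_diff_power_eq[symmetric])
  then have "cmod (poly (box_poly w) (cis x)) * cmod (1 - cis x) = cmod (1 - cis x ^ w)"
    by (metis norm_mult mult.commute)
  also have "\<dots> \<le> cmod 1 + cmod (cis x ^ w)" by (rule norm_triangle_ineq4)
  finally show ?thesis by (simp add: norm_power)
qed

text \<open>The amplitudes of the phase estimation register: the coefficients of
  \<open>(1 + z + \<dots> + z\<^bsup>w - 1\<^esup>)\<^bsup>L + 1\<^esup>\<close>, normalised. Each of \<open>L\<close> factors contributes a decay
  \<open>O(1 / (w |\<theta> - \<alpha>|))\<close> to the amplitude of the estimate \<open>\<alpha>\<close> of \<open>\<theta>\<close>; the remaining one is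
  summed over \<open>\<alpha>\<close> by Parseval.\<close>

locale window =
  fixes L w :: nat and \<delta> :: real
  assumes w_pos: "w > 0"
begin

text \<open>The degree of \<open>window_poly\<close>: with this many queries every register value
  gets its full power of the phase.\<close>

definition n :: nat where "n = (L + 1) * (w - 1)"
definition m :: nat where "m = n + 1"

definition window_poly :: "complex poly" where
  "window_poly = box_poly w ^ (L + 1)"

definition mass :: real where
  "mass = (\<Sum>x<m. (cmod (coeff window_poly x))\<^sup>2)"

definition g :: "nat \<Rightarrow> complex" where
  "g x = coeff window_poly x / of_real (sqrt mass)"

lemma degree_window_poly: "degree window_poly < m"
proof -
  have "degree window_poly \<le> degree (box_poly w) * (L + 1)"
    unfolding window_poly_def by (rule degree_power_le)
  also have "\<dots> \<le> (w - 1) * (L + 1)" by (intro mult_right_mono degree_box_poly) simp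
  finally show ?thesis by (simp add: m_def n_def mult.commute)
qed

lemma w_le_m: "w \<le> m"
  unfolding m_def n_def using w_pos by (cases w) simp_all

lemma m_le: "real m \<le> (real L + 1) * real w"
proof -
  have "m \<le> (L + 1) * w"
    unfolding m_def n_def using w_pos by (cases w) simp_all
  then have "real m \<le> real ((L + 1) * w)" by (simp only: of_nat_le_iff)
  then show ?thesis by (simp add: algebra_simps)
qed

text \<open>Cauchy-Schwarz for the \<open>m\<close> coefficients, whose sum is the value
  \<open>w ^ (L + 1)\<close> at 1.\<close>

lemma mass_ge: "real w ^ (2 * L + 1) / (real L + 1) \<le> mass"
proof -
  have "poly window_poly 1 = (\<Sum>x<m. coeff window_poly x)"
    using degree_window_poly unfolding poly_altdef
    by (simp, intro sum.mono_neutral_left) (auto simp: coeff_eq_0)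
  moreover have "poly window_poly 1 = of_nat w ^ (L + 1)"
    by (simp add: window_poly_def poly_box_poly del: power_Suc)
  ultimately have "real w ^ (L + 1) = cmod (\<Sum>x<m. coeff window_poly x)"
    by (metis norm_of_nat norm_power)
  also have "\<dots> \<le> (\<Sum>x<m. cmod (coeff window_poly x))" by (rule norm_sum)
  finally have "(real w ^ (L + 1))\<^sup>2 \<le> (\<Sum>x<m. cmod (coeff window_poly x))\<^sup>2"
    by (intro power_mono) auto
  also have "\<dots> \<le> real m * mass"
    using square_sum_le[of "\<lambda>x. cmod (coeff window_poly x)" "{..<m}"] by (simp add: mass_def)
  also have "\<dots> \<le> (real L + 1) * real w * mass"
    by (intro mult_right_mono m_le) (auto simp: mass_def intro: sum_nonneg)
  also have "(real w ^ (L + 1))\<^sup>2 = real w * real w ^ (2 * L + 1)"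
  proof -
    have "(L + 1) * 2 = Suc (2 * L + 1)" by simp
    then show ?thesis by (metis power_Suc power_mult)
  qed
  finally have "real w * real w ^ (2 * L + 1) \<le> real w * ((real L + 1) * mass)"
    by (simp only: mult_ac)
  then have "real w ^ (2 * L + 1) \<le> (real L + 1) * mass"
    using w_pos by simp
  then show ?thesis by (simp add: field_simps)
qed

lemma mass_pos: "mass > 0"
proof -
  have "0 < real w ^ (2 * L + 1) / (real L + 1)" using w_pos by simp
  then show ?thesis using mass_ge by linarith
qed

lemma g_norm: "(\<Sum>x<m. cnj (g x) * g x) = 1"
proof -
  have "(\<Sum>x<m. cnj (g x) * g x) = of_real ((\<Sum>x<m. (cmod (coeff window_poly x))\<^sup>2) / mass)"
    using mass_pos
    by (simp add: g_def complex_norm_square sum_divide_distrib mult.commute del: of_real_power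
        flip: of_real_mult)
  then show ?thesis using mass_pos by (simp add: mass_def)
qed

lemma estimate_tail:
  assumes "Y \<subseteq> {..<m}" "0 < d" "\<And>y. y \<in> Y \<Longrightarrow> d \<le> cmod (1 - cis (\<theta> - grid_angle \<delta> m y))"
  shows "(\<Sum>y\<in>Y. (cmod (\<Sum>x<m. fourier \<delta> m y x * (cis \<theta> ^ x * g x)))\<^sup>2)
    \<le> (real L + 1) * (2 / (d * real w)) ^ (2 * L)"
proof -
  have m: "real m > 0" by (simp add: m_def)
  define q where "q y = cmod (poly (box_poly w) (cis (\<theta> - grid_angle \<delta> m y)))" for y
  have est: "(cmod (\<Sum>x<m. fourier \<delta> m y x * (cis \<theta> ^ x * g x)))\<^sup>2 = (q y ^ (L + 1))\<^sup>2 / (real m * mass)" for y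
  proof -
    have "(\<Sum>x<m. fourier \<delta> m y x * (cis \<theta> ^ x * g x))
      = (\<Sum>x<m. fourier \<delta> m y x * (cis \<theta> ^ x * coeff window_poly x)) / of_real (sqrt mass)"
      by (simp add: g_def sum_divide_distrib)
    then show ?thesis
      unfolding poly_fourier[OF degree_window_poly] using mass_pos m
      by (simp add: q_def window_poly_def norm_divide norm_mult norm_power power_divide power_mult_distrib)
  qed
  have le: "(q y ^ (L + 1))\<^sup>2 / (real m * mass) \<le> (2 / d) ^ (2 * L) / (real m * mass) * (q y)\<^sup>2" if y: "y \<in> Y" for y
  proof -
    have "q y * d \<le> q y * cmod (1 - cis (\<theta> - grid_angle \<delta> m y))"
      using assms(3)[OF y] by (intro mult_left_mono) (auto simp: q_def)
    also have "\<dots> \<le> 2" unfolding q_def by (rule norm_box_poly_cis)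
    finally have "q y \<le> 2 / d" using assms(2) by (simp add: field_simps)
    then have "q y ^ (2 * L) \<le> (2 / d) ^ (2 * L)" by (intro power_mono) (auto simp: q_def)
    then have "q y ^ (2 * L) * (q y)\<^sup>2 \<le> (2 / d) ^ (2 * L) * (q y)\<^sup>2" by (intro mult_right_mono) auto
    moreover have "(q y ^ (L + 1))\<^sup>2 = q y ^ (2 * L) * (q y)\<^sup>2"
    proof -
      have "(L + 1) * 2 = 2 * L + 2" by simp
      then show ?thesis by (metis power_add power_mult)
    qed
    ultimately show ?thesis
      using mass_pos m by (simp add: divide_right_mono)
  qed
  have "(\<Sum>y\<in>Y. (cmod (\<Sum>x<m. fourier \<delta> m y x * (cis \<theta> ^ x * g x)))\<^sup>2)
    \<le> (\<Sum>y\<in>Y. (2 / d) ^ (2 * L) / (real m * mass) * (q y)\<^sup>2)"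
    unfolding est by (intro sum_mono le)
  \<comment> \<open>The decay has been extracted from \<open>L\<close> factors, so the sum of the
    last one may be extended to the whole grid, where Parseval evaluates it to
    \<open>m * w\<close>.\<close>
  also have "\<dots> \<le> (\<Sum>y<m. (2 / d) ^ (2 * L) / (real m * mass) * (q y)\<^sup>2)"
    using assms(1,2) mass_pos m by (intro sum_mono2) auto
  also have "\<dots> = (2 / d) ^ (2 * L) / (real m * mass) * (real m * real w)"
  proof -
    have "degree (box_poly w) < m" using degree_box_poly[of w] w_le_m w_pos by linarith
    from sum_norm_poly_grid[OF this, of \<theta> \<delta>]
    have "(\<Sum>y<m. (q y)\<^sup>2) = real m * (\<Sum>x<m. (cmod (coeff (box_poly w) x))\<^sup>2)"
      by (simp add: q_def)
    also have "(\<Sum>x<m. (cmod (coeff (box_poly w) x))\<^sup>2) = (\<Sum>x<w. 1)"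
      using w_le_m by (intro sum.mono_neutral_cong_right) (auto simp: coeff_box_poly)
    finally show ?thesis by (simp only: sum_distrib_left[symmetric]) simp
  qed
  also have "\<dots> = (2 / d) ^ (2 * L) * real w / mass"
    using m by simp
  also have "\<dots> \<le> (2 / d) ^ (2 * L) * real w / (real w ^ (2 * L + 1) / (real L + 1))"
    using assms(2) w_pos mass_pos by (intro divide_left_mono mass_ge) auto
  also have "\<dots> = (real L + 1) * (2 / (d * real w)) ^ (2 * L)"
    using w_pos by (simp add: power_divide power_mult_distrib)
  finally show ?thesis .
qed

end

section \<open>The algorithm\<close>

text \<open>An eigenbasis and its eigenphases identify an input; different ones may yield the same unitary.\<close>

definition promised_inputs :: "nat \<Rightarrow> real \<Rightarrow> ((nat \<Rightarrow> real) \<times> (nat \<Rightarrow> complex vec)) set" where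
  "promised_inputs N \<delta> = {(\<theta>, u). orthonormal_basis N u \<and> (\<forall>j<N. \<theta> j \<in> {0..<2 * pi}) \<and>
     max_phase N \<theta> \<in> {0..<2 * pi - 2 * \<delta>}}"

lemma eigen_inputs_promised:
  assumes "N > 0"
  shows "eigen_inputs N (promised_inputs N \<delta>) (\<lambda>s j a. snd s j $ a)"
proof
  fix s i j assume s: "s \<in> promised_inputs N \<delta>" and ij: "i < N" "j < N"
  then have "snd s i \<in> carrier_vec N" "snd s j \<in> carrier_vec N"
    "snd s i \<bullet>c snd s j = (if i = j then 1 else 0)"
    by (auto simp: promised_inputs_def orthonormal_basis_def)
  then show "(\<Sum>a<N. snd s i $ a * cnj (snd s j $ a)) = (if i = j then 1 else 0)"
    by (simp add: scalar_prod_def atLeast0LessThan)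
qed (rule assms)

lemma unknown_eigenbasis_inputsE:
  assumes "(V, t) \<in> unknown_eigenbasis_inputs N \<delta>"
  obtains s where "s \<in> promised_inputs N \<delta>" "t = max_phase N (fst s)"
    "V = mat N N (\<lambda>(a, b). \<Sum>j<N. cis (fst s j) * (snd s j $ a * cnj (snd s j $ b)))"
proof -
  obtain \<theta> u where "V = mat N N (\<lambda>(a, b). \<Sum>j<N. cis (\<theta> j) * (u j $ a * cnj (u j $ b)))"
    "t = max_phase N \<theta>" "(\<theta>, u) \<in> promised_inputs N \<delta>"
    using assms by (auto simp: unknown_eigenbasis_inputs_def eigendecomposition_def promised_inputs_def)
  then show thesis using that[of "(\<theta>, u)"] by simp
qed

lemma max_phase_bounds:
  assumes "N > 0"
  shows "j < N \<Longrightarrow> \<theta> j \<le> max_phase N \<theta>" "\<exists>j<N. \<theta> j = max_phase N \<theta>"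
proof -
  show "j < N \<Longrightarrow> \<theta> j \<le> max_phase N \<theta>"
    unfolding max_phase_def by (intro Max_ge) auto
  have "max_phase N \<theta> \<in> \<theta> ` {..<N}"
    unfolding max_phase_def using assms by (intro Max_in) auto
  then show "\<exists>j<N. \<theta> j = max_phase N \<theta>" by auto
qed

lemma power_between:
  fixes r X :: real
  assumes "r > 1" "X \<ge> 1"
  shows "\<exists>I. X \<le> r ^ I \<and> r ^ I \<le> r * X"
proof -
  have ex: "\<exists>I. X \<le> r ^ I"
    using real_arch_pow[OF assms(1), of X] by (meson less_imp_le)
  define I where "I = (LEAST I. X \<le> r ^ I)"
  have I: "X \<le> r ^ I" unfolding I_def using ex by (rule LeastI_ex)
  show ?thesis
  proof (cases I)
    case 0
    then show ?thesis using I assms mult_mono[of 1 r 1 X] by (intro exI[of _ 0]) auto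
  next
    case (Suc i)
    then have "\<not> X \<le> r ^ i" unfolding I_def by (metis lessI not_less_Least)
    then show ?thesis using I Suc assms by (intro exI[of _ I]) auto
  qed
qed

lemma real_nat_ceiling_le:
  assumes "0 \<le> x"
  shows "real (nat \<lceil>x\<rceil>) \<le> x + 1"
proof -
  have "0 \<le> \<lceil>x\<rceil>" unfolding zero_le_ceiling using assms by linarith
  then have "real (nat \<lceil>x\<rceil>) = of_int \<lceil>x\<rceil>" by simp
  then show ?thesis using of_int_ceiling_le_add_one[of x] by simp
qed

section \<open>Parameters and success probability\<close>

context
  fixes N :: nat and \<delta> :: real and L w :: nat
  assumes N: "N \<ge> 2" and \<delta>: "0 < \<delta>" "\<delta> < pi" and w: "24 / \<delta> \<le> real w"
    and L: "2097152 * real N \<le> 8 ^ L"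
begin

lemma w_pos: "w > 0"
proof -
  have "0 < 24 / \<delta>" using \<delta> by simp
  then have "0 < real w" using w by linarith
  then show ?thesis by simp
qed

interpretation W: window L w \<delta>
  by unfold_locales (rule w_pos)

interpretation E: estimation N "promised_inputs N \<delta>" fst "\<lambda>s j a. snd s j $ a" W.m W.n "fourier \<delta> W.m" W.g
proof (intro estimation.intro eigen_inputs_promised estimation_axioms.intro)
  show "N > 0" using N by simp
qed (rule fourier_isometry W.g_norm)+

text \<open>\<open>w\<close> makes the base at most 1/4, which yields 16 ^ L in the denominator. A
  factor 2 ^ L absorbs L + 1, and the remaining 8 ^ L exceeds N by the reserve 2097152 = 8 ^ 7. The
  third of \<delta> comes from \<open>dist_one_cis\<close>.\<close>

lemma tail_bound: "(real L + 1) * (2 / (\<delta> / 3 * real w)) ^ (2 * L) \<le> 1 / (2097152 * real N)"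
proof -
  have "24 \<le> \<delta> * real w" using w \<delta> by (simp add: field_simps)
  then have "2 / (\<delta> / 3 * real w) \<le> 1 / 4"
    by (simp add: field_simps)
  then have "(2 / (\<delta> / 3 * real w)) ^ (2 * L) \<le> (1 / 4) ^ (2 * L)"
    using \<delta> by (intro power_mono) auto
  also have "\<dots> = 1 / (2 ^ L * 8 ^ L)"
    by (simp add: power_mult power_divide flip: power_mult_distrib)
  finally have "(real L + 1) * (2 / (\<delta> / 3 * real w)) ^ (2 * L) \<le> 2 ^ L * (1 / (2 ^ L * 8 ^ L))"
  proof (rule mult_mono[rotated])
    have "L + 1 \<le> 2 ^ L" by (simp add: Suc_le_eq)
    then have "real (L + 1) \<le> real (2 ^ L)" by (simp only: of_nat_le_iff)
    then show "real L + 1 \<le> 2 ^ L" by simp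
  qed (use \<delta> in auto)
  also have "\<dots> = 1 / 8 ^ L" by simp
  also have "\<dots> \<le> 1 / (2097152 * real N)"
    using L N by (intro divide_left_mono) auto
  finally show ?thesis .
qed

lemma estimate_far:
  assumes s: "s \<in> promised_inputs N \<delta>" and j: "j < N"
    and Y: "Y \<subseteq> {..<W.m}" "\<And>y. y \<in> Y \<Longrightarrow> \<delta> \<le> \<bar>fst s j - grid_angle \<delta> W.m y\<bar>"
  shows "(\<Sum>y\<in>Y. (cmod (E.\<sigma> s j y))\<^sup>2) \<le> 1 / (2097152 * real N)"
proof -
  have \<theta>: "0 \<le> fst s j" "fst s j < 2 * pi - 2 * \<delta>"
    using s j N max_phase_bounds(1)[of N j "fst s"] by (auto simp: promised_inputs_def)
  have "\<delta> / 3 \<le> cmod (1 - cis (fst s j - grid_angle \<delta> W.m y))" if y: "y \<in> Y" for y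
  proof (rule dist_one_cis[OF \<delta> Y(2)[OF y]])
    \<comment> \<open>The promise enters here: eigenphases lie below 2 pi - 2 \<delta> and grid
      angles between -\<delta> and 2 pi - \<delta>, so an estimate at distance at least \<delta> on
      the line is also that far away on the circle.\<close>
    have "0 \<le> 2 * pi * real y / real W.m" by simp
    moreover have "2 * pi * real y / real W.m \<le> 2 * pi * 1"
      using y Y(1) unfolding times_divide_eq_right[symmetric]
      by (intro mult_left_mono) (auto simp: divide_le_eq)
    ultimately show "\<bar>fst s j - grid_angle \<delta> W.m y\<bar> \<le> 2 * pi - \<delta>"
      using \<theta> unfolding grid_angle_def abs_le_iff by linarith
  qed
  then have "(\<Sum>y\<in>Y. (cmod (\<Sum>x<W.m. fourier \<delta> W.m y x * (cis (fst s j) ^ x * W.g x)))\<^sup>2)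
    \<le> (real L + 1) * (2 / (\<delta> / 3 * real w)) ^ (2 * L)"
    using Y(1) \<delta> by (intro W.estimate_tail) auto
  moreover have "E.\<sigma> s j y = (\<Sum>x<W.m. fourier \<delta> W.m y x * (cis (fst s j) ^ x * W.g x))" for y
    unfolding E.\<sigma>_def by (intro sum.cong refl) (simp add: E.phase_def W.m_def min_def)
  ultimately show ?thesis using tail_bound by simp
qed

definition too_high :: "real \<Rightarrow> nat set" where
  "too_high t = {y. t + \<delta> < grid_angle \<delta> W.m y}"

text \<open>Such estimates are far from every eigenphase, so each branch obeys the tail bound, and
  so does the average.\<close>

lemma too_high_mass:
  assumes s: "s \<in> promised_inputs N \<delta>"
  shows "(\<Sum>y\<in>{..<W.m} \<inter> too_high (max_phase N (fst s)). E.p s y) \<le> 1 / (2097152 * real N)"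
proof -
  let ?Y = "{..<W.m} \<inter> too_high (max_phase N (fst s))"
  have "(\<Sum>y\<in>?Y. E.p s y) = (\<Sum>j<N. \<Sum>y\<in>?Y. (cmod (E.\<sigma> s j y))\<^sup>2) / N"
    unfolding E.p_def sum_divide_distrib[symmetric] by (subst sum.swap) simp
  also have "\<dots> \<le> (\<Sum>j<N. 1 / (2097152 * real N)) / N"
  proof (intro divide_right_mono sum_mono estimate_far s)
    fix j y assume "j \<in> {..<N}" "y \<in> ?Y"
    then show "\<delta> \<le> \<bar>fst s j - grid_angle \<delta> W.m y\<bar>"
      using max_phase_bounds(1)[of N j "fst s"] N \<delta> by (auto simp: too_high_def)
  qed auto
  also have "\<dots> = 1 / (2097152 * real N)" using N by simp
  finally show ?thesis .
qed

text \<open>The maximal eigenphase has weight 1 / N, and at least half of its estimates are not too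
  low. Estimates that are too high are counted too; \<open>overshoot\<close> deals with
  them.\<close>

lemma near_max_mass:
  assumes s: "s \<in> promised_inputs N \<delta>"
  shows "1 / (2 * real N) \<le> (\<Sum>y\<in>{y. y < W.m \<and> max_phase N (fst s) - \<delta> \<le> grid_angle \<delta> W.m y}. E.p s y)"
proof -
  obtain j where j: "j < N" "fst s j = max_phase N (fst s)"
    using max_phase_bounds(2)[of N "fst s"] N by auto
  let ?A = "{y. y < W.m \<and> max_phase N (fst s) - \<delta> \<le> grid_angle \<delta> W.m y}"
  let ?f = "\<lambda>y. (cmod (E.\<sigma> s j y))\<^sup>2"
  have "complex_of_real (\<Sum>y<W.m. ?f y) = (\<Sum>y<W.m. cnj (E.\<sigma> s j y) * E.\<sigma> s j y)"
    by (simp add: complex_norm_square mult.commute del: of_real_power)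
  then have total: "(\<Sum>y<W.m. ?f y) = 1"
    unfolding E.\<sigma>_norm using of_real_eq_1_iff by blast
  have "(\<Sum>y\<in>{..<W.m} - ?A. ?f y) \<le> 1 / (2097152 * real N)"
    by (rule estimate_far[OF s j(1)]) (use j \<delta> in \<open>auto simp: not_le\<close>)
  also have "\<dots> \<le> 1 / 2" using N by (simp add: field_simps)
  finally have "1 / 2 \<le> (\<Sum>y\<in>?A. ?f y)"
    using total sum.subset_diff[of ?A "{..<W.m}" ?f] by fastforce
  then have "1 / (2 * real N) \<le> (\<Sum>y\<in>?A. ?f y) / N"
    using N by (simp add: field_simps)
  also have "\<dots> = (\<Sum>y\<in>?A. ?f y / N)" by (rule sum_divide_distrib)
  also have "\<dots> \<le> (\<Sum>y\<in>?A. E.p s y)"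
    unfolding E.p_def using j(1)
    by (intro sum_mono divide_right_mono member_le_sum[where f = "\<lambda>j. (cmod (E.\<sigma> s j _))\<^sup>2"]) auto
  finally show ?thesis .
qed

text \<open>The square of 101/100 is below the growth 32/31 that \<open>search_tail\<close>
  permits.\<close>

definition rounds :: "nat \<Rightarrow> nat" where
  "rounds i = nat \<lceil>(101 / 100 :: real) ^ i\<rceil>"

lemma rounds: "(101 / 100) ^ i \<le> real (rounds i)" "real (rounds i) \<le> 2 * (101 / 100) ^ i" "rounds i > 0"
proof -
  have 1: "(1 :: real) \<le> (101 / 100) ^ i" by (intro one_le_power) simp
  show "(101 / 100) ^ i \<le> real (rounds i)"
    unfolding rounds_def by (rule real_nat_ceiling_ge)
  then show "rounds i > 0" using 1 by (cases "rounds i") auto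
  have "real (rounds i) \<le> (101 / 100) ^ i + 1"
    unfolding rounds_def using 1 by (intro real_nat_ceiling_le) linarith
  then show "real (rounds i) \<le> 2 * (101 / 100) ^ i" using 1 by linarith
qed

text \<open>For \<open>t = 0\<close>, when no estimate has been accepted, truncated subtraction
  gives the first grid angle as a default.\<close>

definition output_angle :: "nat \<Rightarrow> real" where
  "output_angle t = grid_angle \<delta> W.m (t - 1)"

text \<open>If a wrong output is not too high, then it is too low or the default, and all estimates
  near the maximum still lie beyond the threshold, so \<tau> is at least 1 / (2 N). Thus the
  right-hand side dominates the failure indicator.\<close>

lemma final_threshold_correct:
  assumes s: "s \<in> promised_inputs N \<delta>" and t: "t \<le> W.m"
    and wrong: "output_angle t \<notin> correct_outputs \<delta> (max_phase N (fst s))"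
  shows "1 \<le> E.overshoot (too_high (max_phase N (fst s))) t + 2 * real N * E.\<tau> s t"
proof (cases "t > 0 \<and> t - 1 \<in> too_high (max_phase N (fst s))")
  case True
  then show ?thesis using E.\<tau>_nonneg[of s t] by (simp add: E.overshoot_def)
next
  case False
  let ?\<theta> = "max_phase N (fst s)"
  let ?A = "{y. y < W.m \<and> ?\<theta> - \<delta> \<le> grid_angle \<delta> W.m y}"
  have "?A \<subseteq> {t..<W.m}"
  proof (cases "t > 0")
    case True
    then have "grid_angle \<delta> W.m (t - 1) \<le> ?\<theta> + \<delta>" using False by (auto simp: too_high_def)
    moreover have "grid_angle \<delta> W.m (t - 1) \<notin> {?\<theta> - \<delta>..?\<theta> + \<delta>}"
      using wrong by (auto simp: correct_outputs_def output_angle_def dest: spec[of _ "0 :: int"])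
    ultimately have lt: "grid_angle \<delta> W.m (t - 1) < ?\<theta> - \<delta>" by auto
    have "t \<le> y" if "y \<in> ?A" for y
    proof (rule ccontr)
      assume "\<not> t \<le> y"
      then have "real y \<le> real (t - 1)" by linarith
      then have "grid_angle \<delta> W.m y \<le> grid_angle \<delta> W.m (t - 1)"
        by (auto simp: grid_angle_def intro!: divide_right_mono mult_left_mono)
      then show False using lt that by auto
    qed
    then show ?thesis by auto
  qed auto
  then have "1 / (2 * real N) \<le> E.\<tau> s t"
    unfolding E.\<tau>_def
    by (intro order_trans[OF near_max_mass[OF s]] sum_mono2) (auto simp: E.p_nonneg)
  then have "1 \<le> 2 * real N * E.\<tau> s t" using N by (simp add: field_simps)
  moreover have "E.overshoot (too_high ?\<theta>) t \<ge> 0" by (simp add: E.overshoot_def)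
  ultimately show ?thesis by linarith
qed

text \<open>The last power of 101/100 has a square between 40 N and 41 N. The expected tail is then
  at most 1 / (20 N), which contributes 1/10. The total amplification is at most 32800 N against a
  false mass of 1 / (2097152 N), which contributes less than 1/10. Failure has probability at most
  1/5.\<close>

lemma search_success:
  assumes s: "s \<in> promised_inputs N \<delta>"
    and I: "sqrt (40 * real N) \<le> (101 / 100) ^ I" "(101 / 100) ^ I \<le> 101 / 100 * sqrt (40 * real N)"
  shows "2 / 3 \<le> (\<Sum>t\<le>W.m. if output_angle t \<in> correct_outputs \<delta> (max_phase N (fst s))
    then E.search_prob rounds s I t else 0)"
proof -
  let ?r = "101 / 100 :: real" and ?H = "too_high (max_phase N (fst s))"
  let ?q = "E.search_prob rounds s I" and ?T = "correct_outputs \<delta> (max_phase N (fst s))"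
  have N0: "real N > 0" using N by simp
  have M: "\<And>i. rounds i > 0" by (rule rounds)
  have sq: "40 * real N \<le> (?r ^ I)\<^sup>2" "(?r ^ I)\<^sup>2 \<le> 41 * real N"
  proof -
    have "(sqrt (40 * real N))\<^sup>2 \<le> (?r ^ I)\<^sup>2" using I(1) by (intro power_mono) auto
    then show "40 * real N \<le> (?r ^ I)\<^sup>2" by simp
    have "(?r ^ I)\<^sup>2 \<le> (?r * sqrt (40 * real N))\<^sup>2" using I(2) by (intro power_mono) auto
    also have "\<dots> = ?r\<^sup>2 * (40 * real N)" by (simp only: power_mult_distrib) simp
    also have "\<dots> \<le> 41 * real N" by (simp add: power2_eq_square)
    finally show "(?r ^ I)\<^sup>2 \<le> 41 * real N" .
  qed
  have "(\<Sum>t\<le>W.m. E.\<tau> s t * ?q t) \<le> 2 / (?r ^ I)\<^sup>2"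
    by (rule E.search_tail[OF M]) (auto simp: rounds power2_eq_square)
  also have "\<dots> \<le> 2 / (40 * real N)"
    using sq(1) N0 by (intro divide_left_mono mult_pos_pos) auto
  finally have tail: "2 * real N * (\<Sum>t\<le>W.m. E.\<tau> s t * ?q t) \<le> 1 / 10"
    using N0 by (simp add: field_simps)
  have "(\<Sum>j<I. 4 * (real (rounds j))\<^sup>2) \<le> (\<Sum>j<I. 16 * (?r\<^sup>2) ^ j)"
  proof (rule sum_mono)
    fix j
    have "(real (rounds j))\<^sup>2 \<le> (2 * ?r ^ j)\<^sup>2" by (intro power_mono rounds) auto
    then show "4 * (real (rounds j))\<^sup>2 \<le> 16 * (?r\<^sup>2) ^ j"
      by (simp add: power_mult_distrib power_mult[symmetric] mult.commute)
  qed
  also have "\<dots> = 16 * (((?r\<^sup>2) ^ I - 1) / (?r\<^sup>2 - 1))"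
    by (simp add: sum_distrib_left[symmetric] geometric_sum power2_eq_square)
  \<comment> \<open>The ratio exceeds 1 by 0.0201, and 16 / 0.0201 < 800.\<close>
  also have "\<dots> \<le> 800 * (?r\<^sup>2) ^ I"
    by (simp add: power2_eq_square field_simps)
  also have "(?r\<^sup>2) ^ I = (?r ^ I)\<^sup>2" by (simp add: power_mult[symmetric] mult.commute)
  finally have sumM: "(\<Sum>j<I. 4 * (real (rounds j))\<^sup>2) \<le> 32800 * real N" using sq(2) by linarith
  have "(\<Sum>t\<le>W.m. E.overshoot ?H t * ?q t)
    \<le> (\<Sum>j<I. 4 * (real (rounds j))\<^sup>2) * (\<Sum>y\<in>{..<W.m} \<inter> ?H. E.p s y)"
    by (rule E.search_overshoot[OF M])
  also have "\<dots> \<le> 32800 * real N * (1 / (2097152 * real N))"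
    by (intro mult_mono sumM too_high_mass s sum_nonneg E.p_nonneg) auto
  also have "\<dots> \<le> 1 / 10" using N0 by simp
  finally have over: "(\<Sum>t\<le>W.m. E.overshoot ?H t * ?q t) \<le> 1 / 10" .
  have "(\<Sum>t\<le>W.m. 1 * ?q t) - (\<Sum>t\<le>W.m. if output_angle t \<in> ?T then ?q t else 0)
    = (\<Sum>t\<le>W.m. if output_angle t \<in> ?T then 0 else ?q t)"
    unfolding sum_subtractf[symmetric] by (intro sum.cong refl) auto
  also have "\<dots> \<le> (\<Sum>t\<le>W.m. (E.overshoot ?H t + 2 * real N * E.\<tau> s t) * ?q t)"
  proof (rule sum_mono)
    fix t assume "t \<in> {..W.m}"
    then have t: "t \<le> W.m" by simp
    have q: "?q t \<ge> 0" by (rule E.search_prob_nonneg[OF M])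
    show "(if output_angle t \<in> ?T then 0 else ?q t) \<le> (E.overshoot ?H t + 2 * real N * E.\<tau> s t) * ?q t"
    proof (cases "output_angle t \<in> ?T")
      case True
      then show ?thesis using q N0 E.\<tau>_nonneg[of s t] by (simp add: E.overshoot_def)
    next
      case False
      from mult_right_mono[OF final_threshold_correct[OF s t False] q] show ?thesis
        using False by simp
    qed
  qed
  also have "\<dots> = (\<Sum>t\<le>W.m. E.overshoot ?H t * ?q t) + 2 * real N * (\<Sum>t\<le>W.m. E.\<tau> s t * ?q t)"
    by (simp add: distrib_right sum.distrib sum_distrib_left mult.assoc)
  finally show ?thesis
    using tail over E.search_total[where M = rounds and s = s and i = I, OF M] by linarith
qed

lemma maxQPE_algorithm:
  "\<exists>A. quantum_algorithm N A \<and> solves_maxQPE_on N \<delta> (unknown_eigenbasis_inputs N \<delta>) A \<and>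
    real (cost A) \<le> 7000 * sqrt (real N) * real ((L + 1) * (w - 1))"
proof -
  let ?r = "101 / 100 :: real"
  have "1 \<le> sqrt (40 * real N)" using N by simp
  then obtain I where I: "sqrt (40 * real N) \<le> ?r ^ I" "?r ^ I \<le> ?r * sqrt (40 * real N)"
    using power_between[of ?r "sqrt (40 * real N)"] by auto
  obtain A where A: "quantum_algorithm N A" "cost A = (\<Sum>j<I. W.n + rounds j * (2 * W.n))"
    "\<And>s T. s \<in> promised_inputs N \<delta> \<Longrightarrow> output_prob N A (E.input_mat s) T
      = (\<Sum>t\<le>W.m. if output_angle t \<in> T then E.search_prob rounds s I t else 0)"
    using E.search_algorithm[of rounds I output_angle] rounds(3) by blast
  have "solves_maxQPE_on N \<delta> (unknown_eigenbasis_inputs N \<delta>) A"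
    unfolding solves_maxQPE_on_def
  proof (intro ballI, clarify)
    fix V t assume "(V, t) \<in> unknown_eigenbasis_inputs N \<delta>"
    then obtain s where s: "s \<in> promised_inputs N \<delta>" "t = max_phase N (fst s)" "V = E.input_mat s"
      by (rule unknown_eigenbasis_inputsE) (auto simp: E.input_mat_def E.U_def)
    then show "2 / 3 \<le> output_prob N A V (correct_outputs \<delta> t)"
      using search_success[OF s(1) I] by (simp add: A(3))
  qed
  moreover have "real (cost A) \<le> 7000 * sqrt (real N) * real ((L + 1) * (w - 1))"
  proof -
    have "real (cost A) = (\<Sum>j<I. real W.n * (1 + 2 * real (rounds j)))"
      unfolding A(2) of_nat_sum by (intro sum.cong refl) (simp add: algebra_simps)
    also have "\<dots> \<le> (\<Sum>j<I. real W.n * (5 * ?r ^ j))"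
    proof (intro sum_mono mult_left_mono)
      fix j
      have "(1 :: real) \<le> ?r ^ j" by (intro one_le_power) simp
      then show "1 + 2 * real (rounds j) \<le> 5 * ?r ^ j" using rounds(2)[of j] by linarith
    qed simp
    \<comment> \<open>A geometric sum of ratio 101/100 contributes the factor 100. Together with the
      factor 14 in the next step this gives 7000.\<close>
    also have "\<dots> = 500 * real W.n * (?r ^ I - 1)"
      by (simp add: sum_distrib_left[symmetric] geometric_sum)
    also have "\<dots> \<le> 500 * real W.n * (14 * sqrt (real N))"
    proof (rule mult_left_mono)
      have "sqrt 40 \<le> 7" by (rule real_le_lsqrt) auto
      then have "sqrt (40 * real N) \<le> 7 * sqrt (real N)"
        unfolding real_sqrt_mult by (intro mult_right_mono) auto
      then show "?r ^ I - 1 \<le> 14 * sqrt (real N)"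
        using I(2) real_sqrt_ge_zero[of "real N"] by linarith
    qed simp
    finally show ?thesis by (simp add: W.n_def mult_ac)
  qed
  ultimately show ?thesis using A(1) by blast
qed

end

text \<open>For \<delta> at least pi no input satisfies the promise, and any algorithm without
  queries will do.\<close>

lemma trivial_algorithm:
  assumes "N > 0"
  shows "\<exists>A. quantum_algorithm N A \<and> cost A = 0"
proof -
  interpret query_inputs N "{} :: unit set" "\<lambda>_ _ _. 0"
    by unfold_locales (rule assms)
  show ?thesis
    using query_steps_outcomes_algorithm[where p = "[]" and X = "{()}" and K = "\<lambda>_ _ _. 1"
        and out = "\<lambda>_. 0"] is_gram_const[of 1]
    by auto
qed

theorem lemma4p4:
  shows "\<exists>C::real. C > 0 \<and>
    (\<forall>(N::nat) (\<delta>::real). N \<ge> 2 \<longrightarrow> \<delta> > 0 \<longrightarrow>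
      (\<exists>A. quantum_algorithm N A \<and>
           solves_maxQPE_on N \<delta> (unknown_eigenbasis_inputs N \<delta>) A \<and>
           solves_maxQPE_on N \<delta> (known_eigenbasis_inputs N \<delta>) A \<and>
           real (cost A) \<le> C * (sqrt (real N) * log 2 (real N) / \<delta>)))"
proof (intro exI[of _ "2000000"] conjI allI impI)
  fix N :: nat and \<delta> :: real
  assume N: "N \<ge> 2" and \<delta>: "\<delta> > 0"
  have log_ge: "1 \<le> log 2 (real N)" using N by simp
  have "\<exists>A. quantum_algorithm N A \<and> solves_maxQPE_on N \<delta> (unknown_eigenbasis_inputs N \<delta>) A \<and>
    real (cost A) \<le> 2000000 * (sqrt (real N) * log 2 (real N) / \<delta>)"
  proof (cases "\<delta> < pi")
    case True
    define w where "w = nat \<lceil>24 / \<delta>\<rceil>"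
    define l where "l = nat \<lceil>log 2 (real N)\<rceil>"
    have wpos: "0 < 24 / \<delta>" using \<delta> by simp
    have w: "24 / \<delta> \<le> real w" "real (w - 1) \<le> 24 / \<delta>"
    proof -
      show le: "24 / \<delta> \<le> real w" unfolding w_def by (rule real_nat_ceiling_ge)
      have "real w \<le> 24 / \<delta> + 1"
        unfolding w_def using wpos by (intro real_nat_ceiling_le) simp
      moreover have "w > 0" using le wpos by (cases w) auto
      ultimately show "real (w - 1) \<le> 24 / \<delta>" by (simp add: of_nat_diff)
    qed
    have l: "log 2 (real N) \<le> real l" "real l \<le> log 2 (real N) + 1"
      unfolding l_def using log_ge by (auto intro: real_nat_ceiling_ge real_nat_ceiling_le)
    have "real N = 2 powr log 2 (real N)" using N by simp
    also have "\<dots> \<le> 2 powr real l" by (intro powr_mono l) simp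
    also have "\<dots> = 2 ^ l" by (simp add: powr_realpow)
    also have "\<dots> \<le> 8 ^ l" by (intro power_mono) auto
    \<comment> \<open>Seven additional factors of 8 provide the reserve 8 ^ 7 = 2097152.\<close>
    finally have "2097152 * real N \<le> 8 ^ (l + 7)" by (simp add: power_add)
    from maxQPE_algorithm[OF N \<delta> True w(1) this] obtain A where
      A: "quantum_algorithm N A" "solves_maxQPE_on N \<delta> (unknown_eigenbasis_inputs N \<delta>) A"
      "real (cost A) \<le> 7000 * sqrt (real N) * real ((l + 7 + 1) * (w - 1))" by blast
    have "real ((l + 7 + 1) * (w - 1)) = (real l + 8) * real (w - 1)"
      unfolding of_nat_mult by simp
    \<comment> \<open>\<open>l + 8\<close> is at most log N + 9, and log N is at least 1.\<close>
    also have "\<dots> \<le> (10 * log 2 (real N)) * (24 / \<delta>)"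
      using l log_ge w(2) by (intro mult_mono) auto
    finally have "7000 * sqrt (real N) * real ((l + 7 + 1) * (w - 1))
      \<le> 7000 * sqrt (real N) * ((10 * log 2 (real N)) * (24 / \<delta>))"
      by (intro mult_left_mono) auto
    also have "\<dots> = 1680000 * (sqrt (real N) * log 2 (real N) / \<delta>)" by simp
    also have "\<dots> \<le> 2000000 * (sqrt (real N) * log 2 (real N) / \<delta>)"
      using log_ge \<delta> by (intro mult_right_mono) auto
    finally show ?thesis using A by (intro exI[of _ A]) auto
  next
    case False
    then have "unknown_eigenbasis_inputs N \<delta> = {}"
      by (auto simp: unknown_eigenbasis_inputs_def)
    moreover obtain A where "quantum_algorithm N A" "cost A = 0"
      using trivial_algorithm[of N] N by auto
    moreover have "0 \<le> 2000000 * (sqrt (real N) * log 2 (real N) / \<delta>)"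
      using log_ge \<delta> by simp
    ultimately show ?thesis
      by (intro exI[of _ A]) (simp add: solves_maxQPE_on_def)
  qed
  then show "\<exists>A. quantum_algorithm N A \<and>
           solves_maxQPE_on N \<delta> (unknown_eigenbasis_inputs N \<delta>) A \<and>
           solves_maxQPE_on N \<delta> (known_eigenbasis_inputs N \<delta>) A \<and>
           real (cost A) \<le> 2000000 * (sqrt (real N) * log 2 (real N) / \<delta>)"
    unfolding solves_maxQPE_on_def known_eigenbasis_inputs_def by blast
qed simp

end
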